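(* Let $n \in \mathbb{N}$, let $F$ be a field, let $\mathcal{T}$ be a triangularizable set of matrices in $M_n(F)$, let $\mathcal{N}$ be the set of all nilpotent matrices in $M_n(F)$, and let $\mathcal{T}'$ be the commutant of $\mathcal{T}$. Let $\mathcal{S}$ be a semigroup in $M_n(F)$ such that every member of $\mathcal{S}$ is of the form $T + N$ with $T \in \mathcal{T}$ and $N \in \mathcal{T}' \cap \mathcal{N}$. Then the semigroup $\mathcal{S}$ is triangularizable.
   Context: $M_n(F)$ is the algebra of all $n \times n$ matrices over $F$, whose members are viewed as linear transformations on the space $F^n$ of column vectors. A semigroup in $M_n(F)$ is a set of matrices closed under multiplication. The commutant of a collection $\mathcal{C} \subseteq M_n(F)$ is $\mathcal{C}' = \{A \in M_n(F) : AB = BA \ \text{for all}\ B \in \mathcal{C}\}$. A collection $\mathcal{C} \subseteq M_n(F)$ is triangularizable if there are subspaces $\{0\} = \mathcal{V}_0 \subseteq \mathcal{V}_1 \subseteq \cdots \subseteq \mathcal{V}_n = F^n$ such that $\dim \mathcal{V}_j = j$ and each $\mathcal{V}_j$ is invariant under every member of $\mathcal{C}$ (the same chain for all members). *)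

theory Defs
  imports "Jordan_Normal_Form.VS_Connect"
begin

definition matrix_semigroup :: "nat \<Rightarrow> 'a :: field mat set \<Rightarrow> bool" where
  "matrix_semigroup n S \<longleftrightarrow> S \<subseteq> carrier_mat n n \<and> (\<forall>A\<in>S. \<forall>B\<in>S. A * B \<in> S)"

definition commutant :: "nat \<Rightarrow> 'a :: field mat set \<Rightarrow> 'a mat set" where
  "commutant n C = {A \<in> carrier_mat n n. \<forall>B\<in>C. A * B = B * A}"

definition nilpotent_mats :: "nat \<Rightarrow> 'a :: field mat set" where
  "nilpotent_mats n = {A \<in> carrier_mat n n. \<exists>k. A ^\<^sub>m k = 0\<^sub>m n n}"

text \<open>\<^term>\<open>class_ring\<close> is the scalar field given by the type class, and
  \<^term>\<open>module_vec TYPE('a :: field) n\<close> is the space of column vectors of dimension \<open>n\<close>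
  over it; a subspace becomes a vector space in its own right by restricting the carrier.\<close>

definition triangularizable :: "nat \<Rightarrow> 'a :: field mat set \<Rightarrow> bool" where
  "triangularizable n C \<longleftrightarrow>
    (\<exists>V :: nat \<Rightarrow> 'a vec set.
      V 0 = {0\<^sub>v n} \<and> V n = carrier_vec n \<and>
      (\<forall>j<n. V j \<subseteq> V (Suc j)) \<and>
      (\<forall>j\<le>n. subspace class_ring (V j) (module_vec TYPE('a) n) \<and>
             vectorspace.dim class_ring ((module_vec TYPE('a) n)\<lparr>carrier := V j\<rparr>) = j \<and>
             (\<forall>A\<in>C. \<forall>v\<in>V j. A *\<^sub>v v \<in> V j)))"

end

theory Submission
  imports Defs "HOL-Algebra.Algebraic_Closure_Type" "HOL-Algebra.Sylow" "HOL-Algebra.Group_Action"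
    "Jordan_Normal_Form.Char_Poly"
begin

text \<open>Let \<open>W\<close> be a proper subspace invariant under \<open>\<T>\<close> and \<open>\<S>\<close>. Since \<open>\<T>\<close> is triangularizable,
  it has a nonzero joint eigenspace \<open>E/W\<close> in the quotient by \<open>W\<close>. The nilpotent parts commute with
  \<open>\<T>\<close>, so they preserve \<open>E\<close>, and \<open>\<S>\<close> acts on \<open>E/W\<close> by matrices of the form scalar plus nilpotent.
  Kaplansky's theorem provides a common eigenvector of \<open>\<S>\<close> in \<open>E/W\<close>; it is one of \<open>\<T>\<close> as well, so
  \<open>W\<close> can be enlarged by one dimension.

  For Kaplansky's theorem one may pass to the algebraic closure (a linear functional brings a common
  eigenvector back) and to an irreducible semigroup of size \<open>n\<close>. If it is not scalar, then its span
  contains an element of rank one, so the trace form is nondegenerate on it. As the trace of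
  \<open>l + N\<close> is \<open>n l\<close>, this forces \<open>n \<noteq> 0\<close> in the field and \<open>l \<noteq> 0\<close> on nonzero elements. The
  unipotent parts \<open>1 + N / l\<close>, multiplied up to scalars, form a group, which is finite because by
  determinants the traces of its products take finitely many values. A nontrivial unipotent of
  finite order exists only in positive characteristic \<open>p\<close>, so this is a nontrivial \<open>p\<close>-group. An
  element of its center commutes with the semigroup, and its eigenspace contradicts irreducibility.\<close>

section \<open>Subspaces and bases modulo a subspace\<close>

text \<open>The eigenvalue \<open>L A\<close> is not known to be multiplicative: determinants only
  give \<open>L (A * B) ^ n = L A ^ n * L B ^ n\<close>, so \<open>L\<close> respects products up to
  \<open>n\<close>-th roots of unity. This is why unipotent parts have to be rescaled after each
  multiplication, and it is also what leaves only finitely many traces. The difficulty is positive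
  characteristic, where a unipotent matrix other than 1 can have finite order; finiteness of the
  group alone is then no contradiction, and its center is needed. Elements of rank one matter
  because, for \<open>T y = f y \<cdot> u\<close>, the trace of \<open>X T\<close> is the value
  \<open>f (X u)\<close>; traces against such elements read off single entries, and transitivity of
  the span reaches all of them. The chain is built to be invariant under \<T> as well as \<S>,
  although only \<S> is asked for: the nilpotent part \<open>N = A - T\<close> is seen to preserve
  \<open>W\<close> because \<open>A\<close> and \<open>T\<close> both do. No quotient space is ever
  formed; \<open>E/W\<close> is represented by a matrix whose columns are a basis of
  \<open>E\<close> modulo \<open>W\<close>, and induced maps become smaller matrices.\<close>

definition lin_sub :: "nat \<Rightarrow> 'a :: field vec set \<Rightarrow> bool" where
  "lin_sub n W \<longleftrightarrow> W \<subseteq> carrier_vec n \<and> 0\<^sub>v n \<in> W \<and>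
     (\<forall>x\<in>W. \<forall>y\<in>W. x + y \<in> W) \<and> (\<forall>c. \<forall>x\<in>W. c \<cdot>\<^sub>v x \<in> W)"

lemma lin_subD:
  assumes "lin_sub n W"
  shows "x \<in> W \<Longrightarrow> x \<in> carrier_vec n" "0\<^sub>v n \<in> W"
    "x \<in> W \<Longrightarrow> y \<in> W \<Longrightarrow> x + y \<in> W" "x \<in> W \<Longrightarrow> c \<cdot>\<^sub>v x \<in> W"
  using assms by (auto simp: lin_sub_def)

lemma lin_sub_minus:
  assumes "lin_sub n W" "x \<in> W" "y \<in> W"
  shows "x - y \<in> W"
proof -
  have "x - y = x + (-1) \<cdot>\<^sub>v y"
    using lin_subD(1)[OF assms(1)] assms(2,3) by (intro eq_vecI) (auto dest!: carrier_vecD)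
  then show ?thesis using lin_subD[OF assms(1)] assms by metis
qed

lemma lin_sub_zero: "lin_sub n {0\<^sub>v n}"
  by (auto simp: lin_sub_def)

lemma lin_sub_carrier: "lin_sub n (carrier_vec n)"
  by (auto simp: lin_sub_def)

lemma lin_sub_diff_trans:
  assumes "lin_sub n W" "x \<in> carrier_vec n" "y \<in> carrier_vec n" "z \<in> carrier_vec n"
    and "x - y \<in> W" "y - z \<in> W"
  shows "x - z \<in> W"
proof -
  have "x - z = (x - y) + (y - z)" using assms(2-4) by (intro eq_vecI) auto
  then show ?thesis using lin_subD(3)[OF assms(1) assms(5,6)] by simp
qed

lemma lin_sub_diff_sym:
  assumes "lin_sub n W" "x \<in> carrier_vec n" "y \<in> carrier_vec n" "x - y \<in> W"
  shows "y - x \<in> W"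
proof -
  have "y - x = (-1) \<cdot>\<^sub>v (x - y)" using assms(2,3) by (intro eq_vecI) auto
  then show ?thesis using lin_subD(4)[OF assms(1) assms(4)] by simp
qed

lemma lin_sub_diff_mem:
  assumes "lin_sub n W" "x \<in> carrier_vec n" "y \<in> W" "x - y \<in> W"
  shows "x \<in> W"
proof -
  have "y \<in> carrier_vec n" using lin_subD(1)[OF assms(1)] assms(3) by blast
  then have "x = (x - y) + y" using assms(2) by (intro eq_vecI) auto
  then show ?thesis using lin_subD(3)[OF assms(1) assms(4,3)] by simp
qed

lemma mult_mat_vec_lin_sub_image:
  assumes "A \<in> carrier_mat n m" "lin_sub m U"
  shows "lin_sub n ((\<lambda>x. A *\<^sub>v x) ` U)"
proof -
  have U: "x \<in> carrier_vec m" if "x \<in> U" for x using lin_subD(1)[OF assms(2) that] .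
  show ?thesis unfolding lin_sub_def
  proof (intro conjI ballI allI)
    show "(\<lambda>x. A *\<^sub>v x) ` U \<subseteq> carrier_vec n" using assms(1) U by auto
    have "A *\<^sub>v 0\<^sub>v m = 0\<^sub>v n" using assms(1) by (intro eq_vecI) auto
    then show "0\<^sub>v n \<in> (\<lambda>x. A *\<^sub>v x) ` U" using lin_subD(2)[OF assms(2)] by (metis imageI)
  next
    fix x y assume "x \<in> (\<lambda>x. A *\<^sub>v x) ` U" "y \<in> (\<lambda>x. A *\<^sub>v x) ` U"
    then obtain a b where ab: "a \<in> U" "b \<in> U" "x = A *\<^sub>v a" "y = A *\<^sub>v b" by auto
    then have "x + y = A *\<^sub>v (a + b)" using mult_add_distrib_mat_vec[OF assms(1) U U] by simp
    then show "x + y \<in> (\<lambda>x. A *\<^sub>v x) ` U" using lin_subD(3)[OF assms(2)] ab by blast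
  next
    fix c x assume "x \<in> (\<lambda>x. A *\<^sub>v x) ` U"
    then obtain a where ab: "a \<in> U" "x = A *\<^sub>v a" by auto
    then have "c \<cdot>\<^sub>v x = A *\<^sub>v (c \<cdot>\<^sub>v a)" using mult_mat_vec[OF assms(1) U] by simp
    then show "c \<cdot>\<^sub>v x \<in> (\<lambda>x. A *\<^sub>v x) ` U" using lin_subD(4)[OF assms(2)] ab by blast
  qed
qed

lemma lin_sub_preimage:
  assumes "A \<in> carrier_mat n m" "lin_sub n W"
  shows "lin_sub m {x \<in> carrier_vec m. A *\<^sub>v x \<in> W}"
proof -
  have "A *\<^sub>v 0\<^sub>v m = 0\<^sub>v n" using assms(1) by (intro eq_vecI) auto
  then show ?thesis using lin_subD[OF assms(2)] mult_add_distrib_mat_vec[OF assms(1)] mult_mat_vec[OF assms(1)]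
    unfolding lin_sub_def by auto
qed

section \<open>Matrices whose columns represent a basis modulo a subspace\<close>

definition add_col :: "nat \<Rightarrow> nat \<Rightarrow> 'a mat \<Rightarrow> 'a vec \<Rightarrow> 'a mat" where
  "add_col n m P x = mat n (Suc m) (\<lambda>(i,j). if j < m then P $$ (i,j) else x $ i)"

lemma add_col_carrier [simp]: "add_col n m P x \<in> carrier_mat n (Suc m)"
  by (simp add: add_col_def)

lemma add_col_mult_vec:
  fixes P :: "'a :: field mat"
  assumes "P \<in> carrier_mat n m" "x \<in> carrier_vec n" "c \<in> carrier_vec (Suc m)"
  shows "add_col n m P x *\<^sub>v c = P *\<^sub>v vec m (($) c) + c $ m \<cdot>\<^sub>v x"
  using assms by (intro eq_vecI) (auto simp: add_col_def scalar_prod_def intro!: sum.cong)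

text \<open>If \<open>m > n\<close>, padding \<open>P\<close> with zero rows gives a square matrix
  of determinant 0, and a kernel vector of it is one of \<open>P\<close>.\<close>

lemma injective_mat_le:
  fixes P :: "'a :: field mat"
  assumes P: "P \<in> carrier_mat n m"
    and inj: "\<And>c. c \<in> carrier_vec m \<Longrightarrow> P *\<^sub>v c = 0\<^sub>v n \<Longrightarrow> c = 0\<^sub>v m"
  shows "m \<le> n"
proof (rule ccontr)
  assume "\<not> m \<le> n"
  then have nm: "n < m" by simp
  define P' where "P' = mat m m (\<lambda>(i,j). if i < n then P $$ (i,j) else 0)"
  have P': "P' \<in> carrier_mat m m" by (simp add: P'_def)
  \<comment> \<open>Row \<open>n\<close> of \<open>P'\<close> is one of the padded zero rows, so the
    transpose kills this unit vector and both determinants vanish.\<close>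
  have "P'\<^sup>T *\<^sub>v unit_vec m n = 0\<^sub>v m"
    using nm by (intro eq_vecI) (auto simp: P'_def)
  moreover have "unit_vec m n \<noteq> (0\<^sub>v m :: 'a vec)" using nm by simp
  ultimately have "det P'\<^sup>T = 0"
    using det_0_iff_vec_prod_zero[of "P'\<^sup>T" m] P' by (metis transpose_carrier_mat unit_vec_carrier)
  then have "det P' = 0" using det_transpose[OF P'] by simp
  then obtain v where v: "v \<in> carrier_vec m" "v \<noteq> 0\<^sub>v m" "P' *\<^sub>v v = 0\<^sub>v m"
    using det_0_iff_vec_prod_zero[OF P'] by blast
  have "P *\<^sub>v v = 0\<^sub>v n"
  proof (intro eq_vecI)
    fix i assume "i < dim_vec (0\<^sub>v n :: 'a vec)"
    then have i: "i < n" by simp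
    have "(P *\<^sub>v v) $ i = (P' *\<^sub>v v) $ i"
      using i nm P v(1) by (auto simp: P'_def scalar_prod_def intro!: sum.cong)
    then show "(P *\<^sub>v v) $ i = 0\<^sub>v n $ i" using v(3) i nm by (simp del: index_mult_mat_vec)
  qed (use P in auto)
  then show False using inj v by blast
qed

text \<open>For \<open>W \<subseteq> E\<close> the columns of \<open>P\<close> represent a basis of
  \<open>E/W\<close>; with \<open>W = {0\<^sub>v n}\<close> they are an ordinary basis of
  \<open>E\<close>. Encoding the basis as a matrix makes the passage from coordinates to vectors a
  matrix product.\<close>

definition basis_mat :: "nat \<Rightarrow> nat \<Rightarrow> 'a :: field vec set \<Rightarrow> 'a vec set \<Rightarrow> 'a mat \<Rightarrow> bool" where
  "basis_mat n m W E P \<longleftrightarrow> P \<in> carrier_mat n m \<and>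
     (\<forall>c\<in>carrier_vec m. P *\<^sub>v c \<in> E \<and> (P *\<^sub>v c \<in> W \<longrightarrow> c = 0\<^sub>v m)) \<and>
     (\<forall>x\<in>E. \<exists>c\<in>carrier_vec m. x - P *\<^sub>v c \<in> W)"

lemma basis_matD:
  assumes "basis_mat n m W E P"
  shows "P \<in> carrier_mat n m" "c \<in> carrier_vec m \<Longrightarrow> P *\<^sub>v c \<in> E"
    "c \<in> carrier_vec m \<Longrightarrow> P *\<^sub>v c \<in> W \<Longrightarrow> c = 0\<^sub>v m"
    "x \<in> E \<Longrightarrow> \<exists>c\<in>carrier_vec m. x - P *\<^sub>v c \<in> W"
  using assms by (auto simp: basis_mat_def)

lemma basis_mat_le:
  assumes "lin_sub n W" "basis_mat n m W E P"
  shows "m \<le> n"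
  using injective_mat_le[OF basis_matD(1)[OF assms(2)]] basis_matD(3)[OF assms(2)] lin_subD(2)[OF assms(1)]
  by metis

text \<open>A nonzero last coordinate could be divided out, which would exhibit \<open>x\<close> as
  a combination of the columns of \<open>P\<close> modulo \<open>W\<close>. So it vanishes, and the
  independence of \<open>P\<close> settles the rest.\<close>

lemma add_col_injective:
  fixes P :: "'a :: field mat"
  assumes W: "lin_sub n W" and P: "P \<in> carrier_mat n m"
    and inj: "\<And>c. c \<in> carrier_vec m \<Longrightarrow> P *\<^sub>v c \<in> W \<Longrightarrow> c = 0\<^sub>v m"
    and x: "x \<in> carrier_vec n" and no: "\<And>c. c \<in> carrier_vec m \<Longrightarrow> x - P *\<^sub>v c \<notin> W"
    and c: "c \<in> carrier_vec (Suc m)" and mem: "add_col n m P x *\<^sub>v c \<in> W"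
  shows "c = 0\<^sub>v (Suc m)"
proof -
  let ?d = "vec m (($) c)"
  have eq: "P *\<^sub>v ?d + c $ m \<cdot>\<^sub>v x \<in> W" using mem add_col_mult_vec[OF P x c] by simp
  have cm: "c $ m = 0"
  proof (rule ccontr)
    assume nz: "c $ m \<noteq> 0"
    have "x - P *\<^sub>v ((- 1 / c $ m) \<cdot>\<^sub>v ?d) = (1 / c $ m) \<cdot>\<^sub>v (P *\<^sub>v ?d + c $ m \<cdot>\<^sub>v x)"
      using P x nz mult_mat_vec[OF P, of ?d "- 1 / c $ m"] by (intro eq_vecI) (auto simp: field_simps)
    then show False using no[of "(- 1 / c $ m) \<cdot>\<^sub>v ?d"] lin_subD(4)[OF W eq] by simp
  qed
  then have "P *\<^sub>v ?d + c $ m \<cdot>\<^sub>v x = P *\<^sub>v ?d" using P x by (intro eq_vecI) auto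
  then have "?d = 0\<^sub>v m" using inj[of ?d] eq by simp
  then have "c $ i = 0" if "i < m" for i using that by (metis index_vec index_zero_vec(1))
  then show ?thesis using cm c by (intro eq_vecI) (auto simp: less_Suc_eq)
qed

lemma add_col_mem:
  assumes "lin_sub n E" "P \<in> carrier_mat n m" "\<And>c. c \<in> carrier_vec m \<Longrightarrow> P *\<^sub>v c \<in> E"
    and "x \<in> E" "c \<in> carrier_vec (Suc m)"
  shows "add_col n m P x *\<^sub>v c \<in> E"
  using add_col_mult_vec[OF assms(2) lin_subD(1)[OF assms(1,4)] assms(5)]
    lin_subD(3)[OF assms(1) assms(3)[of "vec m (($) c)"] lin_subD(4)[OF assms(1,4), of "c $ m"]] by simp

text \<open>An independent system of maximal length works: lengths are bounded by \<open>n\<close>,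
  and a vector of \<open>E\<close> that is not reached modulo \<open>W\<close> could be appended as
  a further column.\<close>

lemma basis_mat_exists:
  fixes W E :: "'a :: field vec set"
  assumes W: "lin_sub n W" and E: "lin_sub n E"
  shows "\<exists>m P. basis_mat n m W E P"
proof -
  define Q where "Q m \<longleftrightarrow> (\<exists>P\<in>carrier_mat n m. \<forall>c\<in>carrier_vec m. P *\<^sub>v c \<in> E \<and> (P *\<^sub>v c \<in> W \<longrightarrow> c = 0\<^sub>v m))" for m
  have "Q 0"
  proof -
    have "0\<^sub>m n 0 *\<^sub>v c = 0\<^sub>v n" if "c \<in> carrier_vec 0" for c :: "'a vec"
      using that by (intro eq_vecI) (auto simp: scalar_prod_def)
    then show ?thesis unfolding Q_def using lin_subD(2)[OF E] by (intro bexI[of _ "0\<^sub>m n 0"]) auto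
  qed
  moreover have "m \<le> n" if "Q m" for m
  proof -
    from that obtain P where "P \<in> carrier_mat n m" "\<forall>c\<in>carrier_vec m. P *\<^sub>v c \<in> W \<longrightarrow> c = 0\<^sub>v m"
      unfolding Q_def by blast
    then show ?thesis using injective_mat_le lin_subD(2)[OF W] by metis
  qed
  ultimately obtain m where m: "Q m" "\<And>k. Q k \<Longrightarrow> k \<le> m"
    using GreatestI_nat[of Q 0 n] Greatest_le_nat[of Q _ n] by blast
  then obtain P where P: "P \<in> carrier_mat n m"
    "\<And>c. c \<in> carrier_vec m \<Longrightarrow> P *\<^sub>v c \<in> E" "\<And>c. c \<in> carrier_vec m \<Longrightarrow> P *\<^sub>v c \<in> W \<Longrightarrow> c = 0\<^sub>v m"
    unfolding Q_def by blast
  have "\<exists>c\<in>carrier_vec m. x - P *\<^sub>v c \<in> W" if x: "x \<in> E" for x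
  proof (rule ccontr)
    assume no: "\<not> ?thesis"
    have "Q (Suc m)" unfolding Q_def
      using add_col_injective[OF W P(1) P(3) lin_subD(1)[OF E x]] add_col_mem[OF E P(1,2) x] no
      by (intro bexI[of _ "add_col n m P x"]) (auto simp: add_col_carrier)
    then show False using m(2)[of "Suc m"] by simp
  qed
  then show ?thesis using P unfolding basis_mat_def by blast
qed

lemma vec_diff_zero_iff:
  fixes x :: "'a :: field vec"
  assumes "x \<in> carrier_vec n" "y \<in> carrier_vec n"
  shows "x - y = 0\<^sub>v n \<longleftrightarrow> x = y"
proof
  assume a: "x - y = 0\<^sub>v n"
  show "x = y"
  proof (intro eq_vecI)
    fix i assume "i < dim_vec y"
    then have "(x - y) $ i = 0" "i < n" using a assms by auto
    then show "x $ i = y $ i" using assms by simp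
  qed (use assms in auto)
qed (use assms in auto)

lemma basis_mat_coord:
  assumes "basis_mat n m {0\<^sub>v n} E P" "lin_sub n E" "x \<in> E"
  shows "\<exists>c\<in>carrier_vec m. x = P *\<^sub>v c"
proof -
  obtain c where c: "c \<in> carrier_vec m" "x - P *\<^sub>v c = 0\<^sub>v n" using basis_matD(4)[OF assms(1,3)] by auto
  have x: "x \<in> carrier_vec n" "P *\<^sub>v c \<in> carrier_vec n"
    using lin_subD(1)[OF assms(2)] assms(3) basis_matD(2)[OF assms(1) c(1)] by auto
  then have "x = P *\<^sub>v c" using vec_diff_zero_iff c by blast
  then show ?thesis using c by blast
qed

lemma mult_mat_vec_unit:
  fixes A :: "'a :: semiring_1 mat"
  assumes "A \<in> carrier_mat n m" "j < m"
  shows "A *\<^sub>v unit_vec m j = col A j"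
  using assms by (intro eq_vecI) auto

lemma basis_mat_factor:
  assumes B: "basis_mat n m {0\<^sub>v n} E P" and E: "lin_sub n E"
    and P': "P' \<in> carrier_mat n k" "\<And>c. c \<in> carrier_vec k \<Longrightarrow> P' *\<^sub>v c \<in> E"
  shows "\<exists>Q\<in>carrier_mat m k. P' = P * Q"
proof -
  have "\<exists>c\<in>carrier_vec m. col P' j = P *\<^sub>v c" if "j < k" for j
    using basis_mat_coord[OF B E P'(2)[of "unit_vec k j"]] mult_mat_vec_unit[OF P'(1) that] by auto
  then obtain q where q: "\<And>j. j < k \<Longrightarrow> q j \<in> carrier_vec m \<and> col P' j = P *\<^sub>v q j" by metis
  define Q where "Q = mat m k (\<lambda>(i,j). q j $ i)"
  have col: "col Q j = q j" if "j < k" for j using q[OF that] that by (intro eq_vecI) (auto simp: Q_def)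
  have "P' = P * Q"
  proof (rule mat_col_eqI)
    fix j assume "j < dim_col (P * Q)"
    then have j: "j < k" by (simp add: Q_def)
    have "col (P * Q) j = P *\<^sub>v col Q j"
      using basis_matD(1)[OF B] j by (intro col_mult2[of _ n m _ k]) (auto simp: Q_def)
    then show "col P' j = col (P * Q) j" using q[OF j] col[OF j] by simp
  qed (use P' basis_matD(1)[OF B] in \<open>auto simp: Q_def\<close>)
  then show ?thesis by (intro bexI[of _ Q]) (auto simp: Q_def)
qed

text \<open>Steinitz exchange in coordinates: if \<open>P' = P * Q\<close>, then \<open>Q\<close>
  inherits injectivity from \<open>P'\<close>, and it has \<open>m\<close> rows and \<open>k\<close>
  columns.\<close>

lemma basis_mat_max:
  assumes B: "basis_mat n m {0\<^sub>v n} E P" and E: "lin_sub n E"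
    and P': "P' \<in> carrier_mat n k" "\<And>c. c \<in> carrier_vec k \<Longrightarrow> P' *\<^sub>v c \<in> E"
      "\<And>c. c \<in> carrier_vec k \<Longrightarrow> P' *\<^sub>v c = 0\<^sub>v n \<Longrightarrow> c = 0\<^sub>v k"
  shows "k \<le> m"
proof -
  obtain Q where Q: "Q \<in> carrier_mat m k" "P' = P * Q" using basis_mat_factor[OF B E P'(1,2)] by blast
  have "c = 0\<^sub>v k" if c: "c \<in> carrier_vec k" "Q *\<^sub>v c = 0\<^sub>v m" for c
  proof -
    have "P' *\<^sub>v c = P *\<^sub>v (Q *\<^sub>v c)" using Q basis_matD(1)[OF B] c by simp
    also have "\<dots> = 0\<^sub>v n" using c basis_matD(1)[OF B] by (intro eq_vecI) auto
    finally show ?thesis using P'(3) c by blast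
  qed
  then show ?thesis using injective_mat_le[OF Q(1)] by blast
qed

text \<open>The choice is harmless, since by \<open>sub_dim_eqI\<close> all bases of a subspace have
  the same length; \<open>dim_eq_sub_dim\<close> ties the number to the vector space
  dimension.\<close>

definition sub_dim :: "nat \<Rightarrow> 'a :: field vec set \<Rightarrow> nat" where
  "sub_dim n W = (SOME m. \<exists>P. basis_mat n m {0\<^sub>v n} W P)"

lemma sub_dim_basis:
  assumes "lin_sub n W"
  shows "\<exists>P. basis_mat n (sub_dim n W) {0\<^sub>v n} W P"
  unfolding sub_dim_def using basis_mat_exists[OF lin_sub_zero assms] by (rule someI_ex)

lemma sub_dim_eqI:
  assumes "lin_sub n W" "basis_mat n m {0\<^sub>v n} W P"
  shows "sub_dim n W = m"
proof -
  obtain P' where P': "basis_mat n (sub_dim n W) {0\<^sub>v n} W P'" using sub_dim_basis[OF assms(1)] by blast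
  show ?thesis
    using basis_mat_max[OF assms(2,1) basis_matD(1,2)[OF P']] basis_matD(3)[OF P']
      basis_mat_max[OF P' assms(1) basis_matD(1,2)[OF assms(2)]] basis_matD(3)[OF assms(2)] by fastforce
qed

lemma sub_dim_le:
  assumes "lin_sub n W"
  shows "sub_dim n W \<le> n"
  using sub_dim_basis[OF assms] basis_mat_le[OF lin_sub_zero] by blast

text \<open>Independence survives because an \<open>x\<close> that is a combination of a basis of
  \<open>W\<close> would lie in \<open>W\<close>.\<close>

lemma sub_dim_extend:
  fixes W E :: "'a :: field vec set"
  assumes W: "lin_sub n W" and E: "lin_sub n E" and "W \<subseteq> E" and x: "x \<in> E" "x \<notin> W"
    and B: "basis_mat n m {0\<^sub>v n} W P"
    and c: "c \<in> carrier_vec (Suc m)"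
  shows "add_col n m P x *\<^sub>v c \<in> E" "add_col n m P x *\<^sub>v c = 0\<^sub>v n \<Longrightarrow> c = 0\<^sub>v (Suc m)"
proof -
  have PW: "\<And>c. c \<in> carrier_vec m \<Longrightarrow> P *\<^sub>v c \<in> W" using basis_matD(2)[OF B] .
  have PE: "\<And>c. c \<in> carrier_vec m \<Longrightarrow> P *\<^sub>v c \<in> E" using PW assms(3) by blast
  show "add_col n m P x *\<^sub>v c \<in> E"
    using add_col_mem[OF E basis_matD(1)[OF B] PE x(1) c] .
  have no: "x - P *\<^sub>v c \<notin> {0\<^sub>v n}" if "c \<in> carrier_vec m" for c
    using vec_diff_zero_iff[of x n "P *\<^sub>v c"] lin_subD(1)[OF E] x PW[OF that] PE[OF that] by auto
  show "c = 0\<^sub>v (Suc m)" if "add_col n m P x *\<^sub>v c = 0\<^sub>v n"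
    by (rule add_col_injective[OF lin_sub_zero basis_matD(1)[OF B] basis_matD(3)[OF B] _ no c])
      (use that lin_subD(1)[OF E x(1)] in auto)
qed

lemma sub_dim_strict_mono:
  assumes W: "lin_sub n W" and E: "lin_sub n E" and "W \<subset> E"
  shows "sub_dim n W < sub_dim n E"
proof -
  obtain x where x: "x \<in> E" "x \<notin> W" using assms(3) by blast
  obtain P where P: "basis_mat n (sub_dim n W) {0\<^sub>v n} W P" using sub_dim_basis[OF W] by blast
  obtain P' where P': "basis_mat n (sub_dim n E) {0\<^sub>v n} E P'" using sub_dim_basis[OF E] by blast
  have "Suc (sub_dim n W) \<le> sub_dim n E"
    using basis_mat_max[OF P' E add_col_carrier] sub_dim_extend[OF W E _ x P] assms(3) by blast
  then show ?thesis by simp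
qed

text \<open>Dimension takes the place of Zorn's lemma: a member of least dimension is minimal, since
  a proper subspace has smaller dimension.\<close>

lemma lin_sub_minimal:
  assumes "W0 \<in> \<F>" "\<And>W. W \<in> \<F> \<Longrightarrow> lin_sub n W"
  obtains W where "W \<in> \<F>" "\<And>U. U \<in> \<F> \<Longrightarrow> U \<subseteq> W \<Longrightarrow> U = W"
proof -
  obtain W where "W \<in> \<F>" "\<And>U. U \<in> \<F> \<Longrightarrow> sub_dim n W \<le> sub_dim n U"
    using ex_has_least_nat[of "\<lambda>W. W \<in> \<F>" W0 "sub_dim n"] assms(1) by blast
  then show ?thesis using that sub_dim_strict_mono assms(2) by (metis linorder_not_less psubsetI)
qed

lemma lin_sub_maximal:
  assumes "W0 \<in> \<F>" "\<And>W. W \<in> \<F> \<Longrightarrow> lin_sub n W"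
  obtains W where "W \<in> \<F>" "\<And>U. U \<in> \<F> \<Longrightarrow> W \<subseteq> U \<Longrightarrow> U = W"
proof -
  obtain W where W: "W \<in> \<F>" "\<And>U. U \<in> \<F> \<Longrightarrow> sub_dim n U \<le> sub_dim n W"
    using ex_has_greatest_nat[of "\<lambda>W. W \<in> \<F>" W0 "sub_dim n" "Suc n"] assms sub_dim_le by (metis less_Suc_eq_le)
  then show ?thesis using that sub_dim_strict_mono assms(2) by (metis linorder_not_less psubsetI)
qed

section \<open>Dimension, nilpotent matrices and the trace\<close>

lemma subspace_iff_lin_sub:
  fixes W :: "'a :: field vec set"
  shows "VectorSpace.subspace class_ring W (module_vec TYPE('a) n) \<longleftrightarrow> lin_sub n W"
proof
  assume "VectorSpace.subspace class_ring W (module_vec TYPE('a) n)"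
  then interpret VectorSpace.subspace class_ring W "module_vec TYPE('a) n" .
  from submod show "lin_sub n W"
    unfolding lin_sub_def submodule_def by (auto simp: module_vec_simps)
next
  assume W: "lin_sub n W"
  have "submodule class_ring W (module_vec TYPE('a) n)"
    unfolding submodule_def using vec_module W by (auto simp: module_vec_simps lin_sub_def)
  then show "VectorSpace.subspace class_ring W (module_vec TYPE('a) n)"
    unfolding VectorSpace.subspace_def using vec_vs by blast
qed

text \<open>Multiplication by a basis matrix is an injective linear map from the coordinate space
  onto \<open>W\<close>, so rank-nullity gives the dimension.\<close>

lemma dim_eq_sub_dim:
  fixes W :: "'a :: field vec set"
  assumes W: "lin_sub n W"
  shows "vectorspace.dim class_ring ((module_vec TYPE('a) n)\<lparr>carrier := W\<rparr>) = sub_dim n W"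
proof -
  define m where "m = sub_dim n W"
  obtain P where P: "basis_mat n m {0\<^sub>v n} W P" using sub_dim_basis[OF W] m_def by blast
  interpret M: vec_space "TYPE('a)" m .
  interpret N: vec_space "TYPE('a)" n .
  interpret T: linear_map class_ring "module_vec TYPE('a) m" "module_vec TYPE('a) n" "\<lambda>c. P *\<^sub>v c"
  proof (intro linear_map.intro vec_vs mod_hom.intro vec_module mod_hom_axioms.intro)
    show "(\<lambda>c. P *\<^sub>v c) \<in> LinearCombinations.module_hom class_ring (module_vec TYPE('a) m) (module_vec TYPE('a) n)"
      using mult_add_distrib_mat_vec[OF basis_matD(1)[OF P]] mult_mat_vec[OF basis_matD(1)[OF P]] basis_matD(1)[OF P]
      unfolding LinearCombinations.module_hom_def module_vec_simps by simp
  qed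
  have im: "T.im = W"
    unfolding T.im_def using basis_matD(2)[OF P] basis_mat_coord[OF P W] by (auto simp: module_vec_simps)
  have "P *\<^sub>v 0\<^sub>v m = 0\<^sub>v n" using basis_matD(1)[OF P] by (intro eq_vecI) auto
  then have ker: "T.ker = {0\<^sub>v m}"
    unfolding T.ker_def using basis_matD(3)[OF P] by (auto simp: module_vec_simps)
  interpret Z: vectorspace class_ring "(module_vec TYPE('a) m)\<lparr>carrier := {0\<^sub>v m}\<rparr>"
    using M.subspace_is_vs subspace_iff_lin_sub lin_sub_zero by blast
  \<comment> \<open>The kernel is the zero space; it is spanned by the empty set and so has
    dimension 0.\<close>
  have "Z.dim \<le> card ({} :: 'a vec set)"
  proof (rule Z.gen_ge_dim)
    show "Z.gen_set {}" unfolding Z.span_empty by (simp add: module_vec_simps)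
  qed auto
  then show ?thesis using T.rank_nullity[OF M.fin_dim] M.dim_is_n im ker m_def by simp
qed

lemma eq_mat_by_vec:
  fixes A B :: "'a :: semiring_1 mat"
  assumes "A \<in> carrier_mat n m" "B \<in> carrier_mat n m"
    and "\<And>c. c \<in> carrier_vec m \<Longrightarrow> A *\<^sub>v c = B *\<^sub>v c"
  shows "A = B"
proof (rule mat_col_eqI)
  fix j assume "j < dim_col B"
  then show "col A j = col B j"
    using assms mult_mat_vec_unit[of A n m j] mult_mat_vec_unit[of B n m j] by auto
qed (use assms in auto)

lemma zero_mat_mult_vec:
  assumes "x \<in> carrier_vec m"
  shows "0\<^sub>m n m *\<^sub>v x = (0\<^sub>v n :: 'a :: semiring_0 vec)"
  using assms by (intro eq_vecI) auto

lemma lin_sub_unit_vecs: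
  assumes U: "lin_sub n U" and unit: "\<And>j. j < n \<Longrightarrow> unit_vec n j \<in> U" and x: "x \<in> carrier_vec n"
  shows "x \<in> U"
proof -
  have "vec n (\<lambda>i. if i < k then x $ i else 0) \<in> U" if "k \<le> n" for k
    using that
  proof (induction k)
    case 0
    have "vec n (\<lambda>i. if i < 0 then x $ i else 0) = 0\<^sub>v n" by (intro eq_vecI) auto
    then show ?case using lin_subD(2)[OF U] by simp
  next
    case (Suc k)
    have "vec n (\<lambda>i. if i < Suc k then x $ i else 0) =
        vec n (\<lambda>i. if i < k then x $ i else 0) + x $ k \<cdot>\<^sub>v unit_vec n k"
      using Suc.prems by (intro eq_vecI) (auto simp: unit_vec_def less_Suc_eq)
    then show ?case using Suc lin_subD(3,4)[OF U] unit by simp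
  qed
  from this[of n] have "vec n (\<lambda>i. if i < n then x $ i else 0) \<in> U" by simp
  moreover have "vec n (\<lambda>i. if i < n then x $ i else 0) = x" using x by (intro eq_vecI) auto
  ultimately show ?thesis by simp
qed

text \<open>Coordinates of the columns of \<open>P'\<close> make up \<open>Q\<close>. The vectors
  \<open>c\<close> for which the congruence holds form a subspace, and it contains all unit
  vectors.\<close>

lemma basis_mat_factor_mod:
  assumes B: "basis_mat n m W E P" and W: "lin_sub n W"
    and P': "P' \<in> carrier_mat n k" "\<And>c. c \<in> carrier_vec k \<Longrightarrow> P' *\<^sub>v c \<in> E"
  shows "\<exists>Q\<in>carrier_mat m k. \<forall>c\<in>carrier_vec k. P' *\<^sub>v c - P *\<^sub>v (Q *\<^sub>v c) \<in> W"
proof -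
  note P = basis_matD(1)[OF B]
  have "\<exists>c\<in>carrier_vec m. col P' j - P *\<^sub>v c \<in> W" if "j < k" for j
    using basis_matD(4)[OF B P'(2)[of "unit_vec k j"]] mult_mat_vec_unit[OF P'(1) that] by auto
  then obtain q where q: "\<And>j. j < k \<Longrightarrow> q j \<in> carrier_vec m \<and> col P' j - P *\<^sub>v q j \<in> W" by metis
  define Q where "Q = mat m k (\<lambda>(i,j). q j $ i)"
  have Q: "Q \<in> carrier_mat m k" by (simp add: Q_def)
  have col: "col Q j = q j" if "j < k" for j using q[OF that] that by (intro eq_vecI) (auto simp: Q_def)
  have eq: "(P' - P * Q) *\<^sub>v c = P' *\<^sub>v c - P *\<^sub>v (Q *\<^sub>v c)" if "c \<in> carrier_vec k" for c
    using minus_mult_distrib_mat_vec[OF P'(1), of "P * Q"] P Q that by auto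
  have "lin_sub k {c \<in> carrier_vec k. (P' - P * Q) *\<^sub>v c \<in> W}"
    by (rule lin_sub_preimage[OF _ W]) (use P P' Q in auto)
  moreover have "unit_vec k j \<in> {c \<in> carrier_vec k. (P' - P * Q) *\<^sub>v c \<in> W}" if "j < k" for j
    using q[OF that] eq[of "unit_vec k j"] that col[OF that]
      mult_mat_vec_unit[OF P'(1) that] mult_mat_vec_unit[OF Q that] by auto
  ultimately have "c \<in> {c \<in> carrier_vec k. (P' - P * Q) *\<^sub>v c \<in> W}" if "c \<in> carrier_vec k" for c
    using lin_sub_unit_vecs[of k _ c] that by blast
  then show ?thesis using eq Q by (intro bexI[of _ Q]) auto
qed

section \<open>Matrices of the form scalar plus nilpotent\<close>

lemma char_matrix_mult_vec:
  assumes "A \<in> carrier_mat n n" "x \<in> carrier_vec n"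
  shows "char_matrix A l *\<^sub>v x = A *\<^sub>v x - l \<cdot>\<^sub>v x"
proof -
  have "char_matrix A l *\<^sub>v x = A *\<^sub>v x + (- l \<cdot>\<^sub>m 1\<^sub>m n) *\<^sub>v x"
    unfolding char_matrix_def using assms by (subst add_mult_distrib_mat_vec) auto
  also have "(- l \<cdot>\<^sub>m 1\<^sub>m n) *\<^sub>v x = - l \<cdot>\<^sub>v x"
    using assms by (intro eq_vecI) auto
  finally show ?thesis using assms by (intro eq_vecI) auto
qed

lemma pow_mat_Suc_vec:
  assumes "A \<in> carrier_mat n n" "x \<in> carrier_vec n"
  shows "A ^\<^sub>m Suc k *\<^sub>v x = A ^\<^sub>m k *\<^sub>v (A *\<^sub>v x)"
  using assms by (auto intro!: assoc_mult_mat_vec[of _ n n _ n])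

lemma pow_mat_vec_commute:
  assumes "A \<in> carrier_mat n n" "x \<in> carrier_vec n"
  shows "A ^\<^sub>m k *\<^sub>v (A *\<^sub>v x) = A *\<^sub>v (A ^\<^sub>m k *\<^sub>v x)"
  using assms(2)
proof (induction k arbitrary: x)
  case 0
  then have "A *\<^sub>v x \<in> carrier_vec n" using assms(1) by simp
  then show ?case using 0 assms(1) carrier_matD(1)[OF assms(1)] by (simp only: pow_mat.simps one_mult_mat_vec)
next
  case (Suc k)
  have "A *\<^sub>v x \<in> carrier_vec n" using assms(1) Suc.prems by simp
  have "A ^\<^sub>m Suc k *\<^sub>v (A *\<^sub>v x) = A ^\<^sub>m k *\<^sub>v (A *\<^sub>v (A *\<^sub>v x))"
    by (rule pow_mat_Suc_vec[OF assms(1) \<open>A *\<^sub>v x \<in> carrier_vec n\<close>])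
  also have "\<dots> = A *\<^sub>v (A ^\<^sub>m k *\<^sub>v (A *\<^sub>v x))" by (rule Suc.IH[OF \<open>A *\<^sub>v x \<in> carrier_vec n\<close>])
  also have "A ^\<^sub>m k *\<^sub>v (A *\<^sub>v x) = A ^\<^sub>m Suc k *\<^sub>v x" by (rule pow_mat_Suc_vec[OF assms(1) Suc.prems, symmetric])
  finally show ?case .
qed

text \<open>The iterates of \<open>N\<close> on \<open>x\<close> reach 0 after at most
  \<open>k\<close> steps, and the last nonzero one lies in the kernel.\<close>

lemma nilpotent_kernel_vec:
  assumes N: "N \<in> carrier_mat n n" "N ^\<^sub>m k = 0\<^sub>m n n" and x: "x \<in> carrier_vec n" "x \<noteq> 0\<^sub>v n"
  shows "\<exists>i. N ^\<^sub>m i *\<^sub>v x \<noteq> 0\<^sub>v n \<and> N *\<^sub>v (N ^\<^sub>m i *\<^sub>v x) = 0\<^sub>v n"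
proof -
  define j where "j = (LEAST j. N ^\<^sub>m j *\<^sub>v x = 0\<^sub>v n)"
  have "N ^\<^sub>m k *\<^sub>v x = 0\<^sub>v n" using N x by (intro eq_vecI) auto
  then have j: "N ^\<^sub>m j *\<^sub>v x = 0\<^sub>v n" "\<And>i. i < j \<Longrightarrow> N ^\<^sub>m i *\<^sub>v x \<noteq> 0\<^sub>v n"
    unfolding j_def by (auto intro: LeastI dest: not_less_Least)
  have "j \<noteq> 0"
  proof
    assume "j = 0"
    then show False using j(1) x N by auto
  qed
  then obtain i where i: "j = Suc i" by (cases j) auto
  have "N *\<^sub>v (N ^\<^sub>m i *\<^sub>v x) = N ^\<^sub>m j *\<^sub>v x"
    unfolding i pow_mat_Suc_vec[OF N(1) x(1)] by (rule pow_mat_vec_commute[OF N(1) x(1), symmetric])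
  then have "N ^\<^sub>m i *\<^sub>v x \<noteq> 0\<^sub>v n \<and> N *\<^sub>v (N ^\<^sub>m i *\<^sub>v x) = 0\<^sub>v n"
    using j(1) j(2)[of i] i by simp
  then show ?thesis by blast
qed

text \<open>\<open>char_matrix A l\<close> is \<open>A - l\<close>, so these are the matrices
  \<open>l + N\<close> with \<open>N\<close> nilpotent. The scalar \<open>l\<close> belongs to the
  given field, which is what allows eigenvectors to be brought back from the algebraic
  closure.\<close>

definition almost_scalar :: "nat \<Rightarrow> 'a :: field mat \<Rightarrow> 'a \<Rightarrow> bool" where
  "almost_scalar n A l \<longleftrightarrow> A \<in> carrier_mat n n \<and> (\<exists>k. char_matrix A l ^\<^sub>m k = 0\<^sub>m n n)"

lemma almost_scalar_eigenvector:
  assumes "almost_scalar n A l" "0 < n"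
  shows "\<exists>v\<in>carrier_vec n. v \<noteq> 0\<^sub>v n \<and> A *\<^sub>v v = l \<cdot>\<^sub>v v"
proof -
  obtain k where A: "A \<in> carrier_mat n n" and k: "char_matrix A l ^\<^sub>m k = 0\<^sub>m n n"
    using assms by (auto simp: almost_scalar_def)
  have "unit_vec n 0 \<noteq> (0\<^sub>v n :: 'a vec)" using assms(2) by simp
  then obtain i where i: "char_matrix A l ^\<^sub>m i *\<^sub>v unit_vec n 0 \<noteq> 0\<^sub>v n"
      "char_matrix A l *\<^sub>v (char_matrix A l ^\<^sub>m i *\<^sub>v unit_vec n 0) = 0\<^sub>v n"
    using nilpotent_kernel_vec[OF char_matrix_closed[OF A] k, of "unit_vec n 0"] by auto
  let ?v = "char_matrix A l ^\<^sub>m i *\<^sub>v unit_vec n 0"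
  have v: "?v \<in> carrier_vec n" using char_matrix_closed[OF A] by (metis mult_mat_vec_carrier pow_carrier_mat unit_vec_carrier)
  then have "A *\<^sub>v ?v - l \<cdot>\<^sub>v ?v = 0\<^sub>v n" using i(2) char_matrix_mult_vec[OF A v] by simp
  then have "A *\<^sub>v ?v = l \<cdot>\<^sub>v ?v" using vec_diff_zero_iff[of "A *\<^sub>v ?v" n "l \<cdot>\<^sub>v ?v"] v A by (metis mult_mat_vec_carrier smult_carrier_vec)
  then show ?thesis using v i(1) by blast
qed

text \<open>On \<open>v\<close> the nilpotent matrix \<open>A - l\<close> acts as the scalar
  \<open>e - l\<close>, so some power of \<open>e - l\<close> vanishes.\<close>

lemma almost_scalar_eigenvalue:
  assumes "almost_scalar n A l" and v: "v \<in> carrier_vec n" "v \<noteq> 0\<^sub>v n" "A *\<^sub>v v = e \<cdot>\<^sub>v v"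
  shows "e = l"
proof -
  obtain k where A: "A \<in> carrier_mat n n" and k: "char_matrix A l ^\<^sub>m k = 0\<^sub>m n n"
    using assms by (auto simp: almost_scalar_def)
  have step: "char_matrix A l *\<^sub>v v = (e - l) \<cdot>\<^sub>v v"
    unfolding char_matrix_mult_vec[OF A v(1)] v(3) using v by (intro eq_vecI) (auto simp: algebra_simps)
  have "char_matrix A l ^\<^sub>m j *\<^sub>v v = (e - l) ^ j \<cdot>\<^sub>v v" for j
  proof (induction j)
    case 0
    then show ?case using carrier_matD(1)[OF char_matrix_closed[OF A]] v by simp
  next
    case (Suc j)
    have "char_matrix A l ^\<^sub>m Suc j *\<^sub>v v = char_matrix A l ^\<^sub>m j *\<^sub>v ((e - l) \<cdot>\<^sub>v v)"
      using pow_mat_Suc_vec[OF char_matrix_closed[OF A] v(1)] step by simp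
    also have "\<dots> = (e - l) \<cdot>\<^sub>v (char_matrix A l ^\<^sub>m j *\<^sub>v v)"
      using A v by (intro mult_mat_vec[of _ n n]) auto
    also have "\<dots> = (e - l) ^ Suc j \<cdot>\<^sub>v v" using Suc.IH by (simp add: smult_smult_assoc)
    finally show ?case .
  qed
  from this[of k] have z: "(e - l) ^ k \<cdot>\<^sub>v v = 0\<^sub>v n" using k zero_mat_mult_vec[OF v(1)] by simp
  obtain i where i: "i < n" "v $ i \<noteq> 0" using v by (metis eq_vecI carrier_vecD index_zero_vec(1) index_zero_vec(2))
  have "((e - l) ^ k \<cdot>\<^sub>v v) $ i = 0" using z i by simp
  then have "(e - l) ^ k * v $ i = 0" using i v by simp
  then show ?thesis using i(2) by simp
qed

text \<open>The characteristic polynomial splits over an algebraically closed field and has no root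
  except \<open>l\<close>, so it is \<open>(X - l)^n\<close>; its value at 0 is the determinant up
  to the sign \<open>(-1)^n\<close>.\<close>

lemma almost_scalar_det:
  fixes A :: "'a :: alg_closed_field mat"
  assumes A: "almost_scalar n A l"
  shows "det A = l ^ n"
proof -
  have Ac: "A \<in> carrier_mat n n" using A by (simp add: almost_scalar_def)
  have deg: "Polynomial.degree (char_poly A) = n" "monic (char_poly A)" using degree_monic_char_poly[OF Ac] by auto
  then have "char_poly A \<noteq> 0" by auto
  then obtain M where M: "size M = n" "char_poly A = (\<Prod>x\<in>#M. [:-x, 1:])"
    using alg_closed_imp_factorization[of "char_poly A"] deg by auto
  have "x = l" if x: "x \<in># M" for x
  proof -
    have "poly (char_poly A) x = 0" unfolding M(2) poly_prod_mset using x by (auto simp: prod_mset_zero_iff)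
    then have "eigenvalue A x" using eigenvalue_root_char_poly[OF Ac] by blast
    then show ?thesis using almost_scalar_eigenvalue[OF A] Ac unfolding eigenvalue_def eigenvector_def by auto
  qed
  then have "M = replicate_mset n l" using M(1) by (metis set_mset_subset_singletonD singletonI subsetI)
  then have cp: "char_poly A = [:-l, 1:] ^ n" using M(2) by simp
  have "poly (char_poly A) 0 = det (- char_matrix A 0)" by (rule char_poly_matrix[OF Ac])
  also have "- char_matrix A 0 = (-1) \<cdot>\<^sub>m A" using Ac by (intro eq_matI) (auto simp: char_matrix_def)
  also have "det \<dots> = (-1) ^ n * det A" using Ac by simp
  finally have "(-1) ^ n * det A = (- l) ^ n" unfolding cp by (simp add: poly_power)
  then have "(-1) ^ n * ((-1) ^ n * det A) = (-1) ^ n * (- l) ^ n" by simp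
  then show ?thesis by (simp add: mult.assoc[symmetric] power_mult_distrib[symmetric])
qed

section \<open>The trace\<close>

definition mat_trace :: "'a :: comm_ring_1 mat \<Rightarrow> 'a" where
  "mat_trace A = (\<Sum>i<dim_row A. A $$ (i,i))"

lemma mat_trace_mult:
  assumes "A \<in> carrier_mat n m" "B \<in> carrier_mat m n"
  shows "mat_trace (A * B) = (\<Sum>i<n. \<Sum>j<m. A $$ (i,j) * B $$ (j,i))"
  using assms by (auto simp: mat_trace_def scalar_prod_def lessThan_atLeast0 intro!: sum.cong)

lemma mat_trace_mult_comm:
  assumes "A \<in> carrier_mat n m" "B \<in> carrier_mat m n"
  shows "mat_trace (A * B) = mat_trace (B * A)"
  unfolding mat_trace_mult[OF assms] mat_trace_mult[OF assms(2,1)]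
  by (subst sum.swap) (simp add: mult.commute)

lemma mat_trace_add:
  assumes "A \<in> carrier_mat n n" "B \<in> carrier_mat n n"
  shows "mat_trace (A + B) = mat_trace A + mat_trace B"
  using assms by (simp add: mat_trace_def sum.distrib)

lemma mat_trace_smult:
  assumes "A \<in> carrier_mat n n"
  shows "mat_trace (c \<cdot>\<^sub>m A) = c * mat_trace A"
  using assms by (auto simp: mat_trace_def sum_distrib_left intro!: sum.cong)

text \<open>Induction on the nilpotency exponent, without eigenvalues. Factor
  \<open>N = P * Q\<close> through its image; then \<open>tr (P Q) = tr (Q P)\<close>, and
  \<open>Q * P\<close> is the restriction of \<open>N\<close> to its image in coordinates, where one
  power less is enough.\<close>

lemma mat_trace_nilpotent:
  fixes N :: "'a :: field mat"
  assumes "N \<in> carrier_mat n n" "N ^\<^sub>m k = 0\<^sub>m n n"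
  shows "mat_trace N = 0"
  using assms
proof (induction k arbitrary: n N)
  case 0
  \<comment> \<open>\<open>N ^ 0\<close> is the identity, which is zero only in size 0.\<close>
  have "n = 0"
  proof (rule ccontr)
    assume "n \<noteq> 0"
    then have "(1\<^sub>m n :: 'a mat) $$ (0,0) = 0\<^sub>m n n $$ (0,0)" using 0 by auto
    then show False using \<open>n \<noteq> 0\<close> by simp
  qed
  then show ?case using 0 by (auto simp: mat_trace_def)
next
  case (Suc k)
  let ?E = "(\<lambda>x. N *\<^sub>v x) ` carrier_vec n"
  have E: "lin_sub n ?E" by (rule mult_mat_vec_lin_sub_image[OF Suc.prems(1) lin_sub_carrier])
  obtain m P where B: "basis_mat n m {0\<^sub>v n} ?E P" using basis_mat_exists[OF lin_sub_zero E] by blast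
  note P = basis_matD(1)[OF B]
  obtain Q where Q: "Q \<in> carrier_mat m n" "N = P * Q"
    using basis_mat_factor[OF B E Suc.prems(1)] by auto
  have inj: "c = 0\<^sub>v m" if "c \<in> carrier_vec m" "P *\<^sub>v c = 0\<^sub>v n" for c
    using basis_matD(3)[OF B] that by blast
  have surj: "\<exists>x\<in>carrier_vec n. c = Q *\<^sub>v x" if c: "c \<in> carrier_vec m" for c
  proof -
    obtain x where x: "x \<in> carrier_vec n" "P *\<^sub>v c = N *\<^sub>v x" using basis_matD(2)[OF B c] by auto
    have "P *\<^sub>v (c - Q *\<^sub>v x) = P *\<^sub>v c - P *\<^sub>v (Q *\<^sub>v x)"
      using P Q c x by (intro mult_minus_distrib_mat_vec) auto
    also have "P *\<^sub>v (Q *\<^sub>v x) = N *\<^sub>v x" using P Q x by simp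
    also have "P *\<^sub>v c - N *\<^sub>v x = 0\<^sub>v n" using x Suc.prems(1) by auto
    finally have "c - Q *\<^sub>v x = 0\<^sub>v m" using inj[of "c - Q *\<^sub>v x"] c Q x by auto
    then show ?thesis using x(1) vec_diff_zero_iff[of c m "Q *\<^sub>v x"] c Q by (metis mult_mat_vec_carrier)
  qed
  have QP: "Q * P \<in> carrier_mat m m" using Q P by simp
  \<comment> \<open>Regrouping \<open>P (Q P)^j Q\<close> gives \<open>(P Q)^(j+1)\<close>. As
    \<open>P\<close> is injective and \<open>Q\<close> is surjective, the vanishing of
    \<open>N ^ Suc k\<close> passes to \<open>(Q * P) ^ k\<close>.\<close>
  have power: "P *\<^sub>v ((Q * P) ^\<^sub>m j *\<^sub>v (Q *\<^sub>v x)) = N ^\<^sub>m Suc j *\<^sub>v x" if x: "x \<in> carrier_vec n" for j x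
    using x
  proof (induction j arbitrary: x)
    case 0
    then show ?case using P Q QP Suc.prems(1) by auto
  next
    case (Suc j)
    have Nx: "N *\<^sub>v x \<in> carrier_vec n" using Suc.prems \<open>N \<in> carrier_mat n n\<close> by simp
    have "(Q * P) ^\<^sub>m Suc j *\<^sub>v (Q *\<^sub>v x) = (Q * P) ^\<^sub>m j *\<^sub>v ((Q * P) *\<^sub>v (Q *\<^sub>v x))"
      using pow_mat_Suc_vec[OF QP] Q Suc.prems by simp
    also have "(Q * P) *\<^sub>v (Q *\<^sub>v x) = Q *\<^sub>v (N *\<^sub>v x)"
      using P Q Suc.prems by simp
    finally have "P *\<^sub>v ((Q * P) ^\<^sub>m Suc j *\<^sub>v (Q *\<^sub>v x)) = N ^\<^sub>m Suc j *\<^sub>v (N *\<^sub>v x)"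
      using Suc.IH[OF Nx] by simp
    also have "\<dots> = N ^\<^sub>m Suc (Suc j) *\<^sub>v x" using pow_mat_Suc_vec[OF \<open>N \<in> carrier_mat n n\<close> Suc.prems] by metis
    finally show ?case .
  qed
  have "(Q * P) ^\<^sub>m k = 0\<^sub>m m m"
  proof (rule eq_mat_by_vec[of _ m m])
    fix c :: "'a vec" assume c: "c \<in> carrier_vec m"
    obtain x where x: "x \<in> carrier_vec n" "c = Q *\<^sub>v x" using surj[OF c] by blast
    have "P *\<^sub>v ((Q * P) ^\<^sub>m k *\<^sub>v c) = N ^\<^sub>m Suc k *\<^sub>v x" using power[OF x(1)] x(2) by simp
    also have "\<dots> = 0\<^sub>v n" using Suc.prems(2) x(1) by auto
    finally show "(Q * P) ^\<^sub>m k *\<^sub>v c = 0\<^sub>m m m *\<^sub>v c"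
      using inj[of "(Q * P) ^\<^sub>m k *\<^sub>v c"] c mult_mat_vec_carrier[OF pow_carrier_mat[OF QP] c] by auto
  qed (use QP in auto)
  then have "mat_trace (Q * P) = 0" using Suc.IH[OF QP] by blast
  then show ?case using mat_trace_mult_comm[OF P Q(1)] Q(2) by simp
qed

lemma almost_scalar_trace:
  assumes "almost_scalar n A l"
  shows "mat_trace A = of_nat n * l"
proof -
  obtain k where A: "A \<in> carrier_mat n n" and k: "char_matrix A l ^\<^sub>m k = 0\<^sub>m n n"
    using assms by (auto simp: almost_scalar_def)
  have "0 = mat_trace (char_matrix A l)" using mat_trace_nilpotent[OF char_matrix_closed[OF A] k] by simp
  also have "\<dots> = mat_trace A + - l * mat_trace (1\<^sub>m n)"
    unfolding char_matrix_def using A mat_trace_add[OF A, of "- l \<cdot>\<^sub>m 1\<^sub>m n"] mat_trace_smult[OF one_carrier_mat, of "- l" n] by simp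
  also have "mat_trace (1\<^sub>m n :: 'a mat) = of_nat n" by (simp add: mat_trace_def)
  finally show ?thesis by (simp add: algebra_simps)
qed

section \<open>Compression to a subquotient\<close>

lemma char_matrix_preserves:
  assumes "lin_sub n W" "A \<in> carrier_mat n n" "\<And>x. x \<in> W \<Longrightarrow> A *\<^sub>v x \<in> W" "x \<in> W"
  shows "char_matrix A l *\<^sub>v x \<in> W"
  using char_matrix_mult_vec[OF assms(2) lin_subD(1)[OF assms(1,4)]]
    lin_sub_minus[OF assms(1) assms(3)[OF assms(4)] lin_subD(4)[OF assms(1,4)]] by simp

text \<open>The subquotient \<open>E/W\<close> in the coordinates given by \<open>P\<close>. With
  \<open>W = {0}\<close> it serves to restrict to an invariant subspace; with general
  \<open>W\<close> it serves to extend a chain by one step.\<close>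

locale compression =
  fixes n m :: nat and W E :: "'a :: field vec set" and P :: "'a mat"
  assumes W: "lin_sub n W" and E: "lin_sub n E" and WE: "W \<subseteq> E"
    and B: "basis_mat n m W E P"
begin

definition stable :: "'a mat \<Rightarrow> bool" where
  "stable A \<longleftrightarrow> A \<in> carrier_mat n n \<and> (\<forall>x\<in>W. A *\<^sub>v x \<in> W) \<and> (\<forall>x\<in>E. A *\<^sub>v x \<in> E)"

text \<open>The matrix of the map that \<open>A\<close> induces on \<open>E/W\<close>. For stable
  \<open>A\<close> it exists, and \<open>coord_eqI\<close> makes it unique.\<close>

definition cmp :: "'a mat \<Rightarrow> 'a mat" where
  "cmp A = (SOME Q. Q \<in> carrier_mat m m \<and> (\<forall>c\<in>carrier_vec m. A *\<^sub>v (P *\<^sub>v c) - P *\<^sub>v (Q *\<^sub>v c) \<in> W))"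

lemmas P = basis_matD(1)[OF B]

lemma Pc: "c \<in> carrier_vec m \<Longrightarrow> P *\<^sub>v c \<in> carrier_vec n"
  using P by simp

lemma coord_eqI:
  assumes "c \<in> carrier_vec m" "d \<in> carrier_vec m" "P *\<^sub>v c - P *\<^sub>v d \<in> W"
  shows "c = d"
proof -
  have "P *\<^sub>v (c - d) \<in> W" using mult_minus_distrib_mat_vec[OF P assms(1,2)] assms(3) by simp
  then have "c - d = 0\<^sub>v m" using basis_matD(3)[OF B, of "c - d"] assms by simp
  then show ?thesis using vec_diff_zero_iff[OF assms(1,2)] by simp
qed

lemma cmp:
  assumes "stable A"
  shows "cmp A \<in> carrier_mat m m"
    "c \<in> carrier_vec m \<Longrightarrow> A *\<^sub>v (P *\<^sub>v c) - P *\<^sub>v (cmp A *\<^sub>v c) \<in> W"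
proof -
  have A: "A \<in> carrier_mat n n" using assms by (simp add: stable_def)
  have eq: "(A * P) *\<^sub>v c = A *\<^sub>v (P *\<^sub>v c)" if "c \<in> carrier_vec m" for c using A P that by simp
  have "\<exists>Q\<in>carrier_mat m m. \<forall>c\<in>carrier_vec m. (A * P) *\<^sub>v c - P *\<^sub>v (Q *\<^sub>v c) \<in> W"
    by (rule basis_mat_factor_mod[OF B W])
      (use A P assms basis_matD(2)[OF B] in \<open>auto simp: stable_def\<close>)
  then have "\<exists>Q. Q \<in> carrier_mat m m \<and> (\<forall>c\<in>carrier_vec m. A *\<^sub>v (P *\<^sub>v c) - P *\<^sub>v (Q *\<^sub>v c) \<in> W)"
    using eq by auto
  from someI_ex[OF this]
  show "cmp A \<in> carrier_mat m m" "c \<in> carrier_vec m \<Longrightarrow> A *\<^sub>v (P *\<^sub>v c) - P *\<^sub>v (cmp A *\<^sub>v c) \<in> W"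
    unfolding cmp_def by auto
qed

lemma cmp_vec_eqI:
  assumes "stable A" "c \<in> carrier_vec m" "d \<in> carrier_vec m" "A *\<^sub>v (P *\<^sub>v c) - P *\<^sub>v d \<in> W"
  shows "cmp A *\<^sub>v c = d"
proof -
  have A: "A \<in> carrier_mat n n" using assms by (simp add: stable_def)
  have c: "cmp A *\<^sub>v c \<in> carrier_vec m" using cmp(1)[OF assms(1)] assms(2) by simp
  have "P *\<^sub>v (cmp A *\<^sub>v c) - A *\<^sub>v (P *\<^sub>v c) \<in> W"
    by (rule lin_sub_diff_sym[OF W _ _ cmp(2)[OF assms(1,2)]]) (use A Pc c assms in auto)
  note tr = this
  have "P *\<^sub>v (cmp A *\<^sub>v c) - P *\<^sub>v d \<in> W"
    by (rule lin_sub_diff_trans[OF W _ _ _ tr assms(4)]) (use A Pc c assms in auto)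
  then show ?thesis using coord_eqI[OF c assms(3)] by blast
qed

lemma stable_mult:
  assumes "stable A" "stable B"
  shows "stable (A * B)"
proof -
  have AB: "A \<in> carrier_mat n n" "B \<in> carrier_mat n n" using assms by (auto simp: stable_def)
  have "(A * B) *\<^sub>v x = A *\<^sub>v (B *\<^sub>v x)" if "x \<in> E" for x
    using AB lin_subD(1)[OF E that] by simp
  then show ?thesis using assms AB WE unfolding stable_def by (auto simp: subset_iff)
qed

lemma stable_one: "stable (1\<^sub>m n)"
  using lin_subD(1)[OF W] lin_subD(1)[OF E] by (auto simp: stable_def)

lemma stable_pow: "stable A \<Longrightarrow> stable (A ^\<^sub>m k)"
proof (induction k)
  case 0
  then have "dim_row A = n" by (auto simp: stable_def)
  then show ?case using stable_one by simp
qed (use stable_mult in auto)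

lemma stable_char_matrix:
  assumes "stable A"
  shows "stable (char_matrix A l)"
  using assms char_matrix_preserves[OF W] char_matrix_preserves[OF E] unfolding stable_def by auto

lemma cmp_mult:
  assumes "stable A" "stable B"
  shows "cmp (A * B) = cmp A * cmp B"
proof (rule eq_mat_by_vec[of _ m m])
  fix c :: "'a vec" assume c: "c \<in> carrier_vec m"
  have AB: "A \<in> carrier_mat n n" "B \<in> carrier_mat n n" using assms by (auto simp: stable_def)
  have Bc: "cmp B *\<^sub>v c \<in> carrier_vec m" using cmp(1)[OF assms(2)] c by simp
  have ABc: "cmp A *\<^sub>v (cmp B *\<^sub>v c) \<in> carrier_vec m" using cmp(1)[OF assms(1)] Bc by simp
  have "A *\<^sub>v (B *\<^sub>v (P *\<^sub>v c) - P *\<^sub>v (cmp B *\<^sub>v c)) \<in> W"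
    using cmp(2)[OF assms(2) c] assms(1) by (auto simp: stable_def)
  then have "A *\<^sub>v (B *\<^sub>v (P *\<^sub>v c)) - A *\<^sub>v (P *\<^sub>v (cmp B *\<^sub>v c)) \<in> W"
    using mult_minus_distrib_mat_vec[OF AB(1)] AB Pc[OF c] Pc[OF Bc] by simp
  note tr = this
  have "A *\<^sub>v (B *\<^sub>v (P *\<^sub>v c)) - P *\<^sub>v (cmp A *\<^sub>v (cmp B *\<^sub>v c)) \<in> W"
    by (rule lin_sub_diff_trans[OF W _ _ _ tr cmp(2)[OF assms(1) Bc]]) (use AB Pc c Bc ABc in auto)
  then have "(A * B) *\<^sub>v (P *\<^sub>v c) - P *\<^sub>v (cmp A *\<^sub>v (cmp B *\<^sub>v c)) \<in> W"
    using AB Pc[OF c] by simp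
  then have "cmp (A * B) *\<^sub>v c = cmp A *\<^sub>v (cmp B *\<^sub>v c)"
    by (rule cmp_vec_eqI[OF stable_mult[OF assms] c ABc])
  then show "cmp (A * B) *\<^sub>v c = (cmp A * cmp B) *\<^sub>v c"
    using cmp(1)[OF assms(1)] cmp(1)[OF assms(2)] c by simp
qed (use cmp(1)[OF assms(1)] cmp(1)[OF assms(2)] cmp(1)[OF stable_mult[OF assms]] in auto)

lemma cmp_one: "cmp (1\<^sub>m n) = 1\<^sub>m m"
proof (rule eq_mat_by_vec[of _ m m])
  fix c :: "'a vec" assume c: "c \<in> carrier_vec m"
  have "1\<^sub>m n *\<^sub>v (P *\<^sub>v c) - P *\<^sub>v c = 0\<^sub>v n" using Pc[OF c] by simp
  then show "cmp (1\<^sub>m n) *\<^sub>v c = 1\<^sub>m m *\<^sub>v c"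
    using cmp_vec_eqI[OF stable_one c c] lin_subD(2)[OF W] c by simp
qed (use cmp(1) stable_one in auto)

lemma cmp_pow:
  assumes "stable A"
  shows "cmp (A ^\<^sub>m k) = cmp A ^\<^sub>m k"
proof (induction k)
  case 0
  have "dim_row A = n" using assms by (auto simp: stable_def)
  moreover have "dim_row (cmp A) = m" using cmp(1)[OF assms] by simp
  ultimately show ?case using cmp_one by simp
next
  case (Suc k)
  then show ?case using cmp_mult[OF stable_pow[OF assms] assms] by simp
qed

lemma cmp_char_matrix:
  assumes "stable A"
  shows "cmp (char_matrix A l) = char_matrix (cmp A) l"
proof (rule eq_mat_by_vec[of _ m m])
  fix c :: "'a vec" assume c: "c \<in> carrier_vec m"
  have A: "A \<in> carrier_mat n n" using assms by (simp add: stable_def)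
  note cA = cmp(1)[OF assms]
  have Ac: "cmp A *\<^sub>v c \<in> carrier_vec m" using cA c by simp
  have "P *\<^sub>v (cmp A *\<^sub>v c - l \<cdot>\<^sub>v c) = P *\<^sub>v (cmp A *\<^sub>v c) - l \<cdot>\<^sub>v (P *\<^sub>v c)"
    using mult_minus_distrib_mat_vec[OF P Ac, of "l \<cdot>\<^sub>v c"] mult_mat_vec[OF P c] c by simp
  then have "char_matrix A l *\<^sub>v (P *\<^sub>v c) - P *\<^sub>v (cmp A *\<^sub>v c - l \<cdot>\<^sub>v c)
      = A *\<^sub>v (P *\<^sub>v c) - l \<cdot>\<^sub>v (P *\<^sub>v c) - (P *\<^sub>v (cmp A *\<^sub>v c) - l \<cdot>\<^sub>v (P *\<^sub>v c))"
    using char_matrix_mult_vec[OF A Pc[OF c]] by simp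
  also have "\<dots> = A *\<^sub>v (P *\<^sub>v c) - P *\<^sub>v (cmp A *\<^sub>v c)"
    using carrier_vecD[OF mult_mat_vec_carrier[OF A Pc[OF c]]] carrier_vecD[OF Pc[OF c]] carrier_vecD[OF Pc[OF Ac]]
    by (intro eq_vecI) (simp_all del: index_mult_mat_vec)
  finally have "char_matrix A l *\<^sub>v (P *\<^sub>v c) - P *\<^sub>v (cmp A *\<^sub>v c - l \<cdot>\<^sub>v c) \<in> W"
    using cmp(2)[OF assms c] by simp
  then have "cmp (char_matrix A l) *\<^sub>v c = cmp A *\<^sub>v c - l \<cdot>\<^sub>v c"
    by (rule cmp_vec_eqI[OF stable_char_matrix[OF assms] c, rotated]) (use Ac c in auto)
  then show "cmp (char_matrix A l) *\<^sub>v c = char_matrix (cmp A) l *\<^sub>v c"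
    using char_matrix_mult_vec[OF cA c] by simp
qed (use cmp(1) assms stable_char_matrix in auto)

text \<open>A power of \<open>A - l\<close> that maps \<open>E\<close> into \<open>W\<close> induces
  0 on \<open>E/W\<close>, and compression commutes with powers and with subtracting
  \<open>l\<close>. The matrix \<open>A\<close> itself may have other eigenvalues outside this
  subquotient.\<close>

lemma cmp_almost_scalar:
  assumes "stable A" and k: "\<And>x. x \<in> E \<Longrightarrow> char_matrix A l ^\<^sub>m k *\<^sub>v x \<in> W"
  shows "almost_scalar m (cmp A) l"
proof -
  note st = stable_pow[OF stable_char_matrix[OF assms(1)], of l k]
  have "cmp (char_matrix A l ^\<^sub>m k) = 0\<^sub>m m m"
  proof (rule eq_mat_by_vec[of _ m m])
    fix c :: "'a vec" assume c: "c \<in> carrier_vec m"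
    have z: "P *\<^sub>v 0\<^sub>v m = 0\<^sub>v n" using P by (intro eq_vecI) auto
    have "char_matrix A l ^\<^sub>m k *\<^sub>v (P *\<^sub>v c) - P *\<^sub>v 0\<^sub>v m \<in> W"
      using lin_sub_minus[OF W k[OF basis_matD(2)[OF B c]] lin_subD(2)[OF W]] z by simp
    then show "cmp (char_matrix A l ^\<^sub>m k) *\<^sub>v c = 0\<^sub>m m m *\<^sub>v c"
      using cmp_vec_eqI[OF st c zero_carrier_vec] zero_mat_mult_vec[OF c] by simp
  qed (use cmp(1) st in auto)
  then show ?thesis
    using cmp(1)[OF assms(1)] cmp_pow[OF stable_char_matrix[OF assms(1)]] cmp_char_matrix[OF assms(1)]
    unfolding almost_scalar_def by metis
qed

lemma cmp_eigenvector:
  assumes "stable A" "c \<in> carrier_vec m" "cmp A *\<^sub>v c = e \<cdot>\<^sub>v c"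
  shows "A *\<^sub>v (P *\<^sub>v c) - e \<cdot>\<^sub>v (P *\<^sub>v c) \<in> W"
  using cmp(2)[OF assms(1,2)] mult_mat_vec[OF P assms(2)] assms(3) by simp

lemma cmp_semigroup:
  assumes "matrix_semigroup n S" "\<And>A. A \<in> S \<Longrightarrow> stable A"
  shows "matrix_semigroup m (cmp ` S)"
  using assms cmp(1) cmp_mult unfolding matrix_semigroup_def by (auto simp: image_iff) metis

lemma size_pos:
  assumes "W \<noteq> E"
  shows "0 < m"
proof (rule ccontr)
  assume m: "\<not> 0 < m"
  have "x \<in> W" if x: "x \<in> E" for x
  proof -
    obtain c where c: "c \<in> carrier_vec m" "x - P *\<^sub>v c \<in> W" using basis_matD(4)[OF B x] by blast
    have "P *\<^sub>v c = 0\<^sub>v n" using m c P by (intro eq_vecI) (auto simp: scalar_prod_def)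
    then show ?thesis using lin_sub_diff_mem[OF W lin_subD(1)[OF E x] _ c(2)] lin_subD(2)[OF W] by simp
  qed
  then show False using assms WE by blast
qed

text \<open>Correspondence of submodules: an invariant subspace \<open>U\<close> of coordinates
  pulls back to an invariant \<open>E'\<close> between \<open>W\<close> and \<open>E\<close>, and
  the two possibilities for \<open>E'\<close> translate into those for \<open>U\<close>.\<close>

lemma cmp_irreducible:
  assumes S: "\<And>A. A \<in> S \<Longrightarrow> stable A"
    and min: "\<And>E'. lin_sub n E' \<Longrightarrow> W \<subseteq> E' \<Longrightarrow> E' \<subseteq> E \<Longrightarrow> \<forall>A\<in>S. \<forall>x\<in>E'. A *\<^sub>v x \<in> E' \<Longrightarrow> E' = W \<or> E' = E"
    and U: "lin_sub m U" and inv: "\<And>A c. A \<in> S \<Longrightarrow> c \<in> U \<Longrightarrow> cmp A *\<^sub>v c \<in> U"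
  shows "U = {0\<^sub>v m} \<or> U = carrier_vec m"
proof -
  define E' where "E' = {x \<in> E. \<exists>c\<in>U. x - P *\<^sub>v c \<in> W}"
  have Uc: "c \<in> carrier_vec m" if "c \<in> U" for c using lin_subD(1)[OF U that] .
  have "lin_sub n E'" unfolding lin_sub_def
  proof (intro conjI ballI allI)
    show "E' \<subseteq> carrier_vec n" using lin_subD(1)[OF E] by (auto simp: E'_def)
    have "0\<^sub>v n - P *\<^sub>v 0\<^sub>v m = 0\<^sub>v n" using P by (intro eq_vecI) auto
    then show "0\<^sub>v n \<in> E'" using lin_subD(2)[OF U] lin_subD(2)[OF E] lin_subD(2)[OF W]
      unfolding E'_def by (auto intro!: bexI[of _ "0\<^sub>v m"])
  next
    fix x y assume "x \<in> E'" "y \<in> E'"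
    then obtain c d where cd: "x \<in> E" "y \<in> E" "c \<in> U" "d \<in> U" "x - P *\<^sub>v c \<in> W" "y - P *\<^sub>v d \<in> W"
      by (auto simp: E'_def)
    have "x + y - P *\<^sub>v (c + d) = (x - P *\<^sub>v c) + (y - P *\<^sub>v d)"
      unfolding mult_add_distrib_mat_vec[OF P Uc[OF cd(3)] Uc[OF cd(4)]]
      using carrier_vecD[OF lin_subD(1)[OF E cd(1)]] carrier_vecD[OF lin_subD(1)[OF E cd(2)]]
        carrier_vecD[OF Pc[OF Uc[OF cd(3)]]] carrier_vecD[OF Pc[OF Uc[OF cd(4)]]]
      by (intro eq_vecI) (simp_all del: index_mult_mat_vec)
    then show "x + y \<in> E'"
      using cd lin_subD(3)[OF E cd(1,2)] lin_subD(3)[OF U cd(3,4)] lin_subD(3)[OF W cd(5,6)]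
      unfolding E'_def by (auto intro!: bexI[of _ "c + d"])
  next
    fix e x assume "x \<in> E'"
    then obtain c where cd: "x \<in> E" "c \<in> U" "x - P *\<^sub>v c \<in> W" by (auto simp: E'_def)
    have "e \<cdot>\<^sub>v x - P *\<^sub>v (e \<cdot>\<^sub>v c) = e \<cdot>\<^sub>v (x - P *\<^sub>v c)"
      unfolding mult_mat_vec[OF P Uc[OF cd(2)]]
      using carrier_vecD[OF lin_subD(1)[OF E cd(1)]] carrier_vecD[OF Pc[OF Uc[OF cd(2)]]]
      by (intro eq_vecI) (simp_all del: index_mult_mat_vec add: right_diff_distrib)
    then show "e \<cdot>\<^sub>v x \<in> E'"
      using cd lin_subD(4)[OF E cd(1)] lin_subD(4)[OF U cd(2)] lin_subD(4)[OF W cd(3)]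
      unfolding E'_def by (auto intro!: bexI[of _ "e \<cdot>\<^sub>v c"])
  qed
  moreover have "W \<subseteq> E'"
  proof
    fix x assume x: "x \<in> W"
    have "x - P *\<^sub>v 0\<^sub>v m = x" using P lin_subD(1)[OF W x] by (intro eq_vecI) auto
    then show "x \<in> E'" using x WE lin_subD(2)[OF U] unfolding E'_def by (auto intro!: bexI[of _ "0\<^sub>v m"])
  qed
  moreover have "E' \<subseteq> E" by (auto simp: E'_def)
  moreover have "\<forall>A\<in>S. \<forall>x\<in>E'. A *\<^sub>v x \<in> E'"
  proof (intro ballI)
    fix A x assume A: "A \<in> S" and "x \<in> E'"
    then obtain c where cd: "x \<in> E" "c \<in> U" "x - P *\<^sub>v c \<in> W" by (auto simp: E'_def)
    have st: "A \<in> carrier_mat n n" "\<And>x. x \<in> W \<Longrightarrow> A *\<^sub>v x \<in> W" "\<And>x. x \<in> E \<Longrightarrow> A *\<^sub>v x \<in> E"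
      using S[OF A] by (auto simp: stable_def)
    have x: "x \<in> carrier_vec n" using lin_subD(1)[OF E cd(1)] .
    note c = Uc[OF cd(2)]
    have Ac: "cmp A *\<^sub>v c \<in> U" using inv[OF A cd(2)] .
    have "A *\<^sub>v x - A *\<^sub>v (P *\<^sub>v c) \<in> W"
      using st(2)[OF cd(3)] mult_minus_distrib_mat_vec[OF st(1) x Pc[OF c]] by simp
    note tr = this
    have "A *\<^sub>v x - P *\<^sub>v (cmp A *\<^sub>v c) \<in> W"
      by (rule lin_sub_diff_trans[OF W _ _ _ tr cmp(2)[OF S[OF A] c]]) (use st x Pc c Uc[OF Ac] in auto)
    then show "A *\<^sub>v x \<in> E'" using st(3)[OF cd(1)] Ac unfolding E'_def by blast
  qed
  ultimately consider "E' = W" | "E' = E" using min by blast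
  then show ?thesis
  proof cases
    case 1
    have "c = 0\<^sub>v m" if "c \<in> U" for c
    proof -
      have "P *\<^sub>v c - P *\<^sub>v c = 0\<^sub>v n" using Pc[OF Uc[OF that]] by simp
      then have "P *\<^sub>v c \<in> E'" using that basis_matD(2)[OF B Uc[OF that]] lin_subD(2)[OF W] unfolding E'_def by (auto intro!: bexI[of _ c])
      then show ?thesis using 1 basis_matD(3)[OF B Uc[OF that]] by simp
    qed
    then show ?thesis using lin_subD(2)[OF U] by blast
  next
    case 2
    have "c \<in> U" if c: "c \<in> carrier_vec m" for c
    proof -
      have "P *\<^sub>v c \<in> E'" using 2 basis_matD(2)[OF B c] by simp
      then obtain d where "d \<in> U" "P *\<^sub>v c - P *\<^sub>v d \<in> W" by (auto simp: E'_def)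
      then show ?thesis using coord_eqI[OF c Uc] by blast
    qed
    then show ?thesis using Uc by blast
  qed
qed

end

section \<open>Finite groups of prime power order\<close>

text \<open>Class equation: were the center trivial, every conjugacy class except that of the
  identity would have size divisible by \<open>p\<close>, and the order would be 1 modulo
  \<open>p\<close>.\<close>

lemma finite_group_center_nontrivial:
  assumes "group G" and order: "Coset.order G = p ^ a" and p: "Factorial_Ring.prime p" and "0 < a"
  shows "\<exists>z\<in>carrier G. z \<noteq> \<one>\<^bsub>G\<^esub> \<and> (\<forall>g\<in>carrier G. g \<otimes>\<^bsub>G\<^esub> z = z \<otimes>\<^bsub>G\<^esub> g)"
proof (rule ccontr)
  assume no: "\<not> ?thesis"
  interpret group G by fact
  let ?\<phi> = "\<lambda>g. \<lambda>h \<in> carrier G. g \<otimes>\<^bsub>G\<^esub> h \<otimes>\<^bsub>G\<^esub> (inv\<^bsub>G\<^esub> g)"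
  interpret group_action G "carrier G" ?\<phi> by (rule action_by_conjugation)
  have "0 < Coset.order G" using order p by (simp add: prime_gt_0_nat)
  then have fin: "finite (carrier G)" unfolding Coset.order_def by (rule card_ge_0_finite)
  have orb1: "orbit G ?\<phi> \<one>\<^bsub>G\<^esub> = {\<one>\<^bsub>G\<^esub>}" unfolding orbit_def by (auto intro!: exI[of _ "\<one>\<^bsub>G\<^esub>"])
  have dvd: "p dvd card orb" if orb: "orb \<in> orbits G (carrier G) ?\<phi>" "orb \<noteq> {\<one>\<^bsub>G\<^esub>}" for orb
  proof -
    obtain x where x: "x \<in> carrier G" "orb = orbit G ?\<phi> x" using orb(1) unfolding orbits_def by auto
    have "x \<noteq> \<one>\<^bsub>G\<^esub>" using orb(2) x orb1 by auto
    then obtain g where g: "g \<in> carrier G" "g \<otimes>\<^bsub>G\<^esub> x \<noteq> x \<otimes>\<^bsub>G\<^esub> g" using no x(1) by auto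
    have mem: "x \<in> orb" "g \<otimes>\<^bsub>G\<^esub> x \<otimes>\<^bsub>G\<^esub> inv\<^bsub>G\<^esub> g \<in> orb"
      using orbit_refl[OF x(1)] x g(1) unfolding orbit_def by auto
    have ne: "g \<otimes>\<^bsub>G\<^esub> x \<otimes>\<^bsub>G\<^esub> inv\<^bsub>G\<^esub> g \<noteq> x"
    proof
      assume "g \<otimes>\<^bsub>G\<^esub> x \<otimes>\<^bsub>G\<^esub> inv\<^bsub>G\<^esub> g = x"
      then have "g \<otimes>\<^bsub>G\<^esub> x \<otimes>\<^bsub>G\<^esub> inv\<^bsub>G\<^esub> g \<otimes>\<^bsub>G\<^esub> g = x \<otimes>\<^bsub>G\<^esub> g" by simp
      moreover have "g \<otimes>\<^bsub>G\<^esub> x \<otimes>\<^bsub>G\<^esub> inv\<^bsub>G\<^esub> g \<otimes>\<^bsub>G\<^esub> g = g \<otimes>\<^bsub>G\<^esub> x"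
        using g(1) x(1) by (simp add: m_assoc)
      ultimately show False using g(2) by simp
    qed
    \<comment> \<open>By orbit-stabilizer the class size divides \<open>p ^ a\<close>, and it is not
      1 because the class contains \<open>x\<close> and a different conjugate of it.\<close>
    have "card orb dvd p ^ a"
      unfolding x(2) order[symmetric] by (rule dvdI[OF orbit_stabilizer_theorem[OF x(1), symmetric]])
    then obtain i where i: "card orb = p ^ i" using divides_primepow_nat[OF p] by auto
    have "i \<noteq> 0"
    proof
      assume "i = 0"
      then obtain y where "orb = {y}" using i by (auto simp: card_1_singleton_iff)
      then show False using mem ne by auto
    qed
    then show ?thesis using i by simp
  qed
  have "orbits G (carrier G) ?\<phi> \<subseteq> Pow (carrier G)" using orbits_coverture by blast
  then have fo: "finite (orbits G (carrier G) ?\<phi>)" using fin finite_subset by blast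
  have "{\<one>\<^bsub>G\<^esub>} \<in> orbits G (carrier G) ?\<phi>" using orb1 unfolding orbits_def by force
  then have sum: "sum card (orbits G (carrier G) ?\<phi>) = 1 + sum card (orbits G (carrier G) ?\<phi> - {{\<one>\<^bsub>G\<^esub>}})"
    by (subst sum.remove[OF fo]) auto
  have total: "sum card (orbits G (carrier G) ?\<phi>) = p ^ a"
    using disjoint_sum[OF fin, of "\<lambda>_. 1::nat"] order by (simp add: Coset.order_def)
  have "p dvd sum card (orbits G (carrier G) ?\<phi> - {{\<one>\<^bsub>G\<^esub>}})"
    using dvd by (intro dvd_sum) auto
  moreover have "p dvd 1 + sum card (orbits G (carrier G) ?\<phi> - {{\<one>\<^bsub>G\<^esub>}})"
    unfolding sum[symmetric] total using \<open>0 < a\<close> by (simp add: dvd_power)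
  ultimately have "p dvd 1" by (rule dvd_add_left_iff[THEN iffD1])
  then show False using p by simp
qed

text \<open>An element \<open>\<noteq> 1\<close> of order \<open>r^a\<close> makes the characteristic divide \<open>r^a\<close>; this
  singles out one prime \<open>r\<close>, whether or not the characteristic is positive.\<close>

lemma prime_power_orderI:
  assumes G: "group G" "finite (carrier G)"
    and field: "\<And>g k. g \<in> carrier G \<Longrightarrow> g \<noteq> \<one>\<^bsub>G\<^esub> \<Longrightarrow> g [^]\<^bsub>G\<^esub> (k::nat) = \<one>\<^bsub>G\<^esub> \<Longrightarrow> (of_nat k :: 'a :: field) = 0"
    and ne: "carrier G \<noteq> {\<one>\<^bsub>G\<^esub>}"
  shows "\<exists>p a. Factorial_Ring.prime p \<and> 0 < a \<and> Coset.order G = p ^ a"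
proof -
  interpret group G by fact
  have "0 < Coset.order G" using G order_gt_0_iff_finite by simp
  have zero: "(of_nat r :: 'a) = 0" if r: "Factorial_Ring.prime r" "r dvd Coset.order G" for r
  proof -
    have "Coset.order G \<noteq> 0" using \<open>0 < Coset.order G\<close> by simp
    then obtain a m where am: "Coset.order G = r ^ a * m" "\<not> r dvd m"
      using multiplicity_decompose'[of "Coset.order G" r] r(1) by (metis not_prime_unit)
    \<comment> \<open>A nontrivial element of a Sylow subgroup for \<open>r\<close> satisfies
      \<open>h ^ (r ^ a) = 1\<close>, to which \<open>field\<close> applies.\<close>
    obtain H where H: "subgroup H G" "card H = r ^ a" using sylow_thm[OF r(1) G(1) am(1) G(2)] by blast
    have "a \<noteq> 0" using am r(2) by (cases a) auto
    then have "card H \<noteq> 1" using H(2) prime_power_eq_one_iff[OF r(1)] by metis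
    then have "H \<noteq> {\<one>\<^bsub>G\<^esub>}" by auto
    then obtain h where h: "h \<in> H" "h \<noteq> \<one>\<^bsub>G\<^esub>" using subgroup.one_closed[OF H(1)] by blast
    interpret HG: group "G\<lparr>carrier := H\<rparr>" by (rule subgroup.subgroup_is_group[OF H(1) G(1)])
    have "h [^]\<^bsub>G\<lparr>carrier := H\<rparr>\<^esub> Coset.order (G\<lparr>carrier := H\<rparr>) = \<one>\<^bsub>G\<^esub>"
      using HG.pow_order_eq_1[of h] h(1) by simp
    then have "h [^]\<^bsub>G\<^esub> (r ^ a) = \<one>\<^bsub>G\<^esub>" using H(2) by (simp add: Coset.order_def nat_pow_consistent[symmetric])
    then have "(of_nat (r ^ a) :: 'a) = 0" using field subgroup.mem_carrier[OF H(1) h(1)] h(2) by blast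
    then show ?thesis by simp
  qed
  have "Coset.order G \<noteq> 1"
  proof
    assume "Coset.order G = 1"
    then show False using ne one_closed unfolding Coset.order_def by (metis card_1_singletonE singletonD)
  qed
  then obtain p where p: "Factorial_Ring.prime p" "p dvd Coset.order G" using prime_factor_nat by blast
  have unique: "r = p" if r: "Factorial_Ring.prime r" "r dvd Coset.order G" for r
  proof (rule ccontr)
    assume "r \<noteq> p"
    then have "coprime r p" using p r primes_coprime by blast
    \<comment> \<open>Two distinct primes that both vanish in the field would make 1 vanish by
      Bezout.\<close>
    then obtain x y where "int r * x + int p * y = 1"
      by (metis bezout_int coprime_imp_gcd_eq_1 coprime_int_iff mult.commute)
    then have "(of_int (int r * x + int p * y) :: 'a) = 1" by simp
    then show False using zero[OF r] zero[OF p] by simp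
  qed
  obtain a m where am: "Coset.order G = p ^ a * m" "\<not> p dvd m"
    using multiplicity_decompose'[of "Coset.order G" p] p(1) \<open>0 < Coset.order G\<close> by (metis not_prime_unit less_irrefl)
  have "m = 1"
  proof (rule ccontr)
    assume "m \<noteq> 1"
    then obtain r where r: "Factorial_Ring.prime r" "r dvd m" using prime_factor_nat by blast
    then have "r = p" using unique[OF r(1)] am(1) by simp
    then show False using r am by simp
  qed
  moreover have "a \<noteq> 0" using am \<open>Coset.order G \<noteq> 1\<close> calculation by (cases a) auto
  ultimately show ?thesis using am p by auto
qed

section \<open>Irreducible semigroups over an algebraically closed field\<close>

text \<open>In coordinates on \<open>U\<close> the restriction of \<open>A\<close> is a square
  matrix of positive size, and its characteristic polynomial has a root.\<close>

lemma eigenvector_in_invariant_subspace: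
  fixes A :: "'a :: alg_closed_field mat"
  assumes A: "A \<in> carrier_mat n n" and U: "lin_sub n U" "U \<noteq> {0\<^sub>v n}" and inv: "\<And>x. x \<in> U \<Longrightarrow> A *\<^sub>v x \<in> U"
  shows "\<exists>v\<in>U. v \<noteq> 0\<^sub>v n \<and> (\<exists>e. A *\<^sub>v v = e \<cdot>\<^sub>v v)"
proof -
  obtain m P where B: "basis_mat n m {0\<^sub>v n} U P" using basis_mat_exists[OF lin_sub_zero U(1)] by blast
  interpret compression n m "{0\<^sub>v n}" U P
    by unfold_locales (use B U lin_sub_zero lin_subD(2)[OF U(1)] in auto)
  have "A *\<^sub>v 0\<^sub>v n = 0\<^sub>v n" using A by (intro eq_vecI) auto
  then have st: "stable A" using A inv by (simp add: stable_def)
  note cA = cmp(1)[OF st]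
  have "0 < m" using size_pos U(2) by blast
  then have "0 < Polynomial.degree (char_poly (cmp A))" using degree_monic_char_poly[OF cA] by simp
  then obtain e where "poly (char_poly (cmp A)) e = 0" using alg_closed_imp_poly_has_root by blast
  then have "eigenvalue (cmp A) e" using eigenvalue_root_char_poly[OF cA] by blast
  then obtain c where c: "c \<in> carrier_vec m" "c \<noteq> 0\<^sub>v m" "cmp A *\<^sub>v c = e \<cdot>\<^sub>v c"
    using cA unfolding eigenvalue_def eigenvector_def by auto
  have "A *\<^sub>v (P *\<^sub>v c) - e \<cdot>\<^sub>v (P *\<^sub>v c) = 0\<^sub>v n" using cmp_eigenvector[OF st c(1,3)] by simp
  then have "A *\<^sub>v (P *\<^sub>v c) = e \<cdot>\<^sub>v (P *\<^sub>v c)"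
    using vec_diff_zero_iff[OF mult_mat_vec_carrier[OF A Pc[OF c(1)]] smult_carrier_vec[THEN iffD2, OF Pc[OF c(1)]]] by blast
  moreover have "P *\<^sub>v c \<in> U" "P *\<^sub>v c \<noteq> 0\<^sub>v n" using basis_matD(2,3)[OF B c(1)] c(2) by auto
  ultimately show ?thesis by blast
qed

text \<open>The linear span as an inductive set, so that linear conditions pass from
  \<open>S\<close> to the span by induction. Zero arises as \<open>0 \<cdot>\<^sub>m A\<close>; the
  span of the empty set is therefore empty.\<close>

inductive_set mspan :: "'a :: field mat set \<Rightarrow> 'a mat set" for S where
  base: "A \<in> S \<Longrightarrow> A \<in> mspan S"
| add: "A \<in> mspan S \<Longrightarrow> B \<in> mspan S \<Longrightarrow> A + B \<in> mspan S"
| smult: "A \<in> mspan S \<Longrightarrow> c \<cdot>\<^sub>m A \<in> mspan S"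

lemma mspan_carrier:
  assumes "S \<subseteq> carrier_mat n m" "A \<in> mspan S"
  shows "A \<in> carrier_mat n m"
  using assms(2) by induction (use assms(1) in auto)

lemma mspan_mult:
  assumes S: "matrix_semigroup n S" and A: "A \<in> mspan S" and B: "B \<in> mspan S"
  shows "A * B \<in> mspan S"
proof -
  have Sc: "S \<subseteq> carrier_mat n n" using S by (simp add: matrix_semigroup_def)
  have 1: "A * B \<in> mspan S" if A: "A \<in> S" and B: "B \<in> mspan S" for A B
    using B
  proof induction
    case (base B)
    then show ?case using S A by (auto simp: matrix_semigroup_def intro: mspan.base)
  next
    case (add B C)
    have "A * (B + C) = A * B + A * C"
      using A Sc add.hyps mspan_carrier[OF Sc] by (intro mult_add_distrib_mat) auto
    then show ?case using add.IH mspan.add by metis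
  next
    case (smult B c)
    have "A * (c \<cdot>\<^sub>m B) = c \<cdot>\<^sub>m (A * B)"
      using A Sc smult.hyps mspan_carrier[OF Sc] by (intro mult_smult_distrib) auto
    then show ?case using smult.IH mspan.smult by metis
  qed
  show ?thesis using A
  proof induction
    case (base A)
    then show ?case using 1 B by blast
  next
    case (add A C)
    have "(A + C) * B = A * B + C * B"
      by (rule add_mult_distrib_mat[OF mspan_carrier[OF Sc add.hyps(1)] mspan_carrier[OF Sc add.hyps(2)] mspan_carrier[OF Sc B]])
    then show ?case using add.IH mspan.add by metis
  next
    case (smult A c)
    have "(c \<cdot>\<^sub>m A) * B = c \<cdot>\<^sub>m (A * B)"
      by (rule mult_smult_assoc_mat[OF mspan_carrier[OF Sc smult.hyps] mspan_carrier[OF Sc B]])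
    then show ?case using smult.IH mspan.smult by metis
  qed
qed

text \<open>\<open>Y\<close> is built from finitely many members of \<open>S\<close>, and the trace
  of \<open>M * Y\<close> is the same combination of the traces against them. The finiteness is what
  later bounds the number of unipotent parts.\<close>

lemma mspan_trace_finite:
  assumes Sc: "S \<subseteq> carrier_mat n n" and Y: "Y \<in> mspan S"
  shows "\<exists>H\<subseteq>S. finite H \<and> (\<forall>M\<in>carrier_mat n n. (\<forall>Z\<in>H. mat_trace (M * Z) = 0) \<longrightarrow> mat_trace (M * Y) = 0)"
  using Y
proof induction
  case (base A)
  then show ?case by (intro exI[of _ "{A}"]) auto
next
  case (add A B)
  then obtain H K where "H \<subseteq> S" "finite H" "\<forall>M\<in>carrier_mat n n. (\<forall>Z\<in>H. mat_trace (M * Z) = 0) \<longrightarrow> mat_trace (M * A) = 0"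
    "K \<subseteq> S" "finite K" "\<forall>M\<in>carrier_mat n n. (\<forall>Z\<in>K. mat_trace (M * Z) = 0) \<longrightarrow> mat_trace (M * B) = 0" by blast
  moreover have "mat_trace (M * (A + B)) = mat_trace (M * A) + mat_trace (M * B)" if "M \<in> carrier_mat n n" for M
    using mat_trace_add[of "M * A" n "M * B"] mult_add_distrib_mat[OF that, of A n B] that
      mspan_carrier[OF Sc add.hyps(1)] mspan_carrier[OF Sc add.hyps(2)] by auto
  ultimately show ?case by (intro exI[of _ "H \<union> K"]) auto
next
  case (smult A c)
  then obtain H where "H \<subseteq> S" "finite H" "\<forall>M\<in>carrier_mat n n. (\<forall>Z\<in>H. mat_trace (M * Z) = 0) \<longrightarrow> mat_trace (M * A) = 0"
    by blast
  moreover have "mat_trace (M * (c \<cdot>\<^sub>m A)) = c * mat_trace (M * A)" if "M \<in> carrier_mat n n" for M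
    using mat_trace_smult[of "M * A" n c] mult_smult_distrib[OF that, of A n c] that
      mspan_carrier[OF Sc smult.hyps(1)] by auto
  ultimately show ?case by (intro exI[of _ H]) auto
qed

text \<open>Entry \<open>(j, i)\<close> of \<open>T\<close> is \<open>f (e_i) u_j\<close>, so
  \<open>tr (L T)\<close> is the sum of \<open>f (e_i) (L u)_i\<close>, the value at
  \<open>L u\<close> of the functional behind \<open>T\<close>. Keeping the factor \<open>u\<close>
  expresses that value through \<open>T\<close> alone.\<close>

lemma trace_rank_one:
  fixes T L :: "'a :: field mat"
  assumes T: "T \<in> carrier_mat n n" and L: "L \<in> carrier_mat n n" and u: "u \<in> carrier_vec n"
    and f: "\<And>y. y \<in> carrier_vec n \<Longrightarrow> T *\<^sub>v y = f y \<cdot>\<^sub>v u"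
  shows "mat_trace (L * T) \<cdot>\<^sub>v u = T *\<^sub>v (L *\<^sub>v u)"
proof -
  have Tij: "T $$ (j,i) = f (unit_vec n i) * u $ j" if "i < n" "j < n" for i j
  proof -
    have "T $$ (j,i) = (T *\<^sub>v unit_vec n i) $ j" using mult_mat_vec_unit[OF T that(1)] T that by simp
    then show ?thesis using f[of "unit_vec n i"] u that by simp
  qed
  have vec: "(M *\<^sub>v y) $ i = (\<Sum>j<n. M $$ (i,j) * y $ j)"
    if "M \<in> carrier_mat n n" "y \<in> carrier_vec n" "i < n" for M :: "'a mat" and y i
    using that by (auto simp: scalar_prod_def lessThan_atLeast0 intro!: sum.cong)
  have tr: "mat_trace (L * T) = (\<Sum>i<n. f (unit_vec n i) * (L *\<^sub>v u) $ i)"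
    unfolding mat_trace_mult[OF L T]
    by (intro sum.cong refl) (simp add: vec[OF L u] Tij sum_distrib_left mult_ac del: index_mult_mat_vec)
  have Lu: "L *\<^sub>v u \<in> carrier_vec n" using L u by simp
  show ?thesis
  proof (intro eq_vecI)
    fix j assume "j < dim_vec (T *\<^sub>v (L *\<^sub>v u))"
    then have j: "j < n" using T by simp
    have "(T *\<^sub>v (L *\<^sub>v u)) $ j = (\<Sum>i<n. f (unit_vec n i) * u $ j * (L *\<^sub>v u) $ i)"
      unfolding vec[OF T Lu j] using j Tij by (intro sum.cong) auto
    also have "\<dots> = mat_trace (L * T) * u $ j"
      unfolding tr sum_distrib_right by (intro sum.cong refl) (simp add: mult_ac del: index_mult_mat_vec)
    finally show "(mat_trace (L * T) \<cdot>\<^sub>v u) $ j = (T *\<^sub>v (L *\<^sub>v u)) $ j" using u j by simp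
  qed (use T u in auto)
qed

text \<open>A nonscalar member rules out the sizes 0 and 1, where every semigroup is irreducible in
  this sense, and provides the nonzero element from which the search for rank one starts.\<close>

locale irreducible_semigroup =
  fixes n :: nat and S :: "'a :: alg_closed_field mat set" and B0 :: "'a mat"
  assumes semigroup: "matrix_semigroup n S"
    and irreducible: "\<And>U. lin_sub n U \<Longrightarrow> (\<And>A x. A \<in> S \<Longrightarrow> x \<in> U \<Longrightarrow> A *\<^sub>v x \<in> U) \<Longrightarrow>
      U = {0\<^sub>v n} \<or> U = carrier_vec n"
    and B0: "B0 \<in> S" and nonscalar: "\<And>c. B0 \<noteq> c \<cdot>\<^sub>m 1\<^sub>m n"
begin

lemma S_carrier: "S \<subseteq> carrier_mat n n" and S_mult: "A \<in> S \<Longrightarrow> B \<in> S \<Longrightarrow> A * B \<in> S"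
  using semigroup by (auto simp: matrix_semigroup_def)

lemma S_mat: "A \<in> S \<Longrightarrow> A \<in> carrier_mat n n"
  using S_carrier by blast

lemmas span_carrier = mspan_carrier[OF S_carrier]
lemmas span_mult = mspan_mult[OF semigroup]

lemma B0_nonzero: "B0 \<noteq> 0\<^sub>m n n"
proof -
  have "0 \<cdot>\<^sub>m 1\<^sub>m n = (0\<^sub>m n n :: 'a mat)" by (intro eq_matI) auto
  then show ?thesis using nonscalar[of 0] by simp
qed

text \<open>The vectors \<open>M x\<close> with \<open>M\<close> in the span form an invariant
  subspace. Were it zero, \<open>x\<close> would lie in the common kernel of \<open>S\<close>, which
  is invariant too and hence the whole space, against \<open>B0\<close> being nonzero. The detour is
  due to the span not being known to contain the identity.\<close>

lemma span_transitive:
  assumes x: "x \<in> carrier_vec n" "x \<noteq> 0\<^sub>v n" and y: "y \<in> carrier_vec n"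
  shows "\<exists>M\<in>mspan S. M *\<^sub>v x = y"
proof -
  define U where "U = (\<lambda>M. M *\<^sub>v x) ` mspan S"
  have "lin_sub n U" unfolding lin_sub_def
  proof (intro conjI ballI allI)
    show "U \<subseteq> carrier_vec n" using span_carrier x unfolding U_def by fastforce
    have "0 \<cdot>\<^sub>m B0 \<in> mspan S" using B0 by (intro mspan.intros)
    moreover have "(0 \<cdot>\<^sub>m B0) *\<^sub>v x = 0\<^sub>v n" using S_mat[OF B0] x by (intro eq_vecI) auto
    ultimately show "0\<^sub>v n \<in> U" unfolding U_def by (metis imageI)
  next
    fix v w assume "v \<in> U" "w \<in> U"
    then obtain M Y where M: "M \<in> mspan S" "Y \<in> mspan S" "v = M *\<^sub>v x" "w = Y *\<^sub>v x" by (auto simp: U_def)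
    then have "v + w = (M + Y) *\<^sub>v x"
      using add_mult_distrib_mat_vec[OF span_carrier[OF M(1)] span_carrier[OF M(2)] x(1)] by simp
    then show "v + w \<in> U" using mspan.add[OF M(1,2)] unfolding U_def by blast
  next
    fix c v assume "v \<in> U"
    then obtain M where M: "M \<in> mspan S" "v = M *\<^sub>v x" by (auto simp: U_def)
    then have "c \<cdot>\<^sub>v v = (c \<cdot>\<^sub>m M) *\<^sub>v x" using span_carrier[OF M(1)] x by (intro eq_vecI) auto
    then show "c \<cdot>\<^sub>v v \<in> U" using mspan.smult[OF M(1)] unfolding U_def by blast
  qed
  moreover have "A *\<^sub>v v \<in> U" if A: "A \<in> S" and v: "v \<in> U" for A v
  proof -
    obtain M where M: "M \<in> mspan S" "v = M *\<^sub>v x" using v by (auto simp: U_def)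
    then have "A *\<^sub>v v = (A * M) *\<^sub>v x" using S_mat[OF A] span_carrier[OF M(1)] x by simp
    then show ?thesis using span_mult[OF mspan.base[OF A] M(1)] unfolding U_def by blast
  qed
  ultimately consider "U = {0\<^sub>v n}" | "U = carrier_vec n" using irreducible by blast
  then show ?thesis
  proof cases
    case 1
    define K where "K = {x \<in> carrier_vec n. \<forall>A\<in>S. A *\<^sub>v x = 0\<^sub>v n}"
    have z: "A *\<^sub>v 0\<^sub>v n = 0\<^sub>v n" if "A \<in> S" for A using S_mat[OF that] by (intro eq_vecI) auto
    have "lin_sub n K"
      unfolding lin_sub_def K_def
      using mult_add_distrib_mat_vec[OF S_mat] mult_mat_vec[OF S_mat] z by auto
    moreover have "A *\<^sub>v v \<in> K" if "A \<in> S" "v \<in> K" for A v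
      using that z unfolding K_def by auto
    ultimately have "K = {0\<^sub>v n} \<or> K = carrier_vec n" by (rule irreducible)
    moreover have "x \<in> K" using 1 x mspan.base unfolding K_def U_def by auto
    ultimately have "K = carrier_vec n" using x by auto
    then have "B0 *\<^sub>v c = 0\<^sub>v n" if "c \<in> carrier_vec n" for c using B0 that unfolding K_def by blast
    then have "B0 = 0\<^sub>m n n"
      using eq_mat_by_vec[OF S_mat[OF B0] zero_carrier_mat] zero_mat_mult_vec by metis
    then show ?thesis using B0_nonzero by blast
  next
    case 2
    then have "y \<in> U" using y by simp
    then show ?thesis unfolding U_def by auto
  qed
qed

text \<open>Burnside's argument: an element of the span whose kernel is maximal has rank one, since
  otherwise \<open>T A T - e T\<close> would have a larger kernel for an eigenvalue \<open>e\<close> of \<open>T A\<close> on the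
  image of \<open>T\<close>.\<close>

lemma rank_one_in_span:
  obtains T u f x where "T \<in> mspan S" "u \<in> carrier_vec n" "x \<in> carrier_vec n" "T *\<^sub>v x \<noteq> 0\<^sub>v n"
    "u \<noteq> 0\<^sub>v n" "\<And>y. y \<in> carrier_vec n \<Longrightarrow> T *\<^sub>v y = f y \<cdot>\<^sub>v u"
proof -
  define ker where "ker T = {x \<in> carrier_vec n. T *\<^sub>v x = 0\<^sub>v n}" for T :: "'a mat"
  have lk: "lin_sub n (ker T)" if "T \<in> carrier_mat n n" for T
    using lin_sub_preimage[OF that lin_sub_zero] unfolding ker_def by simp
  have "ker B0 \<in> {ker T | T. T \<in> mspan S \<and> T \<noteq> 0\<^sub>m n n}" using B0 B0_nonzero mspan.base by blast
  then obtain K where K: "K \<in> {ker T | T. T \<in> mspan S \<and> T \<noteq> 0\<^sub>m n n}"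
    "\<And>U. U \<in> {ker T | T. T \<in> mspan S \<and> T \<noteq> 0\<^sub>m n n} \<Longrightarrow> K \<subseteq> U \<Longrightarrow> U = K"
    by (rule lin_sub_maximal) (use lk span_carrier in auto)
  then obtain T where T: "T \<in> mspan S" "T \<noteq> 0\<^sub>m n n" "K = ker T" by blast
  note Tc = span_carrier[OF T(1)]
  have "\<exists>x\<in>carrier_vec n. T *\<^sub>v x \<noteq> 0\<^sub>v n"
    using T(2) eq_mat_by_vec[OF Tc, of "0\<^sub>m n n"] zero_mat_mult_vec by fastforce
  then obtain x where x: "x \<in> carrier_vec n" "T *\<^sub>v x \<noteq> 0\<^sub>v n" by blast
  have TAT: "\<exists>e. \<forall>y\<in>carrier_vec n. T *\<^sub>v (A *\<^sub>v (T *\<^sub>v y)) = e \<cdot>\<^sub>v (T *\<^sub>v y)" if A: "A \<in> mspan S" for A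
  proof -
    note Ac = span_carrier[OF A]
    let ?I = "(\<lambda>x. T *\<^sub>v x) ` carrier_vec n"
    have "\<exists>v\<in>?I. v \<noteq> 0\<^sub>v n \<and> (\<exists>e. (T * A) *\<^sub>v v = e \<cdot>\<^sub>v v)"
    proof (rule eigenvector_in_invariant_subspace)
      show "lin_sub n ?I" by (rule mult_mat_vec_lin_sub_image[OF Tc lin_sub_carrier])
      show "?I \<noteq> {0\<^sub>v n}" using x by blast
      show "(T * A) *\<^sub>v v \<in> ?I" if "v \<in> ?I" for v using that Tc Ac by auto
    qed (use Tc Ac in simp)
    then obtain y e where y: "y \<in> carrier_vec n" "T *\<^sub>v y \<noteq> 0\<^sub>v n" "(T * A) *\<^sub>v (T *\<^sub>v y) = e \<cdot>\<^sub>v (T *\<^sub>v y)"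
      by blast
    define T1 where "T1 = T * A * T + (- e) \<cdot>\<^sub>m T"
    have T1: "T1 \<in> mspan S" unfolding T1_def by (rule mspan.add[OF span_mult[OF span_mult[OF T(1) A] T(1)] mspan.smult[OF T(1)]])
    have T1_vec: "T1 *\<^sub>v z = T *\<^sub>v (A *\<^sub>v (T *\<^sub>v z)) - e \<cdot>\<^sub>v (T *\<^sub>v z)" if z: "z \<in> carrier_vec n" for z
    proof -
      have "T1 *\<^sub>v z = (T * A * T) *\<^sub>v z + (- e \<cdot>\<^sub>m T) *\<^sub>v z"
        unfolding T1_def using Tc Ac z by (intro add_mult_distrib_mat_vec) auto
      also have "(T * A * T) *\<^sub>v z = T *\<^sub>v (A *\<^sub>v (T *\<^sub>v z))"
        using assoc_mult_mat_vec[OF mult_carrier_mat[OF Tc Ac] Tc z] assoc_mult_mat_vec[OF Tc Ac mult_mat_vec_carrier[OF Tc z]] by simp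
      also have "(- e \<cdot>\<^sub>m T) *\<^sub>v z = - e \<cdot>\<^sub>v (T *\<^sub>v z)" using Tc z by (intro eq_vecI) auto
      finally show ?thesis using Tc by (auto intro!: eq_vecI simp del: index_mult_mat_vec)
    qed
    have z: "T *\<^sub>v 0\<^sub>v n = 0\<^sub>v n" "A *\<^sub>v 0\<^sub>v n = 0\<^sub>v n" using Tc Ac by (auto intro!: eq_vecI)
    have "ker T \<subseteq> ker T1" using T1_vec z unfolding ker_def by auto
    moreover have "y \<in> ker T1" "y \<notin> ker T"
      using T1_vec[OF y(1)] y Tc Ac mult_mat_vec_carrier[OF Tc y(1)] unfolding ker_def by auto
    ultimately have "T1 = 0\<^sub>m n n" using K(2)[of "ker T1"] T T1 by blast
    then have "T *\<^sub>v (A *\<^sub>v (T *\<^sub>v z)) = e \<cdot>\<^sub>v (T *\<^sub>v z)" if z: "z \<in> carrier_vec n" for z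
      using T1_vec[OF z] zero_mat_mult_vec[OF z]
        vec_diff_zero_iff[of "T *\<^sub>v (A *\<^sub>v (T *\<^sub>v z))" n "e \<cdot>\<^sub>v (T *\<^sub>v z)"] Tc Ac z by auto
    then show ?thesis by blast
  qed
  have Tx: "T *\<^sub>v x \<in> carrier_vec n" using Tc x by simp
  \<comment> \<open>By transitivity \<open>y = M (T x)\<close>, so \<open>T y = T M T x\<close> is a
    multiple of \<open>T x\<close>: the image of \<open>T\<close> is a line.\<close>
  have "\<exists>c. T *\<^sub>v y = c \<cdot>\<^sub>v (T *\<^sub>v x)" if y: "y \<in> carrier_vec n" for y
  proof -
    obtain M where M: "M \<in> mspan S" "M *\<^sub>v (T *\<^sub>v x) = y" using span_transitive[OF Tx x(2) y] by blast
    then show ?thesis using TAT[OF M(1)] x(1) by metis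
  qed
  then obtain f where "\<And>y. y \<in> carrier_vec n \<Longrightarrow> T *\<^sub>v y = f y \<cdot>\<^sub>v (T *\<^sub>v x)" by metis
  then show ?thesis using that T(1) Tx x by blast
qed

text \<open>Nondegeneracy of the trace form. For \<open>T\<close> of rank one with image spanned by
  \<open>u\<close>, and \<open>G i\<close> sending \<open>u\<close> to the unit vector
  \<open>e_i\<close>, the equation \<open>tr (M G_i T A) = tr (A M G_i T) = 0\<close> gives
  \<open>T A M e_i = 0\<close>; if this holds for enough \<open>A\<close> in the span, then
  \<open>M e_i = 0\<close>.\<close>

lemma finite_trace_test:
  "\<exists>H\<subseteq>S. finite H \<and> (\<forall>M\<in>carrier_mat n n. (\<forall>Z\<in>H. mat_trace (M * Z) = 0) \<longrightarrow> M = 0\<^sub>m n n)"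
proof -
  obtain T u f x where T: "T \<in> mspan S" "u \<in> carrier_vec n" "x \<in> carrier_vec n" "T *\<^sub>v x \<noteq> 0\<^sub>v n"
    "u \<noteq> 0\<^sub>v n" and f: "\<And>y. y \<in> carrier_vec n \<Longrightarrow> T *\<^sub>v y = f y \<cdot>\<^sub>v u"
    by (rule rank_one_in_span) blast
  note Tc = span_carrier[OF T(1)]
  define ann where "ann H = {y \<in> carrier_vec n. \<forall>A\<in>H. T *\<^sub>v (A *\<^sub>v y) = 0\<^sub>v n}" for H :: "'a mat set"
  have lin_ann: "lin_sub n (ann H)" if H: "H \<subseteq> mspan S" for H
  proof -
    have "lin_sub n {y \<in> carrier_vec n. T *\<^sub>v (A *\<^sub>v y) \<in> {0\<^sub>v n}}" if A: "A \<in> H" for A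
    proof -
      have Ac: "A \<in> carrier_mat n n" using span_carrier H A by blast
      have "{y \<in> carrier_vec n. T *\<^sub>v (A *\<^sub>v y) \<in> {0\<^sub>v n}} = {y \<in> carrier_vec n. (T * A) *\<^sub>v y \<in> {0\<^sub>v n}}"
        using Tc Ac by auto
      then show ?thesis using lin_sub_preimage[OF mult_carrier_mat[OF Tc Ac] lin_sub_zero] by simp
    qed
    then show ?thesis unfolding ann_def lin_sub_def by auto
  qed
  \<comment> \<open>A smallest annihilator exists by dimension, so finitely many \<open>A\<close>
    suffice; transitivity shows that it is zero.\<close>
  have "ann {} \<in> {ann H | H. finite H \<and> H \<subseteq> mspan S}" by blast
  then obtain W where W: "W \<in> {ann H | H. finite H \<and> H \<subseteq> mspan S}"
    "\<And>U. U \<in> {ann H | H. finite H \<and> H \<subseteq> mspan S} \<Longrightarrow> U \<subseteq> W \<Longrightarrow> U = W"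
    by (rule lin_sub_minimal) (use lin_ann in auto)
  then obtain H where H: "finite H" "H \<subseteq> mspan S" "W = ann H" by blast
  have ann0: "y = 0\<^sub>v n" if y: "y \<in> ann H" for y
  proof (rule ccontr)
    assume "y \<noteq> 0\<^sub>v n"
    moreover have yc: "y \<in> carrier_vec n" using y by (auto simp: ann_def)
    ultimately obtain A where A: "A \<in> mspan S" "A *\<^sub>v y = x" using span_transitive T(3) by blast
    have "ann (insert A H) \<in> {ann H | H. finite H \<and> H \<subseteq> mspan S}" using H A by blast
    moreover have "ann (insert A H) \<subseteq> W" unfolding H(3) ann_def by auto
    ultimately have "ann (insert A H) = W" by (rule W(2))
    then have "y \<in> ann (insert A H)" using y H(3) by simp
    then show False using A T(4) by (auto simp: ann_def)
  qed
  have "\<exists>M\<in>mspan S. M *\<^sub>v u = unit_vec n i" for i using span_transitive[OF T(2,5)] by simp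
  then obtain G where G: "\<And>i. G i \<in> mspan S" "\<And>i. G i *\<^sub>v u = unit_vec n i" by metis
  \<comment> \<open>These finitely many products lie in the span, and each of them is in turn
    replaced by a finite set of members of \<open>S\<close>.\<close>
  define F where "F = (\<lambda>(i, A). G i * (T * A)) ` ({..<n} \<times> H)"
  have "F \<subseteq> mspan S" unfolding F_def using G(1) T(1) H(2) span_mult by auto
  then have "\<forall>Y\<in>F. \<exists>K\<subseteq>S. finite K \<and> (\<forall>M\<in>carrier_mat n n. (\<forall>Z\<in>K. mat_trace (M * Z) = 0) \<longrightarrow> mat_trace (M * Y) = 0)"
    using mspan_trace_finite[OF S_carrier] by blast
  from bchoice[OF this] obtain K where K: "\<And>Y. Y \<in> F \<Longrightarrow> K Y \<subseteq> S" "\<And>Y. Y \<in> F \<Longrightarrow> finite (K Y)"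
    "\<And>M Y. Y \<in> F \<Longrightarrow> M \<in> carrier_mat n n \<Longrightarrow> \<forall>Z\<in>K Y. mat_trace (M * Z) = 0 \<Longrightarrow> mat_trace (M * Y) = 0"
    by blast
  have "M = 0\<^sub>m n n" if M: "M \<in> carrier_mat n n" and tr: "\<forall>Z\<in>\<Union> (K ` F). mat_trace (M * Z) = 0" for M
  proof -
    have "M *\<^sub>v unit_vec n i = 0\<^sub>v n" if i: "i < n" for i
    proof (rule ann0)
      have "T *\<^sub>v (A *\<^sub>v (M *\<^sub>v unit_vec n i)) = 0\<^sub>v n" if A: "A \<in> H" for A
      proof -
        have c: "A \<in> carrier_mat n n" "G i \<in> carrier_mat n n"
          using span_carrier G(1) H(2) A by blast+
        have "G i * (T * A) \<in> F" unfolding F_def using i A by auto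
        then have "0 = mat_trace (M * (G i * (T * A)))" using K(3)[OF _ M] tr by auto
        also have "M * (G i * (T * A)) = (M * G i * T) * A"
          using M c Tc by (simp add: assoc_mult_mat[of _ n n _ n _ n])
        also have "mat_trace \<dots> = mat_trace (A * (M * G i * T))"
          using M c Tc by (intro mat_trace_mult_comm[of _ n n]) auto
        also have "A * (M * G i * T) = (A * (M * G i)) * T"
          using M c Tc by (simp add: assoc_mult_mat[of _ n n _ n _ n])
        finally have "mat_trace ((A * (M * G i)) * T) = 0" by simp
        moreover have "mat_trace ((A * (M * G i)) * T) \<cdot>\<^sub>v u = T *\<^sub>v ((A * (M * G i)) *\<^sub>v u)"
          using M c by (intro trace_rank_one[OF Tc _ T(2) f]) auto
        moreover have "(A * (M * G i)) *\<^sub>v u = A *\<^sub>v (M *\<^sub>v unit_vec n i)"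
          using M c T(2) G(2)[of i] by (simp add: assoc_mult_mat_vec[of _ n n _ n])
        moreover have "0 \<cdot>\<^sub>v u = 0\<^sub>v n" using T(2) by auto
        ultimately show ?thesis by simp
      qed
      then show "M *\<^sub>v unit_vec n i \<in> ann H" unfolding ann_def using M by simp
    qed
    then have "unit_vec n i \<in> {c \<in> carrier_vec n. M *\<^sub>v c \<in> {0\<^sub>v n}}" if "i < n" for i using that by simp
    then have "c \<in> {c \<in> carrier_vec n. M *\<^sub>v c \<in> {0\<^sub>v n}}" if "c \<in> carrier_vec n" for c
      using lin_sub_unit_vecs[OF lin_sub_preimage[OF M lin_sub_zero] _ that] by blast
    then show ?thesis using eq_mat_by_vec[OF M zero_carrier_mat] zero_mat_mult_vec by fastforce
  qed
  moreover have "finite (\<Union> (K ` F))" using K(2) H(1) unfolding F_def by blast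
  moreover have "\<Union> (K ` F) \<subseteq> S" using K(1) by blast
  ultimately show ?thesis by blast
qed

end

section \<open>The finite group of unipotent parts\<close>

lemma smult_smult_mat:
  fixes A :: "'a :: semigroup_mult mat"
  shows "c \<cdot>\<^sub>m (d \<cdot>\<^sub>m A) = (c * d) \<cdot>\<^sub>m A"
  by (intro eq_matI) (auto simp: mult.assoc)

lemma one_smult_mat: "(1 :: 'a :: monoid_mult) \<cdot>\<^sub>m A = A"
  by (intro eq_matI) auto

lemma pow_mat_vec_funpow:
  fixes A :: "'a :: comm_semiring_1 mat"
  assumes "A \<in> carrier_mat n n" "x \<in> carrier_vec n"
  shows "A ^\<^sub>m k *\<^sub>v x = ((\<lambda>x. A *\<^sub>v x) ^^ k) x"
  using assms(2)
proof (induction k arbitrary: x)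
  case 0
  then show ?case using carrier_matD(1)[OF assms(1)] by simp
next
  case (Suc k)
  have Ax: "A *\<^sub>v x \<in> carrier_vec n" using assms(1) Suc.prems by simp
  have "A ^\<^sub>m Suc k *\<^sub>v x = A ^\<^sub>m k *\<^sub>v (A *\<^sub>v x)"
    using assoc_mult_mat_vec[OF pow_carrier_mat[OF assms(1)] assms(1) Suc.prems] by simp
  also have "\<dots> = ((\<lambda>x. A *\<^sub>v x) ^^ Suc k) x" unfolding Suc.IH[OF Ax] by (simp only: funpow_Suc_right o_apply)
  finally show ?case .
qed

lemma char_matrix_smult:
  fixes A :: "'a :: field mat"
  assumes "A \<in> carrier_mat n n"
  shows "char_matrix (c \<cdot>\<^sub>m A) (c * l) = c \<cdot>\<^sub>m char_matrix A l"
  using assms by (intro eq_matI) (auto simp: char_matrix_def algebra_simps)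

lemma smult_pow_mat:
  fixes A :: "'a :: field mat"
  assumes "A \<in> carrier_mat n n"
  shows "(c \<cdot>\<^sub>m A) ^\<^sub>m k = c ^ k \<cdot>\<^sub>m A ^\<^sub>m k"
proof (induction k)
  case 0
  then show ?case using assms by (intro eq_matI) auto
next
  case (Suc k)
  have "(c \<cdot>\<^sub>m A) ^\<^sub>m Suc k = (c ^ k \<cdot>\<^sub>m A ^\<^sub>m k) * (c \<cdot>\<^sub>m A)" using Suc.IH by simp
  also have "\<dots> = c ^ k \<cdot>\<^sub>m (c \<cdot>\<^sub>m (A ^\<^sub>m k * A))"
    using mult_smult_assoc_mat[OF pow_carrier_mat[OF assms] smult_carrier_mat[OF assms]]
      mult_smult_distrib[OF pow_carrier_mat[OF assms] assms] by simp
  finally show ?case by (simp add: smult_smult_mat mult.commute)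
qed

lemma almost_scalar_smult:
  assumes "almost_scalar n A l"
  shows "almost_scalar n (c \<cdot>\<^sub>m A) (c * l)"
proof -
  obtain k where A: "A \<in> carrier_mat n n" and k: "char_matrix A l ^\<^sub>m k = 0\<^sub>m n n"
    using assms by (auto simp: almost_scalar_def)
  have "char_matrix (c \<cdot>\<^sub>m A) (c * l) ^\<^sub>m k = 0\<^sub>m n n"
    unfolding char_matrix_smult[OF A] smult_pow_mat[OF char_matrix_closed[OF A]] k by (intro eq_matI) auto
  then show ?thesis using A unfolding almost_scalar_def by auto
qed

text \<open>With \<open>N = A - 1\<close> and \<open>N x\<close> nonzero, let
  \<open>z = N^i (N x)\<close> be the last nonzero iterate. Then \<open>y = N^i x\<close> satisfies
  \<open>N y = z\<close> and \<open>N z = 0\<close>, a Jordan block of size 2.\<close>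

lemma unipotent_jordan_pair:
  assumes A: "almost_scalar n A 1" and "A \<noteq> 1\<^sub>m n"
  obtains y z where "y \<in> carrier_vec n" "z \<in> carrier_vec n" "z \<noteq> 0\<^sub>v n"
    "A *\<^sub>v y = y + z" "A *\<^sub>v z = z"
proof -
  let ?N = "char_matrix A 1"
  obtain k where Ac: "A \<in> carrier_mat n n" and k: "?N ^\<^sub>m k = 0\<^sub>m n n"
    using A by (auto simp: almost_scalar_def)
  note N = char_matrix_closed[OF Ac, of 1]
  have Nx: "?N *\<^sub>v x = A *\<^sub>v x - x" if "x \<in> carrier_vec n" for x
    using char_matrix_mult_vec[OF Ac that, of 1] by simp
  have "\<exists>x\<in>carrier_vec n. ?N *\<^sub>v x \<noteq> 0\<^sub>v n"
  proof (rule ccontr)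
    assume "\<not> ?thesis"
    then have N0: "?N *\<^sub>v x = 0\<^sub>v n" if "x \<in> carrier_vec n" for x using that by blast
    have "A *\<^sub>v x = 1\<^sub>m n *\<^sub>v x" if "x \<in> carrier_vec n" for x
    proof -
      have "A *\<^sub>v x - x = 0\<^sub>v n" using N0[OF that] Nx[OF that] by simp
      then have "A *\<^sub>v x = x" using vec_diff_zero_iff[OF mult_mat_vec_carrier[OF Ac that] that] by blast
      then show ?thesis using that by simp
    qed
    then show False using eq_mat_by_vec[OF Ac one_carrier_mat] assms(2) by blast
  qed
  then obtain x where x: "x \<in> carrier_vec n" "?N *\<^sub>v x \<noteq> 0\<^sub>v n" by blast
  have Nxc: "?N *\<^sub>v x \<in> carrier_vec n" using N x by simp
  obtain i where i: "?N ^\<^sub>m i *\<^sub>v (?N *\<^sub>v x) \<noteq> 0\<^sub>v n" "?N *\<^sub>v (?N ^\<^sub>m i *\<^sub>v (?N *\<^sub>v x)) = 0\<^sub>v n"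
    using nilpotent_kernel_vec[OF N k Nxc x(2)] by blast
  define y z where "y = ?N ^\<^sub>m i *\<^sub>v x" and "z = ?N *\<^sub>v y"
  have y: "y \<in> carrier_vec n" unfolding y_def by (rule mult_mat_vec_carrier[OF pow_carrier_mat[OF N] x(1)])
  then have z: "z \<in> carrier_vec n" unfolding z_def using N by simp
  have zi: "z = ?N ^\<^sub>m i *\<^sub>v (?N *\<^sub>v x)"
    unfolding z_def y_def by (rule pow_mat_vec_commute[OF N x(1), symmetric])
  have "A *\<^sub>v z = z"
    using i(2) Nx[OF z] vec_diff_zero_iff[OF mult_mat_vec_carrier[OF Ac z] z] unfolding zi[symmetric] by simp
  moreover have "A *\<^sub>v y = y + z"
    unfolding z_def Nx[OF y] using carrier_vecD[OF y] carrier_vecD[OF mult_mat_vec_carrier[OF Ac y]]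
    by (intro eq_vecI) (simp_all del: index_mult_mat_vec dim_mult_mat_vec)
  moreover have "z \<noteq> 0\<^sub>v n" using i(1) zi by simp
  ultimately show ?thesis using that y z by blast
qed

text \<open>On a Jordan pair \<open>A^k y = y + k z\<close>, so \<open>A^d = 1\<close> forces
  \<open>d z = 0\<close>.\<close>

lemma unipotent_finite_order:
  fixes A :: "'a :: field mat"
  assumes A: "almost_scalar n A 1" "A \<noteq> 1\<^sub>m n" and d: "A ^\<^sub>m d = 1\<^sub>m n"
  shows "(of_nat d :: 'a) = 0"
proof -
  obtain y z where yz: "y \<in> carrier_vec n" "z \<in> carrier_vec n" "z \<noteq> 0\<^sub>v n"
    "A *\<^sub>v y = y + z" "A *\<^sub>v z = z" using unipotent_jordan_pair[OF A] by blast
  have Ac: "A \<in> carrier_mat n n" using A by (simp add: almost_scalar_def)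
  have "((\<lambda>x. A *\<^sub>v x) ^^ k) y = y + of_nat k \<cdot>\<^sub>v z" for k
  proof (induction k)
    case 0
    then show ?case using yz by (intro eq_vecI) auto
  next
    case (Suc k)
    have "((\<lambda>x. A *\<^sub>v x) ^^ Suc k) y = A *\<^sub>v y + A *\<^sub>v (of_nat k \<cdot>\<^sub>v z)"
      using Suc.IH mult_add_distrib_mat_vec[OF Ac yz(1), of "of_nat k \<cdot>\<^sub>v z"] yz(2) by simp
    also have "\<dots> = (y + z) + of_nat k \<cdot>\<^sub>v z" using mult_mat_vec[OF Ac yz(2)] yz by simp
    also have "\<dots> = y + of_nat (Suc k) \<cdot>\<^sub>v z" using yz(1,2) by (intro eq_vecI) (auto simp: algebra_simps)
    finally show ?case .
  qed
  then have eq: "y = y + of_nat d \<cdot>\<^sub>v z" using pow_mat_vec_funpow[OF Ac yz(1), of d] d yz(1) by simp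
  obtain i where i: "i < n" "z $ i \<noteq> 0" using yz(2,3) by (metis eq_vecI carrier_vecD index_zero_vec(1) index_zero_vec(2))
  have "y $ i = y $ i + of_nat d * z $ i" using arg_cong[OF eq, of "\<lambda>v. vec_index v i"] yz(1,2) i by simp
  then show ?thesis using i(2) by simp
qed

text \<open>These assumptions are inconsistent, which is what \<open>contradiction\<close>
  establishes; the lemmas before it are consequences on the way.\<close>

locale almost_scalar_irreducible = irreducible_semigroup n S B0
  for n and S :: "'a :: alg_closed_field mat set" and B0 +
  assumes almost_scalar: "A \<in> S \<Longrightarrow> \<exists>l. almost_scalar n A l"
begin

text \<open>On \<open>l + N\<close> this is \<open>l\<close>, once \<open>n\<close> is known to be
  nonzero in the field. Defining it through the trace makes it linear.\<close>

definition L :: "'a mat \<Rightarrow> 'a" where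
  "L A = mat_trace A / of_nat n"

definition normalize_mat :: "'a mat \<Rightarrow> 'a mat" where
  "normalize_mat A = (1 / L A) \<cdot>\<^sub>m A"

definition U :: "'a mat set" where
  "U = normalize_mat ` (S - {0\<^sub>m n n})"

text \<open>If \<open>n\<close> vanished in the field, all products \<open>B0 * Z\<close> would have
  trace \<open>n l = 0\<close>, and the trace test would give \<open>B0 = 0\<close>.\<close>

lemma of_nat_n: "(of_nat n :: 'a) \<noteq> 0"
proof
  assume n: "(of_nat n :: 'a) = 0"
  have "mat_trace (B0 * Z) = 0" if "Z \<in> S" for Z
    using almost_scalar[OF S_mult[OF B0 that]] almost_scalar_trace n by fastforce
  then show False using finite_trace_test S_mat[OF B0] B0_nonzero by blast
qed

lemma n_pos: "0 < n"
  using of_nat_n by (cases n) auto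

lemma L_eqI: "almost_scalar n A l \<Longrightarrow> L A = l"
  using almost_scalar_trace[of n A l] of_nat_n by (simp add: L_def)

lemma S_almost_scalar: "A \<in> S \<Longrightarrow> almost_scalar n A (L A)"
  using almost_scalar L_eqI by blast

lemma L_smult: "A \<in> carrier_mat n n \<Longrightarrow> L (c \<cdot>\<^sub>m A) = c * L A"
  by (simp add: L_def mat_trace_smult)

lemma L_zero: "L (0\<^sub>m n n) = 0"
  by (simp add: L_def mat_trace_def)

lemma L_one: "L (1\<^sub>m n) = 1"
  using of_nat_n by (simp add: L_def mat_trace_def)

text \<open>Compare determinants: that of \<open>l + N\<close> is \<open>l ^ n\<close>.\<close>

lemma L_mult_pow:
  assumes "A \<in> S" "B \<in> S"
  shows "L (A * B) ^ n = L A ^ n * L B ^ n"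
  using almost_scalar_det[OF S_almost_scalar[OF S_mult[OF assms]]] det_mult[OF S_mat[OF assms(1)] S_mat[OF assms(2)]]
    almost_scalar_det[OF S_almost_scalar[OF assms(1)]] almost_scalar_det[OF S_almost_scalar[OF assms(2)]] by simp

text \<open>If \<open>L A = 0\<close>, then \<open>L_mult_pow\<close> makes \<open>L (A * Z)\<close>
  and with it the trace of \<open>A * Z\<close> vanish for every \<open>Z\<close>, and the trace
  test gives \<open>A = 0\<close>.\<close>

lemma L_nonzero:
  assumes "A \<in> S" "A \<noteq> 0\<^sub>m n n"
  shows "L A \<noteq> 0"
proof
  assume z: "L A = 0"
  have "mat_trace (A * Z) = 0" if "Z \<in> S" for Z
  proof -
    have "L (A * Z) ^ n = 0" using L_mult_pow[OF assms(1) that] z n_pos by simp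
    then show ?thesis using of_nat_n by (simp add: L_def)
  qed
  then show False using finite_trace_test S_mat[OF assms(1)] assms(2) by blast
qed

lemma mult_nonzero:
  assumes "A \<in> S" "A \<noteq> 0\<^sub>m n n" "B \<in> S" "B \<noteq> 0\<^sub>m n n"
  shows "A * B \<noteq> 0\<^sub>m n n"
proof
  assume "A * B = 0\<^sub>m n n"
  then have "L A ^ n * L B ^ n = 0" using L_mult_pow[OF assms(1,3)] L_zero zero_power[OF n_pos] by metis
  then show False using L_nonzero assms by simp
qed

lemma normalize_smult:
  assumes "A \<in> carrier_mat n n" "c \<noteq> 0"
  shows "normalize_mat (c \<cdot>\<^sub>m A) = normalize_mat A"
  using assms by (simp add: normalize_mat_def L_smult smult_smult_mat)

lemma U_E:
  assumes "A \<in> U"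
  obtains A0 c where "A0 \<in> S" "A0 \<noteq> 0\<^sub>m n n" "c \<noteq> 0" "A = c \<cdot>\<^sub>m A0" "A0 \<in> carrier_mat n n"
proof -
  obtain A0 where A0: "A0 \<in> S" "A0 \<noteq> 0\<^sub>m n n" "A = normalize_mat A0" using assms by (auto simp: U_def)
  show ?thesis by (rule that[OF A0(1,2) _ _ S_mat[OF A0(1)], of "1 / L A0"])
    (use A0 L_nonzero in \<open>auto simp: normalize_mat_def\<close>)
qed

lemma U_carrier: "A \<in> U \<Longrightarrow> A \<in> carrier_mat n n"
  by (elim U_E) auto

lemma U_unipotent:
  assumes "A \<in> U"
  shows "almost_scalar n A 1"
proof -
  obtain A0 where A0: "A0 \<in> S" "A0 \<noteq> 0\<^sub>m n n" "A = normalize_mat A0" using assms by (auto simp: U_def)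
  show ?thesis using almost_scalar_smult[OF S_almost_scalar[OF A0(1)], of "1 / L A0"] L_nonzero[OF A0(1,2)] A0(3)
    by (simp add: normalize_mat_def)
qed

lemma U_L: "A \<in> U \<Longrightarrow> L A = 1"
  using U_unipotent L_eqI by blast

lemma U_normalize: "A \<in> U \<Longrightarrow> normalize_mat A = A"
  using U_L by (auto simp: normalize_mat_def intro!: eq_matI)

lemma U_mult:
  assumes "A \<in> U" "B \<in> U"
  shows "normalize_mat (A * B) \<in> U" "L (A * B) \<noteq> 0"
proof -
  obtain A0 a where A: "A0 \<in> S" "A0 \<noteq> 0\<^sub>m n n" "a \<noteq> 0" "A = a \<cdot>\<^sub>m A0" "A0 \<in> carrier_mat n n" using U_E[OF assms(1)] .
  obtain B1 b where B: "B1 \<in> S" "B1 \<noteq> 0\<^sub>m n n" "b \<noteq> 0" "B = b \<cdot>\<^sub>m B1" "B1 \<in> carrier_mat n n" using U_E[OF assms(2)] .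
  have "A * B = a \<cdot>\<^sub>m (A0 * (b \<cdot>\<^sub>m B1))"
    unfolding A(4) B(4) by (rule mult_smult_assoc_mat[OF A(5) smult_carrier_mat[OF B(5)]])
  then have AB: "A * B = (a * b) \<cdot>\<^sub>m (A0 * B1)"
    unfolding mult_smult_distrib[OF A(5) B(5)] smult_smult_mat .
  have c: "A0 * B1 \<in> carrier_mat n n" using A B by simp
  have nz: "A0 * B1 \<noteq> 0\<^sub>m n n" by (rule mult_nonzero[OF A(1,2) B(1,2)])
  show "normalize_mat (A * B) \<in> U"
    unfolding AB normalize_smult[OF c no_zero_divisors[OF A(3) B(3)]] U_def
    using S_mult[OF A(1) B(1)] nz by blast
  show "L (A * B) \<noteq> 0"
    unfolding AB L_smult[OF c] using A(3) B(3) L_nonzero[OF S_mult[OF A(1) B(1)] nz] by simp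
qed

lemma normalize_mult_left:
  assumes "L A \<noteq> 0" "A \<in> carrier_mat n n" "B \<in> carrier_mat n n"
  shows "normalize_mat (normalize_mat A * B) = normalize_mat (A * B)"
  using normalize_smult[of "A * B" "1 / L A"] mult_smult_assoc_mat[OF assms(2,3)] assms by (simp add: normalize_mat_def)

lemma normalize_mult_right:
  assumes "L B \<noteq> 0" "A \<in> carrier_mat n n" "B \<in> carrier_mat n n"
  shows "normalize_mat (A * normalize_mat B) = normalize_mat (A * B)"
  using normalize_smult[of "A * B" "1 / L B"] mult_smult_distrib[OF assms(2,3)] assms by (simp add: normalize_mat_def)

text \<open>A member \<open>A\<close> of \<open>U\<close> is determined by the values
  \<open>L (A * Z)\<close> for \<open>Z\<close> in the finite test set \<open>H\<close>. Each value
  is \<open>L Z\<close> times an \<open>n\<close>-th root of unity, so only finitely many families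
  of values occur.\<close>

lemma finite_U: "finite U"
proof -
  obtain H where H: "H \<subseteq> S" "finite H"
    "\<And>M. M \<in> carrier_mat n n \<Longrightarrow> \<forall>Z\<in>H. mat_trace (M * Z) = 0 \<Longrightarrow> M = 0\<^sub>m n n"
    using finite_trace_test by blast
  define R where "R = {r :: 'a. r ^ n = 1}"
  have "poly (Polynomial.monom 1 n - 1 :: 'a poly) r = r ^ n - 1" for r by (simp add: Polynomial.poly_monom)
  then have "R = {r. poly (Polynomial.monom 1 n - 1) r = 0}" unfolding R_def by auto
  moreover have "Polynomial.monom 1 n - 1 \<noteq> (0 :: 'a poly)"
  proof
    assume "Polynomial.monom 1 n - 1 = (0 :: 'a poly)"
    then have "poly.coeff (Polynomial.monom 1 n - 1 :: 'a poly) n = 0" by simp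
    then show False using n_pos by simp
  qed
  ultimately have R: "finite R" using poly_roots_finite by metis
  let ?\<phi> = "\<lambda>A. restrict (\<lambda>Z. L (A * Z)) H"
  have "?\<phi> ` U \<subseteq> PiE H (\<lambda>Z. (\<lambda>r. r * L Z) ` R)"
  proof
    fix g assume "g \<in> ?\<phi> ` U"
    then obtain A where A: "A \<in> U" "g = ?\<phi> A" by blast
    obtain A0 where A0: "A0 \<in> S" "A0 \<noteq> 0\<^sub>m n n" "A = normalize_mat A0" using A(1) by (auto simp: U_def)
    have "L (A * Z) \<in> (\<lambda>r. r * L Z) ` R" if Z: "Z \<in> H" for Z
    proof -
      have ZS: "Z \<in> S" using Z H by blast
      have eq: "L (A * Z) = L (A0 * Z) / L A0"
        unfolding A0(3) normalize_mat_def mult_smult_assoc_mat[OF S_mat[OF A0(1)] S_mat[OF ZS]]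
        using L_smult S_mat[OF S_mult[OF A0(1) ZS]] by simp
      show ?thesis
      proof (cases "Z = 0\<^sub>m n n")
        case True
        then have "L (A * Z) = 1 * L Z" unfolding eq using S_mat[OF A0(1)] L_zero by simp
        then show ?thesis unfolding R_def by (intro image_eqI[of _ _ 1]) auto
      next
        case False
        have "(L (A * Z) / L Z) ^ n = 1"
          unfolding eq power_divide L_mult_pow[OF A0(1) ZS] using L_nonzero[OF A0(1,2)] L_nonzero[OF ZS False] by simp
        then show ?thesis unfolding R_def using L_nonzero[OF ZS False]
          by (intro image_eqI[of _ _ "L (A * Z) / L Z"]) auto
      qed
    qed
    then show "g \<in> PiE H (\<lambda>Z. (\<lambda>r. r * L Z) ` R)" using A(2) by auto
  qed
  then have "finite (?\<phi> ` U)" using R H(2) by (meson finite_PiE finite_imageI finite_subset)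
  moreover have "inj_on ?\<phi> U"
  proof (rule inj_onI)
    fix A B assume AB: "A \<in> U" "B \<in> U" "?\<phi> A = ?\<phi> B"
    note c = U_carrier[OF AB(1)] U_carrier[OF AB(2)]
    have "A + (-1) \<cdot>\<^sub>m B = 0\<^sub>m n n"
    proof (rule H(3), simp_all add: c, intro ballI)
      fix Z assume Z: "Z \<in> H"
      then have Zc: "Z \<in> carrier_mat n n" using H S_mat by blast
      have "L (A * Z) = L (B * Z)" using AB(3) Z by (metis restrict_apply')
      then have "mat_trace (A * Z) = mat_trace (B * Z)" using of_nat_n by (simp add: L_def)
      moreover have "(A + (-1) \<cdot>\<^sub>m B) * Z = A * Z + (-1) \<cdot>\<^sub>m (B * Z)"
        using add_mult_distrib_mat[OF c(1) smult_carrier_mat[OF c(2)] Zc] mult_smult_assoc_mat[OF c(2) Zc] by simp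
      ultimately show "mat_trace ((A + (-1) \<cdot>\<^sub>m B) * Z) = 0"
        using mat_trace_add[of "A * Z" n "(-1) \<cdot>\<^sub>m (B * Z)"] mat_trace_smult[of "B * Z" n "-1"] c Zc by simp
    qed
    then have "(A + (-1) \<cdot>\<^sub>m B) $$ (i,j) = 0" if "i < n" "j < n" for i j using that by simp
    then show "A = B" using c by (intro eq_matI) auto
  qed
  ultimately show ?thesis using finite_imageD by blast
qed

text \<open>Exponents start at 1, since the identity is not yet known to lie in \<open>U\<close>; it
  is obtained later as such a power.\<close>

lemma U_pow:
  assumes "A \<in> U"
  shows "normalize_mat (A ^\<^sub>m Suc k) \<in> U \<and> L (A ^\<^sub>m Suc k) \<noteq> 0"
proof (induction k)
  case 0
  then show ?case using assms U_normalize U_L U_carrier by simp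
next
  case (Suc k)
  note c = U_carrier[OF assms]
  let ?P = "A ^\<^sub>m Suc k"
  have P: "?P \<in> carrier_mat n n" by (rule pow_carrier_mat[OF c])
  have eq: "normalize_mat (normalize_mat ?P * A) = normalize_mat (?P * A)"
    using normalize_mult_left[OF _ P c] Suc.IH by blast
  have "normalize_mat (normalize_mat ?P * A) \<in> U" using U_mult Suc.IH assms by blast
  moreover have "L (normalize_mat ?P * A) \<noteq> 0" using U_mult Suc.IH assms by blast
  then have "L (?P * A) \<noteq> 0"
    unfolding normalize_mat_def mult_smult_assoc_mat[OF P c] using L_smult[OF mult_carrier_mat[OF P c]] by auto
  ultimately show ?case using eq by simp
qed

text \<open>A nonzero vector fixed by the unipotent \<open>A\<close> is fixed by all powers of
  \<open>A\<close>.\<close>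

lemma scalar_pow_eq_one:
  assumes A: "A \<in> U" and d: "A ^\<^sub>m d = c \<cdot>\<^sub>m 1\<^sub>m n"
  shows "c = 1"
proof -
  note Ac = U_carrier[OF A]
  obtain v where v: "v \<in> carrier_vec n" "v \<noteq> 0\<^sub>v n" "A *\<^sub>v v = v"
    using almost_scalar_eigenvector[OF U_unipotent[OF A] n_pos] by auto
  have "((\<lambda>x. A *\<^sub>v x) ^^ k) v = v" for k by (induction k) (use v in auto)
  then have "A ^\<^sub>m d *\<^sub>v v = v" using pow_mat_vec_funpow[OF Ac v(1)] by simp
  moreover have "(c \<cdot>\<^sub>m 1\<^sub>m n) *\<^sub>v v = c \<cdot>\<^sub>v v" using v by (intro eq_vecI) auto
  ultimately have eq: "c \<cdot>\<^sub>v v = v" using d by simp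
  obtain i where i: "i < n" "v $ i \<noteq> 0" using v(1,2) by (metis eq_vecI carrier_vecD index_zero_vec(1) index_zero_vec(2))
  have "c * v $ i = v $ i" using arg_cong[OF eq, of "\<lambda>v. vec_index v i"] v(1) i by simp
  then show ?thesis using i by simp
qed

text \<open>By pigeonhole two normalized powers agree, so two powers of \<open>A\<close> are
  proportional; cancelling the injective smaller one leaves a scalar power, whose scalar is 1. An
  exponent of at least 2 lets one factor be split off with a positive power remaining, which after
  normalization is an inverse inside \<open>U\<close>.\<close>

lemma U_finite_order:
  assumes A: "A \<in> U"
  shows "\<exists>k. A ^\<^sub>m Suc (Suc k) = 1\<^sub>m n"
proof -
  note Ac = U_carrier[OF A]
  let ?f = "\<lambda>x. A *\<^sub>v x"
  have fc: "(?f ^^ k) x \<in> carrier_vec n" if "x \<in> carrier_vec n" for k x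
    using that Ac by (induction k) auto
  have inj: "x = 0\<^sub>v n" if "x \<in> carrier_vec n" "A *\<^sub>v x = 0\<^sub>v n" for x
  proof (rule ccontr)
    assume "x \<noteq> 0\<^sub>v n"
    moreover have "A *\<^sub>v x = 0 \<cdot>\<^sub>v x" using that by auto
    ultimately have "0 = (1::'a)" using almost_scalar_eigenvalue[OF U_unipotent[OF A] that(1)] by blast
    then show False by simp
  qed
  have injk: "x = y" if "x \<in> carrier_vec n" "y \<in> carrier_vec n" "(?f ^^ k) x = (?f ^^ k) y" for x y k
    using that(3)
  proof (induction k)
    case (Suc k)
    let ?x = "(?f ^^ k) x" and ?y = "(?f ^^ k) y"
    have "A *\<^sub>v (?x - ?y) = A *\<^sub>v ?x - A *\<^sub>v ?y"
      using mult_minus_distrib_mat_vec[OF Ac] fc that by blast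
    also have "\<dots> = 0\<^sub>v n" using Suc.prems Ac fc[OF that(2)] by simp
    finally have "?x - ?y = 0\<^sub>v n" using inj[of "?x - ?y"] fc that by simp
    then have "?x = ?y" using vec_diff_zero_iff fc that by blast
    then show ?case by (rule Suc.IH)
  qed simp
  have "\<not> inj (\<lambda>k. normalize_mat (A ^\<^sub>m Suc k))"
  proof
    assume "inj (\<lambda>k. normalize_mat (A ^\<^sub>m Suc k))"
    then have "infinite (range (\<lambda>k. normalize_mat (A ^\<^sub>m Suc k)))" by (rule range_inj_infinite)
    moreover have "range (\<lambda>k. normalize_mat (A ^\<^sub>m Suc k)) \<subseteq> U" using U_pow[OF A] by blast
    ultimately show False using finite_U finite_subset by blast
  qed
  then obtain i j where "i \<noteq> j" "normalize_mat (A ^\<^sub>m Suc i) = normalize_mat (A ^\<^sub>m Suc j)"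
    unfolding inj_def by blast
  then obtain i j where ij: "i < j" "normalize_mat (A ^\<^sub>m Suc i) = normalize_mat (A ^\<^sub>m Suc j)"
    by (metis linorder_neqE_nat)
  define c where "c = L (A ^\<^sub>m Suc j) * (1 / L (A ^\<^sub>m Suc i))"
  have "A ^\<^sub>m Suc j = L (A ^\<^sub>m Suc j) \<cdot>\<^sub>m normalize_mat (A ^\<^sub>m Suc j)"
    using U_pow[OF A, of j] unfolding normalize_mat_def smult_smult_mat by (intro eq_matI) auto
  then have Aj: "A ^\<^sub>m Suc j = c \<cdot>\<^sub>m A ^\<^sub>m Suc i"
    unfolding ij(2)[symmetric] unfolding normalize_mat_def smult_smult_mat c_def .
  define d where "d = j - i"
  have d: "0 < d" "Suc j = Suc i + d" using ij(1) by (auto simp: d_def)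
  have "A ^\<^sub>m d = c \<cdot>\<^sub>m 1\<^sub>m n"
  proof (rule eq_mat_by_vec[of _ n n])
    fix x :: "'a vec" assume x: "x \<in> carrier_vec n"
    have cx: "c \<cdot>\<^sub>v x \<in> carrier_vec n" using x by simp
    have "(?f ^^ Suc i) ((?f ^^ d) x) = (?f ^^ Suc j) x" unfolding d(2) funpow_add by simp
    also have "\<dots> = A ^\<^sub>m Suc j *\<^sub>v x" by (rule pow_mat_vec_funpow[OF Ac x, symmetric])
    also have "\<dots> = c \<cdot>\<^sub>v (A ^\<^sub>m Suc i *\<^sub>v x)"
      unfolding Aj using pow_carrier_mat[OF Ac, of "Suc i"] x by (intro eq_vecI) auto
    also have "\<dots> = A ^\<^sub>m Suc i *\<^sub>v (c \<cdot>\<^sub>v x)" by (rule mult_mat_vec[OF pow_carrier_mat[OF Ac] x, symmetric])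
    also have "\<dots> = (?f ^^ Suc i) (c \<cdot>\<^sub>v x)" by (rule pow_mat_vec_funpow[OF Ac cx])
    finally have "(?f ^^ d) x = c \<cdot>\<^sub>v x" by (rule injk[OF fc[OF x] cx])
    moreover have "(c \<cdot>\<^sub>m 1\<^sub>m n) *\<^sub>v x = c \<cdot>\<^sub>v x" using x by (intro eq_vecI) auto
    ultimately show "A ^\<^sub>m d *\<^sub>v x = (c \<cdot>\<^sub>m 1\<^sub>m n) *\<^sub>v x" using pow_mat_vec_funpow[OF Ac x] by simp
  qed (use Ac in auto)
  then have "A ^\<^sub>m d = 1\<^sub>m n" using scalar_pow_eq_one[OF A, of d c] one_smult_mat[of "1\<^sub>m n"] by simp
  then have fd: "(?f ^^ d) x = x" if "x \<in> carrier_vec n" for x using pow_mat_vec_funpow[OF Ac that, of d] that by simp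
  \<comment> \<open>Doubling the exponent \<open>d > 0\<close> gives at least 2 even when
    \<open>d = 1\<close>.\<close>
  have k: "Suc (Suc (d + d - 2)) = d + d" using d(1) by simp
  have "A ^\<^sub>m Suc (Suc (d + d - 2)) = 1\<^sub>m n"
  proof (rule eq_mat_by_vec[OF pow_carrier_mat[OF Ac] one_carrier_mat])
    fix x :: "'a vec" assume x: "x \<in> carrier_vec n"
    show "A ^\<^sub>m Suc (Suc (d + d - 2)) *\<^sub>v x = 1\<^sub>m n *\<^sub>v x"
      unfolding pow_mat_vec_funpow[OF Ac x] k funpow_add o_apply fd[OF x] using x by simp
  qed
  then show ?thesis by blast
qed

text \<open>The image of the nonzero part of \<open>S\<close> modulo scalars, each class being
  represented by its unipotent member.\<close>

definition GU :: "'a mat monoid" where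
  "GU = \<lparr>carrier = U, monoid.mult = (\<lambda>A B. normalize_mat (A * B)), one = 1\<^sub>m n\<rparr>"

lemma normalize_one: "normalize_mat (1\<^sub>m n) = 1\<^sub>m n"
  unfolding normalize_mat_def L_one by (intro eq_matI) auto

text \<open>\<open>S\<close> need not contain the identity, but a power of the normalized
  \<open>B0\<close> is the identity.\<close>

lemma one_U: "1\<^sub>m n \<in> U"
proof -
  have A: "normalize_mat B0 \<in> U" unfolding U_def using B0 B0_nonzero by blast
  obtain k where k: "normalize_mat B0 ^\<^sub>m Suc (Suc k) = 1\<^sub>m n" using U_finite_order[OF A] by blast
  show ?thesis using U_pow[OF A, of "Suc k"] unfolding k normalize_one by blast
qed

lemma group_GU: "group GU"
proof (rule groupI)
  fix A B C assume "A \<in> carrier GU" "B \<in> carrier GU" "C \<in> carrier GU"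
  then have ABC: "A \<in> U" "B \<in> U" "C \<in> U" by (auto simp: GU_def)
  note c = U_carrier[OF ABC(1)] U_carrier[OF ABC(2)] U_carrier[OF ABC(3)]
  have "normalize_mat (normalize_mat (A * B) * C) = normalize_mat (A * normalize_mat (B * C))"
    unfolding normalize_mult_left[OF U_mult(2)[OF ABC(1,2)] mult_carrier_mat[OF c(1,2)] c(3)]
      normalize_mult_right[OF U_mult(2)[OF ABC(2,3)] c(1) mult_carrier_mat[OF c(2,3)]]
      assoc_mult_mat[OF c] ..
  then show "A \<otimes>\<^bsub>GU\<^esub> B \<otimes>\<^bsub>GU\<^esub> C = A \<otimes>\<^bsub>GU\<^esub> (B \<otimes>\<^bsub>GU\<^esub> C)" by (simp add: GU_def)
next
  fix A assume "A \<in> carrier GU"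
  then have A: "A \<in> U" by (simp add: GU_def)
  note Ac = U_carrier[OF A]
  obtain k where k: "A ^\<^sub>m Suc (Suc k) = 1\<^sub>m n" using U_finite_order[OF A] by blast
  have "normalize_mat (normalize_mat (A ^\<^sub>m Suc k) * A) = 1\<^sub>m n"
    using normalize_mult_left[OF conjunct2[OF U_pow[OF A, of k]] pow_carrier_mat[OF Ac] Ac] k normalize_one
    by (metis pow_mat.simps(2))
  then show "\<exists>B\<in>carrier GU. B \<otimes>\<^bsub>GU\<^esub> A = \<one>\<^bsub>GU\<^esub>" using U_pow[OF A, of k] by (auto simp: GU_def)
qed (use one_U U_mult(1) U_normalize left_mult_one_mat[OF U_carrier] in \<open>auto simp: GU_def\<close>)

lemma GU_pow:
  assumes A: "A \<in> U"
  shows "A [^]\<^bsub>GU\<^esub> k = normalize_mat (A ^\<^sub>m k)"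
proof (induction k)
  case 0
  have "dim_row A = n" using U_carrier[OF A] by simp
  then show ?case using normalize_one by (simp add: GU_def nat_pow_def)
next
  case (Suc k)
  note Ac = U_carrier[OF A]
  interpret group GU by (rule group_GU)
  have "dim_row A = n" using Ac by simp
  then have "L (A ^\<^sub>m k) \<noteq> 0" using U_pow[OF A] L_one by (cases k) auto
  have "A [^]\<^bsub>GU\<^esub> Suc k = normalize_mat ((A [^]\<^bsub>GU\<^esub> k) * A)" by (simp add: GU_def nat_pow_def)
  then show ?case
    using normalize_mult_left[OF \<open>L (A ^\<^sub>m k) \<noteq> 0\<close> pow_carrier_mat[OF Ac] Ac] Suc.IH by simp
qed

lemma contradiction: False
proof -
  interpret group GU by (rule group_GU)
  have "\<exists>p a. Factorial_Ring.prime p \<and> 0 < a \<and> Coset.order GU = p ^ a"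
  proof (rule prime_power_orderI[where 'a = 'a])
    show "finite (carrier GU)" using finite_U by (simp add: GU_def)
    \<comment> \<open>If all unipotent parts were trivial, \<open>B0\<close> would be
      scalar.\<close>
    show "carrier GU \<noteq> {\<one>\<^bsub>GU\<^esub>}"
    proof
      assume "carrier GU = {\<one>\<^bsub>GU\<^esub>}"
      then have "normalize_mat B0 = 1\<^sub>m n" using B0 B0_nonzero by (auto simp: GU_def U_def)
      then have "L B0 \<cdot>\<^sub>m normalize_mat B0 = L B0 \<cdot>\<^sub>m 1\<^sub>m n" by simp
      moreover have "L B0 \<cdot>\<^sub>m normalize_mat B0 = B0"
        unfolding normalize_mat_def smult_smult_mat using L_nonzero[OF B0 B0_nonzero] by (intro eq_matI) auto
      ultimately show False using nonscalar by metis
    qed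
    fix A k assume "A \<in> carrier GU" "A \<noteq> \<one>\<^bsub>GU\<^esub>" "A [^]\<^bsub>GU\<^esub> (k::nat) = \<one>\<^bsub>GU\<^esub>"
    then have A: "A \<in> U" "A \<noteq> 1\<^sub>m n" "normalize_mat (A ^\<^sub>m k) = 1\<^sub>m n"
      using GU_pow by (auto simp: GU_def)
    have "dim_row A = n" using U_carrier[OF A(1)] by simp
    then have nz: "L (A ^\<^sub>m k) \<noteq> 0" using U_pow[OF A(1)] L_one by (cases k) auto
    have "L (A ^\<^sub>m k) \<cdot>\<^sub>m normalize_mat (A ^\<^sub>m k) = A ^\<^sub>m k"
      unfolding normalize_mat_def smult_smult_mat using nz by (intro eq_matI) auto
    \<comment> \<open>A power equal to 1 in \<open>GU\<close> only says that the matrix power is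
      scalar; a fixed vector shows that the scalar is 1.\<close>
    then have "A ^\<^sub>m k = L (A ^\<^sub>m k) \<cdot>\<^sub>m 1\<^sub>m n" using A(3) by simp
    then have "A ^\<^sub>m k = 1\<^sub>m n"
      using scalar_pow_eq_one[OF A(1), of k "L (A ^\<^sub>m k)"] one_smult_mat[of "1\<^sub>m n"] by simp
    then show "(of_nat k :: 'a) = 0" by (rule unipotent_finite_order[OF U_unipotent[OF A(1)] A(2)])
  qed (rule group_GU)
  then obtain z where "z \<in> carrier GU" "z \<noteq> \<one>\<^bsub>GU\<^esub>" "\<forall>g\<in>carrier GU. g \<otimes>\<^bsub>GU\<^esub> z = z \<otimes>\<^bsub>GU\<^esub> g"
    using finite_group_center_nontrivial[OF group_GU] by blast
  then have z: "z \<in> U" "z \<noteq> 1\<^sub>m n" and central: "\<And>g. g \<in> U \<Longrightarrow> normalize_mat (g * z) = normalize_mat (z * g)"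
    by (auto simp: GU_def)
  note zc = U_carrier[OF z(1)]
  \<comment> \<open>Central in \<open>GU\<close> means commuting up to a scalar. As
    \<open>g * z\<close> and \<open>z * g\<close> have the same trace, hence the same nonzero
    \<open>L\<close>, they are equal.\<close>
  have comm_U: "g * z = z * g" if g: "g \<in> U" for g
  proof -
    have L: "L (g * z) = L (z * g)" unfolding L_def using mat_trace_mult_comm[OF U_carrier[OF g] zc] by simp
    have "L (g * z) \<cdot>\<^sub>m normalize_mat (g * z) = g * z" "L (z * g) \<cdot>\<^sub>m normalize_mat (z * g) = z * g"
      unfolding normalize_mat_def smult_smult_mat using U_mult(2)[OF g z(1)] U_mult(2)[OF z(1) g]
      by (auto intro!: eq_matI)
    then show ?thesis using central[OF g] L by metis
  qed
  have comm: "A * z = z * A" if A: "A \<in> S" for A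
  proof (cases "A = 0\<^sub>m n n")
    case False
    have "normalize_mat A \<in> U" unfolding U_def using A False by blast
    then have "(1 / L A) \<cdot>\<^sub>m (A * z) = (1 / L A) \<cdot>\<^sub>m (z * A)"
      using comm_U[of "normalize_mat A"] mult_smult_assoc_mat[OF S_mat[OF A] zc] mult_smult_distrib[OF zc S_mat[OF A]]
      by (simp add: normalize_mat_def)
    then have "L A \<cdot>\<^sub>m ((1 / L A) \<cdot>\<^sub>m (A * z)) = L A \<cdot>\<^sub>m ((1 / L A) \<cdot>\<^sub>m (z * A))" by simp
    then show ?thesis unfolding smult_smult_mat using L_nonzero[OF A False] by (simp add: one_smult_mat)
  qed (use zc in simp)
  \<comment> \<open>The fixed space of \<open>z\<close> is invariant since \<open>z\<close> commutes
    with \<open>S\<close>, nonzero since \<open>z\<close> is unipotent, and proper since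
    \<open>z\<close> is not the identity.\<close>
  define K where "K = {x \<in> carrier_vec n. z *\<^sub>v x = x}"
  have "lin_sub n K" unfolding lin_sub_def K_def
    using mult_add_distrib_mat_vec[OF zc] mult_mat_vec[OF zc] zc by (auto intro!: eq_vecI)
  moreover have "A *\<^sub>v x \<in> K" if A: "A \<in> S" and x: "x \<in> K" for A x
  proof -
    have xc: "x \<in> carrier_vec n" "z *\<^sub>v x = x" using x by (auto simp: K_def)
    have "z *\<^sub>v (A *\<^sub>v x) = (A * z) *\<^sub>v x"
      unfolding comm[OF A] by (rule assoc_mult_mat_vec[OF zc S_mat[OF A] xc(1), symmetric])
    also have "\<dots> = A *\<^sub>v x" using assoc_mult_mat_vec[OF S_mat[OF A] zc xc(1)] xc(2) by simp
    finally show ?thesis using S_mat[OF A] xc unfolding K_def by simp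
  qed
  ultimately have "K = {0\<^sub>v n} \<or> K = carrier_vec n" by (rule irreducible)
  moreover obtain v where "v \<in> carrier_vec n" "v \<noteq> 0\<^sub>v n" "z *\<^sub>v v = v"
    using almost_scalar_eigenvector[OF U_unipotent[OF z(1)] n_pos] by auto
  then have "v \<in> K" "v \<noteq> 0\<^sub>v n" by (auto simp: K_def)
  ultimately have "K = carrier_vec n" by auto
  then have "z *\<^sub>v x = 1\<^sub>m n *\<^sub>v x" if "x \<in> carrier_vec n" for x
    using that unfolding K_def by auto
  then show False using eq_mat_by_vec[OF zc one_carrier_mat] z(2) by blast
qed

end

section \<open>Common eigenvectors and triangularizing chains\<close>

text \<open>On a minimal nonzero invariant subspace the semigroup acts irreducibly, so by
  \<open>contradiction\<close> each member acts there as a scalar, and any nonzero vector of that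
  subspace will do.\<close>

lemma common_eigenvector_alg_closed:
  fixes S :: "'a :: alg_closed_field mat set"
  assumes S: "matrix_semigroup n S" and as: "\<And>A. A \<in> S \<Longrightarrow> \<exists>l. almost_scalar n A l" and "0 < n"
  shows "\<exists>v\<in>carrier_vec n. v \<noteq> 0\<^sub>v n \<and> (\<forall>A\<in>S. \<exists>e. A *\<^sub>v v = e \<cdot>\<^sub>v v)"
proof -
  have Sc: "A \<in> carrier_mat n n" if "A \<in> S" for A using S that by (auto simp: matrix_semigroup_def)
  define \<F> where "\<F> = {E. lin_sub n E \<and> E \<noteq> {0\<^sub>v n} \<and> (\<forall>A\<in>S. \<forall>x\<in>E. A *\<^sub>v x \<in> E)}"
  have "unit_vec n 0 \<noteq> (0\<^sub>v n :: 'a vec)" using \<open>0 < n\<close> by simp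
  then have "carrier_vec n \<noteq> {0\<^sub>v n :: 'a vec}" using unit_vec_carrier by blast
  then have "carrier_vec n \<in> \<F>" unfolding \<F>_def using lin_sub_carrier mult_mat_vec_carrier[OF Sc] by auto
  then obtain E where Emin: "E \<in> \<F>" "\<And>U. U \<in> \<F> \<Longrightarrow> U \<subseteq> E \<Longrightarrow> U = E"
    by (rule lin_sub_minimal[of _ _ n]) (auto simp: \<F>_def)
  have E1: "lin_sub n E" "E \<noteq> {0\<^sub>v n}" "\<And>A x. A \<in> S \<Longrightarrow> x \<in> E \<Longrightarrow> A *\<^sub>v x \<in> E" using Emin(1) by (auto simp: \<F>_def)
  obtain m P where B: "basis_mat n m {0\<^sub>v n} E P" using basis_mat_exists[OF lin_sub_zero E1(1)] by blast
  interpret compression n m "{0\<^sub>v n}" E P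
    by unfold_locales (use B E1 lin_sub_zero lin_subD(2)[OF E1(1)] in auto)
  have A0: "A *\<^sub>v 0\<^sub>v n = 0\<^sub>v n" if "A \<in> S" for A using Sc[OF that] by (intro eq_vecI) auto
  have st: "stable A" if "A \<in> S" for A using Sc[OF that] A0[OF that] E1(3)[OF that] by (simp add: stable_def)
  have irred: "U = {0\<^sub>v m} \<or> U = carrier_vec m"
    if "lin_sub m U" "\<And>A x. A \<in> cmp ` S \<Longrightarrow> x \<in> U \<Longrightarrow> A *\<^sub>v x \<in> U" for U
  proof (rule cmp_irreducible[of S])
    fix E' assume "lin_sub n E'" "{0\<^sub>v n} \<subseteq> E'" "E' \<subseteq> E" "\<forall>A\<in>S. \<forall>x\<in>E'. A *\<^sub>v x \<in> E'"
    then show "E' = {0\<^sub>v n} \<or> E' = E" using Emin(2)[of E'] unfolding \<F>_def by blast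
  qed (use st that in auto)
  have cas: "\<exists>l. almost_scalar m Q l" if Q: "Q \<in> cmp ` S" for Q
  proof -
    obtain A where A: "A \<in> S" "Q = cmp A" using Q by blast
    obtain l k where k: "char_matrix A l ^\<^sub>m k = 0\<^sub>m n n" using as[OF A(1)] by (auto simp: almost_scalar_def)
    have "char_matrix A l ^\<^sub>m k *\<^sub>v x \<in> {0\<^sub>v n}" if "x \<in> E" for x
      unfolding k using zero_mat_mult_vec[OF lin_subD(1)[OF E1(1) that]] by simp
    then show ?thesis using cmp_almost_scalar[OF st[OF A(1)]] A(2) by blast
  qed
  have scalar: "\<exists>e. cmp A = e \<cdot>\<^sub>m 1\<^sub>m m" if A: "A \<in> S" for A
  proof (rule ccontr)
    assume no: "\<nexists>e. cmp A = e \<cdot>\<^sub>m 1\<^sub>m m"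
    interpret almost_scalar_irreducible m "cmp ` S" "cmp A"
      by unfold_locales (use cmp_semigroup[OF S st] irred A no cas in auto)
    show False by (rule contradiction)
  qed
  have "0 < m" using size_pos E1(2) by blast
  let ?c = "unit_vec m 0 :: 'a vec"
  have c: "?c \<in> carrier_vec m" "?c \<noteq> 0\<^sub>v m" using \<open>0 < m\<close> by auto
  have "\<exists>e. A *\<^sub>v (P *\<^sub>v ?c) = e \<cdot>\<^sub>v (P *\<^sub>v ?c)" if A: "A \<in> S" for A
  proof -
    obtain e where e: "cmp A = e \<cdot>\<^sub>m 1\<^sub>m m" using scalar[OF A] by blast
    have "cmp A *\<^sub>v ?c = e \<cdot>\<^sub>v ?c" unfolding e using c(1) by (intro eq_vecI) auto
    then have "A *\<^sub>v (P *\<^sub>v ?c) - e \<cdot>\<^sub>v (P *\<^sub>v ?c) = 0\<^sub>v n" using cmp_eigenvector[OF st[OF A] c(1)] by simp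
    then show ?thesis
      using vec_diff_zero_iff[OF mult_mat_vec_carrier[OF Sc[OF A] Pc[OF c(1)]] smult_carrier_vec[THEN iffD2, OF Pc[OF c(1)]]]
      by blast
  qed
  moreover have "P *\<^sub>v ?c \<noteq> 0\<^sub>v n" using basis_matD(3)[OF B c(1)] c(2) by auto
  ultimately show ?thesis using Pc[OF c(1)] by blast
qed

section \<open>Descent from the algebraic closure\<close>

lemma to_ac_functional:
  fixes x :: "'a :: field alg_closure"
  assumes "x \<noteq> 0"
  obtains \<phi> :: "'a alg_closure \<Rightarrow> 'a" where "\<And>a b. \<phi> (a + b) = \<phi> a + \<phi> b" "\<And>a b. \<phi> (to_ac a * b) = a * \<phi> b" "\<phi> x = 1"
proof -
  \<comment> \<open>The closure is viewed as a vector space over the base field; the nonzero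
    \<open>x\<close> is independent, so the value 1 at \<open>x\<close> extends linearly.\<close>
  interpret vector_space_pair "\<lambda>(a :: 'a) b. to_ac a * b" "(*) :: 'a \<Rightarrow> 'a \<Rightarrow> 'a"
    by unfold_locales (auto simp: algebra_simps)
  have "vs1.independent {x}" using assms vs1.dependent_single by blast
  then obtain \<phi> where \<phi>: "Vector_Spaces.linear (\<lambda>(a :: 'a) b. to_ac a * b) (*) \<phi>" "\<phi> x = 1"
    using linear_independent_extend[of "{x}" "\<lambda>_. 1"] by auto
  interpret \<phi>: Vector_Spaces.linear "\<lambda>(a :: 'a) b. to_ac a * b" "(*) :: 'a \<Rightarrow> 'a \<Rightarrow> 'a" \<phi> by (rule \<phi>(1))
  show ?thesis using that[of \<phi>] \<phi>.add \<phi>.scale \<phi>(2) by blast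
qed

text \<open>An eigenvalue over the closure must be the \<open>l\<close> of
  \<open>almost_scalar\<close>, an element of the base field. A functional that is linear over this
  field can therefore be applied to the coordinates of \<open>v\<close>; having value 1 at a nonzero
  coordinate, it gives a nonzero vector.\<close>

lemma common_eigenvector:
  fixes S :: "'a :: field mat set"
  assumes S: "matrix_semigroup n S" and as: "\<And>A. A \<in> S \<Longrightarrow> \<exists>l. almost_scalar n A l" and "0 < n"
  shows "\<exists>v\<in>carrier_vec n. v \<noteq> 0\<^sub>v n \<and> (\<forall>A\<in>S. \<exists>e. A *\<^sub>v v = e \<cdot>\<^sub>v v)"
proof -
  interpret ac: comm_ring_hom "to_ac :: 'a \<Rightarrow> 'a alg_closure" by unfold_locales auto
  let ?h = "map_mat (to_ac :: 'a \<Rightarrow> 'a alg_closure)"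
  have Sc: "A \<in> carrier_mat n n" if "A \<in> S" for A using S that by (auto simp: matrix_semigroup_def)
  have hom: "?h (A * B) = ?h A * ?h B" if "A \<in> S" "B \<in> S" for A B
    by (rule ac.mat_hom_mult[OF Sc[OF that(1)] Sc[OF that(2)]])
  have S': "matrix_semigroup n (?h ` S)"
    using S Sc unfolding matrix_semigroup_def by (auto simp flip: hom)
  have as': "almost_scalar n (?h A) (to_ac l)" if almost: "almost_scalar n A l" for A l
  proof -
    obtain k where A: "A \<in> carrier_mat n n" and k: "char_matrix A l ^\<^sub>m k = 0\<^sub>m n n"
      using almost by (auto simp: almost_scalar_def)
    have "char_matrix (?h A) (to_ac l) = ?h (char_matrix A l)"
      using A by (intro eq_matI) (auto simp: char_matrix_def)
    then have "char_matrix (?h A) (to_ac l) ^\<^sub>m k = ?h (char_matrix A l ^\<^sub>m k)"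
      using ac.mat_hom_pow[OF char_matrix_closed[OF A]] by simp
    also have "\<dots> = 0\<^sub>m n n" unfolding k by (intro eq_matI) auto
    finally show ?thesis using A unfolding almost_scalar_def by auto
  qed
  have "\<exists>v\<in>carrier_vec n. v \<noteq> 0\<^sub>v n \<and> (\<forall>A\<in>?h ` S. \<exists>e. A *\<^sub>v v = e \<cdot>\<^sub>v v)"
    by (rule common_eigenvector_alg_closed[OF S' _ \<open>0 < n\<close>]) (use as as' in blast)
  then obtain v where v: "v \<in> carrier_vec n" "v \<noteq> 0\<^sub>v n" "\<And>A. A \<in> S \<Longrightarrow> \<exists>e. ?h A *\<^sub>v v = e \<cdot>\<^sub>v v" by blast
  obtain i where i: "i < n" "vec_index v i \<noteq> 0" using v(1,2) by (metis eq_vecI carrier_vecD index_zero_vec(1) index_zero_vec(2))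
  obtain \<phi> :: "'a alg_closure \<Rightarrow> 'a" where \<phi>: "\<And>a b. \<phi> (a + b) = \<phi> a + \<phi> b" "\<And>a b. \<phi> (to_ac a * b) = a * \<phi> b"
    "\<phi> (vec_index v i) = 1" by (rule to_ac_functional[OF i(2)]) (rule that)
  have "\<phi> 0 = 0" using \<phi>(2)[of 0 0] by simp
  then have \<phi>_sum: "\<phi> (sum f I) = (\<Sum>j\<in>I. \<phi> (f j))" for f and I :: "nat set"
    by (induction I rule: infinite_finite_induct) (auto simp: \<phi>(1))
  define w where "w = vec n (\<lambda>j. \<phi> (vec_index v j))"
  have w: "w \<in> carrier_vec n" by (simp add: w_def)
  have "\<exists>e. A *\<^sub>v w = e \<cdot>\<^sub>v w" if A: "A \<in> S" for A
  proof -
    obtain l where l: "almost_scalar n A l" using as[OF A] by blast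
    obtain e where "?h A *\<^sub>v v = e \<cdot>\<^sub>v v" using v(3)[OF A] by blast
    then have e: "?h A *\<^sub>v v = to_ac l \<cdot>\<^sub>v v" using almost_scalar_eigenvalue[OF as'[OF l] v(1,2)] by blast
    have "A *\<^sub>v w = l \<cdot>\<^sub>v w"
    proof (intro eq_vecI)
      fix j assume "j < dim_vec (l \<cdot>\<^sub>v w)"
      then have j: "j < n" using w by simp
      have "(\<Sum>k<n. to_ac (A $$ (j,k)) * vec_index v k) = vec_index (?h A *\<^sub>v v) j"
        using Sc[OF A] v(1) j by (auto simp: scalar_prod_def lessThan_atLeast0 intro!: sum.cong)
      also have "\<dots> = to_ac l * vec_index v j" unfolding e using v(1) j by simp
      finally have "\<phi> (\<Sum>k<n. to_ac (A $$ (j,k)) * vec_index v k) = \<phi> (to_ac l * vec_index v j)" by simp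
      then have "(\<Sum>k<n. A $$ (j,k) * \<phi> (vec_index v k)) = l * \<phi> (vec_index v j)"
        unfolding \<phi>_sum \<phi>(2) .
      moreover have "vec_index (A *\<^sub>v w) j = (\<Sum>k<n. A $$ (j,k) * \<phi> (vec_index v k))"
        using Sc[OF A] j by (auto simp: w_def scalar_prod_def lessThan_atLeast0 intro!: sum.cong)
      ultimately show "vec_index (A *\<^sub>v w) j = vec_index (l \<cdot>\<^sub>v w) j" using j by (simp add: w_def)
    qed (use Sc[OF A] w in auto)
    then show ?thesis by blast
  qed
  moreover have "w \<noteq> 0\<^sub>v n"
  proof
    assume "w = 0\<^sub>v n"
    then have "vec_index w i = 0" using i by simp
    then show False using i \<phi>(3) by (simp add: w_def)
  qed
  ultimately show ?thesis using w by blast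
qed

lemma common_eigenvector_quotient:
  fixes S :: "'a :: field mat set"
  assumes W: "lin_sub n W" and E: "lin_sub n E" and WE: "W \<subset> E" and S: "matrix_semigroup n S"
    and inv: "\<And>A x. A \<in> S \<Longrightarrow> x \<in> W \<Longrightarrow> A *\<^sub>v x \<in> W" "\<And>A x. A \<in> S \<Longrightarrow> x \<in> E \<Longrightarrow> A *\<^sub>v x \<in> E"
    and as: "\<And>A. A \<in> S \<Longrightarrow> \<exists>l k. \<forall>x\<in>E. char_matrix A l ^\<^sub>m k *\<^sub>v x \<in> W"
  shows "\<exists>v\<in>E. v \<notin> W \<and> (\<forall>A\<in>S. \<exists>e. A *\<^sub>v v - e \<cdot>\<^sub>v v \<in> W)"
proof -
  obtain m P where B: "basis_mat n m W E P" using basis_mat_exists[OF W E] by blast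
  interpret compression n m W E P by unfold_locales (use B W E WE in auto)
  have Sc: "A \<in> carrier_mat n n" if "A \<in> S" for A using S that by (auto simp: matrix_semigroup_def)
  have st: "stable A" if "A \<in> S" for A using Sc[OF that] inv that by (simp add: stable_def)
  have "0 < m" using size_pos assms(3) by blast
  then have "\<exists>c\<in>carrier_vec m. c \<noteq> 0\<^sub>v m \<and> (\<forall>Q\<in>cmp ` S. \<exists>e. Q *\<^sub>v c = e \<cdot>\<^sub>v c)"
    using common_eigenvector[OF cmp_semigroup[OF S st]] cmp_almost_scalar[OF st] as by blast
  then obtain c where c: "c \<in> carrier_vec m" "c \<noteq> 0\<^sub>v m" "\<And>A. A \<in> S \<Longrightarrow> \<exists>e. cmp A *\<^sub>v c = e \<cdot>\<^sub>v c" by blast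
  have "P *\<^sub>v c \<in> E" "P *\<^sub>v c \<notin> W" using basis_matD(2,3)[OF B c(1)] c(2) by auto
  then show ?thesis using cmp_eigenvector[OF st c(1)] c(3) by blast
qed

section \<open>Enlarging a subspace by one vector, and chains\<close>

definition adjoin :: "'a :: field vec set \<Rightarrow> 'a vec \<Rightarrow> 'a vec set" where
  "adjoin W v = {w + c \<cdot>\<^sub>v v | w c. w \<in> W}"

lemma adjoin_superset:
  assumes "lin_sub n W" "v \<in> carrier_vec n"
  shows "W \<subseteq> adjoin W v" "v \<in> adjoin W v"
proof -
  have "w = w + 0 \<cdot>\<^sub>v v" if "w \<in> W" for w using lin_subD(1)[OF assms(1) that] assms(2) by (intro eq_vecI) auto
  then show "W \<subseteq> adjoin W v" unfolding adjoin_def by blast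
  have "v = 0\<^sub>v n + 1 \<cdot>\<^sub>v v" using assms(2) by (intro eq_vecI) auto
  then show "v \<in> adjoin W v" using lin_subD(2)[OF assms(1)] unfolding adjoin_def by blast
qed

lemma lin_sub_adjoin:
  assumes W: "lin_sub n W" and v: "v \<in> carrier_vec n"
  shows "lin_sub n (adjoin W v)"
  unfolding lin_sub_def
proof (intro conjI ballI allI)
  show "adjoin W v \<subseteq> carrier_vec n" using lin_subD(1)[OF W] v by (auto simp: adjoin_def)
  show "0\<^sub>v n \<in> adjoin W v" using adjoin_superset[OF W v] lin_subD(2)[OF W] by blast
next
  fix x y assume "x \<in> adjoin W v" "y \<in> adjoin W v"
  then obtain a b c d where ab: "a \<in> W" "b \<in> W" "x = a + c \<cdot>\<^sub>v v" "y = b + d \<cdot>\<^sub>v v" by (auto simp: adjoin_def)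
  have "x + y = (a + b) + (c + d) \<cdot>\<^sub>v v"
    unfolding ab(3,4) using lin_subD(1)[OF W ab(1)] lin_subD(1)[OF W ab(2)] v by (intro eq_vecI) (auto simp: algebra_simps)
  then show "x + y \<in> adjoin W v" using lin_subD(3)[OF W ab(1,2)] unfolding adjoin_def by blast
next
  fix e x assume "x \<in> adjoin W v"
  then obtain a c where ab: "a \<in> W" "x = a + c \<cdot>\<^sub>v v" by (auto simp: adjoin_def)
  have "e \<cdot>\<^sub>v x = (e \<cdot>\<^sub>v a) + (e * c) \<cdot>\<^sub>v v"
    unfolding ab(2) using lin_subD(1)[OF W ab(1)] v by (intro eq_vecI) (auto simp: algebra_simps)
  then show "e \<cdot>\<^sub>v x \<in> adjoin W v" using lin_subD(4)[OF W ab(1)] unfolding adjoin_def by blast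
qed

lemma adjoin_subset:
  assumes "lin_sub n E" "W \<subseteq> E" "v \<in> E"
  shows "adjoin W v \<subseteq> E"
  using lin_subD(3)[OF assms(1) _ lin_subD(4)[OF assms(1,3)]] assms(2) by (auto simp: adjoin_def)

lemma sub_dim_adjoin:
  assumes W: "lin_sub n W" and v: "v \<in> carrier_vec n" "v \<notin> W"
  shows "sub_dim n (adjoin W v) = Suc (sub_dim n W)"
proof -
  define m where "m = sub_dim n W"
  obtain P where B: "basis_mat n m {0\<^sub>v n} W P" using sub_dim_basis[OF W] m_def by blast
  note E = lin_sub_adjoin[OF W v(1)]
  note ext = sub_dim_extend[OF W E adjoin_superset(1)[OF W v(1)] adjoin_superset(2)[OF W v(1)] v(2) B]
  have coord: "\<exists>c\<in>carrier_vec (Suc m). x - add_col n m P v *\<^sub>v c \<in> {0\<^sub>v n}" if x: "x \<in> adjoin W v" for x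
  proof -
    obtain w e where w: "w \<in> W" "x = w + e \<cdot>\<^sub>v v" using x by (auto simp: adjoin_def)
    obtain d where d: "d \<in> carrier_vec m" "w = P *\<^sub>v d" using basis_mat_coord[OF B W w(1)] by blast
    let ?c = "vec (Suc m) (\<lambda>i. if i < m then vec_index d i else e)"
    have "vec m (vec_index ?c) = d" using d(1) by (intro eq_vecI) auto
    then have "add_col n m P v *\<^sub>v ?c = x"
      using add_col_mult_vec[OF basis_matD(1)[OF B] v(1), of ?c] d(2) w(2) by simp
    then have "x - add_col n m P v *\<^sub>v ?c = 0\<^sub>v n" using lin_subD(1)[OF E x] by simp
    then show ?thesis by (intro bexI[of _ ?c]) auto
  qed
  have "basis_mat n (Suc m) {0\<^sub>v n} (adjoin W v) (add_col n m P v)"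
    unfolding basis_mat_def using ext coord by simp
  then show ?thesis using sub_dim_eqI[OF E] m_def by blast
qed

lemma sub_dim_zero: "sub_dim n {0\<^sub>v n :: 'a :: field vec} = 0"
proof (rule sub_dim_eqI[OF lin_sub_zero])
  have "\<exists>c\<in>carrier_vec 0. 0\<^sub>v n - 0\<^sub>m n 0 *\<^sub>v c \<in> {0\<^sub>v n :: 'a vec}"
    by (intro bexI[of _ "0\<^sub>v 0"]) (simp_all add: zero_mat_mult_vec)
  then show "basis_mat n 0 {0\<^sub>v n} {0\<^sub>v n} (0\<^sub>m n 0 :: 'a mat)"
    unfolding basis_mat_def by (auto simp: zero_mat_mult_vec)
qed

lemma sub_dim_carrier: "sub_dim n (carrier_vec n :: 'a :: field vec set) = n"
proof (rule sub_dim_eqI[OF lin_sub_carrier])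
  have "\<exists>c\<in>carrier_vec n. x - 1\<^sub>m n *\<^sub>v c \<in> {0\<^sub>v n}" if "x \<in> carrier_vec n" for x :: "'a vec"
    using that by (intro bexI[of _ x]) auto
  then show "basis_mat n n {0\<^sub>v n} (carrier_vec n) (1\<^sub>m n :: 'a mat)"
    unfolding basis_mat_def by simp
qed

lemma sub_dim_subset_eq:
  assumes "lin_sub n W" "lin_sub n E" "W \<subseteq> E" "sub_dim n W = sub_dim n E"
  shows "W = E"
  using sub_dim_strict_mono[OF assms(1,2)] assms(3,4) by auto

text \<open>A subspace of dimension 0 is zero and one of dimension \<open>n\<close> is everything,
  so the dimensions imply the two end conditions of the definition.\<close>

lemma triangularizable_iff:
  "triangularizable n C \<longleftrightarrow> (\<exists>V :: nat \<Rightarrow> 'a :: field vec set.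
    (\<forall>j<n. V j \<subseteq> V (Suc j)) \<and>
    (\<forall>j\<le>n. lin_sub n (V j) \<and> sub_dim n (V j) = j \<and> (\<forall>A\<in>C. \<forall>v\<in>V j. A *\<^sub>v v \<in> V j)))"
  (is "_ \<longleftrightarrow> (\<exists>V. ?chain V)")
proof
  assume "triangularizable n C"
  then obtain V :: "nat \<Rightarrow> 'a vec set" where "\<forall>j<n. V j \<subseteq> V (Suc j)"
    "\<forall>j\<le>n. VectorSpace.subspace class_ring (V j) (module_vec TYPE('a) n) \<and>
             vectorspace.dim class_ring ((module_vec TYPE('a) n)\<lparr>carrier := V j\<rparr>) = j \<and>
             (\<forall>A\<in>C. \<forall>v\<in>V j. A *\<^sub>v v \<in> V j)"
    unfolding triangularizable_def by blast
  then have "?chain V" using subspace_iff_lin_sub dim_eq_sub_dim by metis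
  then show "\<exists>V. ?chain V" by blast
next
  assume "\<exists>V. ?chain V"
  then obtain V where V: "?chain V" by blast
  have "{0\<^sub>v n} = V 0"
    by (rule sub_dim_subset_eq[of n]) (use V lin_subD(2)[of n "V 0"] in \<open>simp_all add: lin_sub_zero sub_dim_zero\<close>)
  moreover have "V n = carrier_vec n"
    by (rule sub_dim_subset_eq[of n]) (use V lin_subD(1)[of n "V n"] in \<open>auto simp: lin_sub_carrier sub_dim_carrier\<close>)
  ultimately show "triangularizable n C"
    unfolding triangularizable_def using V
    by (intro exI[of _ V]) (simp add: subspace_iff_lin_sub dim_eq_sub_dim)
qed

text \<open>Take the first \<open>V j\<close> of a triangularizing chain that is not contained in
  \<open>W\<close>, and \<open>w\<close> in it outside \<open>W\<close>. Its predecessor lies in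
  \<open>W\<close> and has dimension one less, so \<open>V j\<close> is the predecessor plus the
  line of \<open>w\<close>; thus members of \<open>C\<close> map \<open>w\<close> to multiples of
  \<open>w\<close> modulo \<open>W\<close>.\<close>

lemma triangularizable_eigenvector_quotient:
  assumes tri: "triangularizable n C" and W: "lin_sub n W" "W \<noteq> carrier_vec n"
  shows "\<exists>w\<in>carrier_vec n. w \<notin> W \<and> (\<forall>A\<in>C. \<exists>e. A *\<^sub>v w - e \<cdot>\<^sub>v w \<in> W)"
proof -
  obtain V where "(\<forall>j<n. V j \<subseteq> V (Suc j)) \<and>
    (\<forall>j\<le>n. lin_sub n (V j) \<and> sub_dim n (V j) = j \<and> (\<forall>A\<in>C. \<forall>v\<in>V j. A *\<^sub>v v \<in> V j))"
    using tri[unfolded triangularizable_iff] by (elim exE)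
  then have V: "\<And>j. j < n \<Longrightarrow> V j \<subseteq> V (Suc j)" "\<And>j. j \<le> n \<Longrightarrow> lin_sub n (V j)"
    "\<And>j. j \<le> n \<Longrightarrow> sub_dim n (V j) = j" "\<And>j A v. j \<le> n \<Longrightarrow> A \<in> C \<Longrightarrow> v \<in> V j \<Longrightarrow> A *\<^sub>v v \<in> V j"
    by simp_all
  have Vn: "V n = carrier_vec n"
    by (rule sub_dim_subset_eq[OF V(2) lin_sub_carrier]) (use lin_subD(1)[OF V(2)] V(3) in \<open>auto simp: sub_dim_carrier\<close>)
  define j where "j = (LEAST j. \<not> V j \<subseteq> W)"
  have n: "\<not> V n \<subseteq> W" using Vn W lin_subD(1)[OF W(1)] by blast
  have j: "\<not> V j \<subseteq> W" "j \<le> n" "\<And>i. i < j \<Longrightarrow> V i \<subseteq> W"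
    unfolding j_def using LeastI[of "\<lambda>j. \<not> V j \<subseteq> W", OF n] Least_le[of "\<lambda>j. \<not> V j \<subseteq> W", OF n]
    by (auto dest: not_less_Least)
  \<comment> \<open>This gives \<open>j\<close> a predecessor in the chain.\<close>
  have "V 0 \<subseteq> W"
  proof -
    have "{0\<^sub>v n} = V 0"
      by (rule sub_dim_subset_eq[OF lin_sub_zero V(2)]) (use lin_subD(2)[OF V(2)] V(3) in \<open>auto simp: sub_dim_zero\<close>)
    from this[symmetric] show ?thesis using lin_subD(2)[OF W(1)] by simp
  qed
  then obtain i where i: "j = Suc i" using j(1) by (cases j) auto
  have ij: "i < n" "V i \<subseteq> W" using i j by auto
  obtain w where w: "w \<in> V j" "w \<notin> W" using j(1) by blast
  have wc: "w \<in> carrier_vec n" using lin_subD(1)[OF V(2)[OF j(2)] w(1)] .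
  have Vi: "lin_sub n (V i)" using V(2) ij by simp
  have "adjoin (V i) w = V j"
  proof (rule sub_dim_subset_eq)
    show "lin_sub n (adjoin (V i) w)" by (rule lin_sub_adjoin[OF Vi wc])
    show "lin_sub n (V j)" using V(2) j by blast
    show "adjoin (V i) w \<subseteq> V j" using adjoin_subset[OF V(2)[OF j(2)] _ w(1)] V(1)[OF ij(1)] i by blast
    show "sub_dim n (adjoin (V i) w) = sub_dim n (V j)"
      using sub_dim_adjoin[OF Vi wc] w(2) ij V(3)[OF j(2)] V(3)[of i] i by auto
  qed
  then have "\<exists>e. A *\<^sub>v w - e \<cdot>\<^sub>v w \<in> W" if A: "A \<in> C" for A
  proof -
    have "A *\<^sub>v w \<in> adjoin (V i) w" using V(4)[OF j(2) A w(1)] \<open>adjoin (V i) w = V j\<close> by simp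
    then obtain y e where y: "y \<in> V i" "A *\<^sub>v w = y + e \<cdot>\<^sub>v w" by (auto simp: adjoin_def)
    have "A *\<^sub>v w - e \<cdot>\<^sub>v w = y" unfolding y(2) using lin_subD(1)[OF Vi y(1)] wc by (intro eq_vecI) auto
    then show ?thesis using y(1) ij by blast
  qed
  then show ?thesis using w wc by blast
qed

lemma mult_mat_vec_adjoin:
  assumes A: "A \<in> carrier_mat n n" and W: "lin_sub n W" "\<And>x. x \<in> W \<Longrightarrow> A *\<^sub>v x \<in> W"
    and v: "v \<in> carrier_vec n" "A *\<^sub>v v - e \<cdot>\<^sub>v v \<in> W" and x: "x \<in> adjoin W v"
  shows "A *\<^sub>v x \<in> adjoin W v"
proof -
  obtain w c where w: "w \<in> W" "x = w + c \<cdot>\<^sub>v v" using x by (auto simp: adjoin_def)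
  have wc: "w \<in> carrier_vec n" by (rule lin_subD(1)[OF W(1) w(1)])
  have "A *\<^sub>v v \<in> adjoin W v"
    by (rule lin_sub_diff_mem[OF lin_sub_adjoin[OF W(1) v(1)], of _ "e \<cdot>\<^sub>v v"])
      (use A v lin_subD(4)[OF lin_sub_adjoin[OF W(1) v(1)] adjoin_superset(2)[OF W(1) v(1)]]
        adjoin_superset(1)[OF W(1) v(1)] in auto)
  moreover have "A *\<^sub>v x = A *\<^sub>v w + c \<cdot>\<^sub>v (A *\<^sub>v v)"
    unfolding w(2) using mult_add_distrib_mat_vec[OF A wc, of "c \<cdot>\<^sub>v v"] mult_mat_vec[OF A v(1)] v(1) by simp
  moreover have "A *\<^sub>v w \<in> adjoin W v" using W(2)[OF w(1)] adjoin_superset(1)[OF W(1) v(1)] by blast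
  ultimately show ?thesis using lin_subD(3,4)[OF lin_sub_adjoin[OF W(1) v(1)]] by simp
qed

section \<open>Triangularizability of the semigroup\<close>

lemma pow_mat_preserves:
  fixes A :: "'a :: comm_semiring_1 mat"
  assumes "A \<in> carrier_mat n n" "W \<subseteq> carrier_vec n" "\<And>x. x \<in> W \<Longrightarrow> A *\<^sub>v x \<in> W" "x \<in> W"
  shows "A ^\<^sub>m k *\<^sub>v x \<in> W"
proof -
  have "((\<lambda>x. A *\<^sub>v x) ^^ k) x \<in> W" using assms(3,4) by (induction k) auto
  then show ?thesis using pow_mat_vec_funpow[OF assms(1), of x k] assms(2,4) by auto
qed

text \<open>\<open>\<T>\<close> acts by scalars \<open>\<tau>\<close> on the joint eigenspace of \<open>\<T>\<close> modulo \<open>W\<close>, and this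
  eigenspace is invariant under the nilpotent parts because they commute with \<open>\<T>\<close>; hence
  \<open>\<S>\<close> acts there by scalar plus nilpotent matrices.\<close>

lemma common_eigenvector_step:
  fixes \<T> \<S> :: "'a :: field mat set"
  assumes T: "\<T> \<subseteq> carrier_mat n n" and tri: "triangularizable n \<T>" and S: "matrix_semigroup n \<S>"
    and split: "\<forall>A\<in>\<S>. \<exists>T\<in>\<T>. \<exists>N\<in>commutant n \<T> \<inter> nilpotent_mats n. A = T + N"
    and W: "lin_sub n W" "W \<noteq> carrier_vec n" and inv: "\<And>A x. A \<in> \<T> \<union> \<S> \<Longrightarrow> x \<in> W \<Longrightarrow> A *\<^sub>v x \<in> W"
  shows "\<exists>v\<in>carrier_vec n. v \<notin> W \<and> (\<forall>A\<in>\<T> \<union> \<S>. \<exists>e. A *\<^sub>v v - e \<cdot>\<^sub>v v \<in> W)"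
proof -
  have Tc: "A \<in> carrier_mat n n" if "A \<in> \<T>" for A using T that by blast
  have Sc: "A \<in> carrier_mat n n" if "A \<in> \<S>" for A using S that by (auto simp: matrix_semigroup_def)
  obtain w where w: "w \<in> carrier_vec n" "w \<notin> W" "\<forall>A\<in>\<T>. \<exists>e. A *\<^sub>v w - e \<cdot>\<^sub>v w \<in> W"
    using triangularizable_eigenvector_quotient[OF tri W] by blast
  from bchoice[OF w(3)] obtain \<tau> where \<tau>: "\<And>A. A \<in> \<T> \<Longrightarrow> A *\<^sub>v w - \<tau> A \<cdot>\<^sub>v w \<in> W" by blast
  \<comment> \<open>All vectors with the same eigenvalues modulo \<open>W\<close> as
    \<open>w\<close>, so that each member of \<T> acts as one scalar on the whole of
    \<open>E/W\<close>.\<close>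
  define E where "E = {x \<in> carrier_vec n. \<forall>A\<in>\<T>. char_matrix A (\<tau> A) *\<^sub>v x \<in> W}"
  have ED: "x \<in> carrier_vec n" "A \<in> \<T> \<Longrightarrow> char_matrix A (\<tau> A) *\<^sub>v x \<in> W" if "x \<in> E" for x A
    using that by (auto simp: E_def)
  have E: "lin_sub n E"
  proof -
    have "lin_sub n {x \<in> carrier_vec n. char_matrix A (\<tau> A) *\<^sub>v x \<in> W}" if "A \<in> \<T>" for A
      by (rule lin_sub_preimage[OF char_matrix_closed[OF Tc[OF that]] W(1)])
    then show ?thesis unfolding E_def lin_sub_def by auto
  qed
  have WE: "W \<subseteq> E"
    unfolding E_def using lin_subD(1)[OF W(1)] char_matrix_preserves[OF W(1) Tc] inv by blast
  have "w \<in> E" unfolding E_def using w(1) \<tau> char_matrix_mult_vec[OF Tc w(1)] by simp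
  then have WE': "W \<subset> E" using WE w(2) by blast
  have N: "N *\<^sub>v x \<in> W" "y \<in> E \<Longrightarrow> N *\<^sub>v y \<in> E"
    if A: "A \<in> \<S>" "A = T + N" "T \<in> \<T>" "N \<in> commutant n \<T>" and x: "x \<in> W" for A T N x y
  proof -
    have Nc: "N \<in> carrier_mat n n" and comm: "\<And>B. B \<in> \<T> \<Longrightarrow> N * B = B * N"
      using A(4) by (auto simp: commutant_def)
    have NW: "N *\<^sub>v x \<in> W" if x: "x \<in> W" for x
    proof -
      have xc: "x \<in> carrier_vec n" by (rule lin_subD(1)[OF W(1) x])
      \<comment> \<open>\<open>N\<close> is the difference of \<open>A\<close> and \<open>T\<close>,
        which both preserve \<open>W\<close>; commuting with \<T> alone would not give this.\<close>
      have "N *\<^sub>v x = A *\<^sub>v x - T *\<^sub>v x"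
        unfolding A(2) add_mult_distrib_mat_vec[OF Tc[OF A(3)] Nc xc]
        using carrier_vecD[OF mult_mat_vec_carrier[OF Tc[OF A(3)] xc]] carrier_vecD[OF mult_mat_vec_carrier[OF Nc xc]]
        by (intro eq_vecI) (simp_all del: index_mult_mat_vec dim_mult_mat_vec)
      then show ?thesis using lin_sub_minus[OF W(1)] inv A x by auto
    qed
    then show "N *\<^sub>v x \<in> W" using x by blast
    show "N *\<^sub>v y \<in> E" if y: "y \<in> E"
    proof -
      note yc = ED(1)[OF y]
      have Ny: "N *\<^sub>v y \<in> carrier_vec n" using Nc yc by simp
      have "char_matrix B (\<tau> B) *\<^sub>v (N *\<^sub>v y) \<in> W" if B: "B \<in> \<T>" for B
      proof -
        have "B *\<^sub>v (N *\<^sub>v y) = N *\<^sub>v (B *\<^sub>v y)"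
          using assoc_mult_mat_vec[OF Tc[OF B] Nc yc] assoc_mult_mat_vec[OF Nc Tc[OF B] yc] comm[OF B] by simp
        moreover have "N *\<^sub>v (B *\<^sub>v y - \<tau> B \<cdot>\<^sub>v y) = N *\<^sub>v (B *\<^sub>v y) - \<tau> B \<cdot>\<^sub>v (N *\<^sub>v y)"
          using mult_minus_distrib_mat_vec[OF Nc mult_mat_vec_carrier[OF Tc[OF B] yc], of "\<tau> B \<cdot>\<^sub>v y"]
            mult_mat_vec[OF Nc yc] yc by simp
        ultimately have "char_matrix B (\<tau> B) *\<^sub>v (N *\<^sub>v y) = N *\<^sub>v (char_matrix B (\<tau> B) *\<^sub>v y)"
          unfolding char_matrix_mult_vec[OF Tc[OF B] Ny] char_matrix_mult_vec[OF Tc[OF B] yc] by simp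
        then show ?thesis using NW[OF ED(2)[OF y B]] by simp
      qed
      then show ?thesis using Ny unfolding E_def by blast
    qed
  qed
  have TE: "T *\<^sub>v x \<in> E" if B: "T \<in> \<T>" and x: "x \<in> E" for T x
  proof -
    have "T *\<^sub>v x - \<tau> T \<cdot>\<^sub>v x \<in> E" using ED(2)[OF x B] char_matrix_mult_vec[OF Tc[OF B] ED(1)[OF x]] WE by auto
    then show ?thesis
      by (rule lin_sub_diff_mem[OF E mult_mat_vec_carrier[OF Tc[OF B] ED(1)[OF x]] lin_subD(4)[OF E x]])
  qed
  have "\<exists>v\<in>E. v \<notin> W \<and> (\<forall>A\<in>\<S>. \<exists>e. A *\<^sub>v v - e \<cdot>\<^sub>v v \<in> W)"
  proof (rule common_eigenvector_quotient[OF W(1) E WE' S])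
    show "A *\<^sub>v x \<in> W" if "A \<in> \<S>" "x \<in> W" for A x using inv that by blast
    show SE: "A *\<^sub>v x \<in> E" if A: "A \<in> \<S>" and x: "x \<in> E" for A x
    proof -
      obtain T N where TN: "T \<in> \<T>" "N \<in> commutant n \<T>" "A = T + N" using split A by blast
      have Nc: "N \<in> carrier_mat n n" using TN by (auto simp: commutant_def)
      show ?thesis
        unfolding TN(3) add_mult_distrib_mat_vec[OF Tc[OF TN(1)] Nc ED(1)[OF x]]
        by (rule lin_subD(3)[OF E TE[OF TN(1) x] N(2)[OF A TN(3,1,2) lin_subD(2)[OF W(1)] x]])
    qed
    fix A assume A: "A \<in> \<S>"
    obtain T M where TN: "T \<in> \<T>" "M \<in> commutant n \<T>" "M \<in> nilpotent_mats n" "A = T + M" using split A by blast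
    obtain k where k: "M ^\<^sub>m k = 0\<^sub>m n n" and Mc: "M \<in> carrier_mat n n" using TN(3) by (auto simp: nilpotent_mats_def)
    note Ac = Sc[OF A] and Tc' = Tc[OF TN(1)]
    let ?C = "char_matrix A (\<tau> T)"
    note C = char_matrix_closed[OF Ac, of "\<tau> T"]
    have MW: "M *\<^sub>v x \<in> W" if "x \<in> W" for x using N(1)[OF A TN(4,1,2)] that by blast
    \<comment> \<open>On \<open>E\<close> the matrix \<open>A - \<tau> T\<close> agrees with
      \<open>M\<close> modulo \<open>W\<close>, because \<open>T - \<tau> T\<close> sends
      \<open>E\<close> into \<open>W\<close>. Their powers stay congruent, since \<open>M\<close>
      preserves \<open>W\<close> and \<open>A - \<tau> T\<close> preserves \<open>E\<close>; hence
      the \<open>k\<close>-th power sends \<open>E\<close> into \<open>W\<close>.\<close>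
    have pow: "?C ^\<^sub>m j *\<^sub>v x - M ^\<^sub>m j *\<^sub>v x \<in> W" if "x \<in> E" for j x
      using that
    proof (induction j arbitrary: x)
      case 0
      then show ?case using ED(1)[OF 0] carrier_matD(1)[OF C] carrier_matD(1)[OF Mc] lin_subD(2)[OF W(1)] by simp
    next
      case (Suc j)
      note xc = ED(1)[OF Suc.prems]
      define y where "y = ?C *\<^sub>v x"
      have y: "y \<in> E" unfolding y_def by (rule char_matrix_preserves[OF E Ac SE[OF A] Suc.prems])
      have yc: "y \<in> carrier_vec n" by (rule ED(1)[OF y])
      have Mx: "M *\<^sub>v x \<in> carrier_vec n" using Mc xc by simp
      have "y - M *\<^sub>v x = char_matrix T (\<tau> T) *\<^sub>v x"
        unfolding y_def char_matrix_mult_vec[OF Ac xc] char_matrix_mult_vec[OF Tc' xc]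
        unfolding TN(4) add_mult_distrib_mat_vec[OF Tc' Mc xc]
        using carrier_vecD[OF mult_mat_vec_carrier[OF Tc' xc]] carrier_vecD[OF Mx] carrier_vecD[OF xc]
        by (intro eq_vecI) (simp_all del: index_mult_mat_vec dim_mult_mat_vec)
      then have "y - M *\<^sub>v x \<in> W" using ED(2)[OF Suc.prems TN(1)] by simp
      then have "M ^\<^sub>m j *\<^sub>v (y - M *\<^sub>v x) \<in> W"
        using pow_mat_preserves[OF Mc _ MW] lin_subD(1)[OF W(1)] by blast
      then have d: "M ^\<^sub>m j *\<^sub>v y - M ^\<^sub>m j *\<^sub>v (M *\<^sub>v x) \<in> W"
        using mult_minus_distrib_mat_vec[OF pow_carrier_mat[OF Mc] yc Mx] by simp
      have "?C ^\<^sub>m j *\<^sub>v y - M ^\<^sub>m j *\<^sub>v (M *\<^sub>v x) \<in> W"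
        by (rule lin_sub_diff_trans[OF W(1) _ _ _ Suc.IH[OF y] d])
          (rule mult_mat_vec_carrier[OF pow_carrier_mat[OF C] yc] mult_mat_vec_carrier[OF pow_carrier_mat[OF Mc] yc]
            mult_mat_vec_carrier[OF pow_carrier_mat[OF Mc] Mx])+
      then show ?case unfolding pow_mat_Suc_vec[OF C xc] pow_mat_Suc_vec[OF Mc xc] y_def .
    qed
    have "?C ^\<^sub>m k *\<^sub>v x \<in> W" if x: "x \<in> E" for x
      using lin_sub_diff_mem[OF W(1) mult_mat_vec_carrier[OF pow_carrier_mat[OF C] ED(1)[OF x]] _ pow[OF x]]
        k zero_mat_mult_vec[OF ED(1)[OF x]] lin_subD(2)[OF W(1)] by metis
    then show "\<exists>l k. \<forall>x\<in>E. char_matrix A l ^\<^sub>m k *\<^sub>v x \<in> W" by blast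
  qed
  then obtain v where v: "v \<in> E" "v \<notin> W" "\<And>A. A \<in> \<S> \<Longrightarrow> \<exists>e. A *\<^sub>v v - e \<cdot>\<^sub>v v \<in> W" by blast
  have "A *\<^sub>v v - \<tau> A \<cdot>\<^sub>v v \<in> W" if "A \<in> \<T>" for A
    using ED(2)[OF v(1) that] char_matrix_mult_vec[OF Tc[OF that] ED(1)[OF v(1)]] by simp
  then show ?thesis using v ED(1)[OF v(1)] by blast
qed

theorem theorem2p3:
  fixes n :: nat and \<T> \<S> :: "'a :: field mat set"
  assumes "\<T> \<subseteq> carrier_mat n n"
    and "triangularizable n \<T>"
    and "matrix_semigroup n \<S>"
    and "\<forall>A\<in>\<S>. \<exists>T\<in>\<T>. \<exists>N\<in>commutant n \<T> \<inter> nilpotent_mats n. A = T + N"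
  shows "triangularizable n \<S>"
proof -
  have c: "A \<in> carrier_mat n n" if "A \<in> \<T> \<union> \<S>" for A
    using that assms(1,3) by (auto simp: matrix_semigroup_def)
  \<comment> \<open>Dependent choice yields an infinite sequence, so the dimension is capped at
    \<open>n\<close>, after which the chain is constant. Invariance under \<T> is carried along
    because the extension step requires it.\<close>
  define good where "good j W \<longleftrightarrow> lin_sub n W \<and> sub_dim n W = min j n \<and>
    (\<forall>A\<in>\<T> \<union> \<S>. \<forall>x\<in>W. A *\<^sub>v x \<in> W)" for j and W :: "'a vec set"
  have "\<exists>V. \<forall>j. good j (V j) \<and> V j \<subseteq> V (Suc j)"
  proof (rule dependent_nat_choice)
    have "A *\<^sub>v 0\<^sub>v n = 0\<^sub>v n" if "A \<in> \<T> \<union> \<S>" for A using c[OF that] by (intro eq_vecI) auto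
    then have "good 0 {0\<^sub>v n}" unfolding good_def by (simp add: lin_sub_zero sub_dim_zero)
    then show "\<exists>W. good 0 W" by blast
  next
    fix W j assume W: "good j W"
    then have Ws: "lin_sub n W" "sub_dim n W = min j n" "\<And>A x. A \<in> \<T> \<union> \<S> \<Longrightarrow> x \<in> W \<Longrightarrow> A *\<^sub>v x \<in> W"
      by (auto simp: good_def)
    show "\<exists>W'. good (Suc j) W' \<and> W \<subseteq> W'"
    proof (cases "j < n")
      case True
      then have "W \<noteq> carrier_vec n" using Ws(2) sub_dim_carrier[of n, where 'a = 'a] by auto
      then obtain v where v: "v \<in> carrier_vec n" "v \<notin> W" "\<And>A. A \<in> \<T> \<union> \<S> \<Longrightarrow> \<exists>e. A *\<^sub>v v - e \<cdot>\<^sub>v v \<in> W"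
        using common_eigenvector_step[OF assms Ws(1) _ Ws(3)] by blast
      have "A *\<^sub>v x \<in> adjoin W v" if A: "A \<in> \<T> \<union> \<S>" and x: "x \<in> adjoin W v" for A x
        using v(3)[OF A] mult_mat_vec_adjoin[OF c[OF A] Ws(1) Ws(3)[OF A] v(1) _ x] by blast
      then have "good (Suc j) (adjoin W v)"
        unfolding good_def using lin_sub_adjoin[OF Ws(1) v(1)] sub_dim_adjoin[OF Ws(1) v(1,2)] Ws(2) True by simp
      then show ?thesis using adjoin_superset(1)[OF Ws(1) v(1)] by blast
    next
      case False
      then have "good (Suc j) W" using W unfolding good_def by simp
      then show ?thesis by blast
    qed
  qed
  then obtain V where V: "\<And>j. good j (V j)" "\<And>j. V j \<subseteq> V (Suc j)" by blast
  show ?thesis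
    unfolding triangularizable_iff using V unfolding good_def by (intro exI[of _ V]) simp
qed

end
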